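(* Let $H$ be a Hopf algebra, let $\mathcal{A}$ be an algebra on which $H$ acts from the left compatibly with the product (i.e. $\mathcal{A}$ is a left $H$-module algebra), and let $\Psi\in H\otimes H$ be an invertible element satisfying $$\Psi_{12}\,(\Delta\otimes\mathrm{id})\Psi=\Psi_{23}\,(\mathrm{id}\otimes\Delta)\Psi,\qquad (\epsilon\otimes\mathrm{id})\Psi=1=(\mathrm{id}\otimes\epsilon)\Psi .$$ Let $H_\Psi$ be the twisted Hopf algebra and $\mathcal{A}_\Psi$ the deformed algebra with product $*$ (both defined in the context). Then the formula $$T\triangleright\underline{a}=\underline{(t\triangleright a)}\qquad (T\in H_\Psi,\ \underline{a}\in\mathcal{A}_\Psi),$$ where $t\in H$ is the element corresponding to $T$, defines an action of the Hopf algebra $H_\Psi$ on $\mathcal{A}_\Psi$, compatible with the deformed product: for all $T\in H_\Psi$ and $\underline{a},\underline{b}\in\mathcal{A}_\Psi$, $$T\triangleright(\underline{a}*\underline{b})=(T_{(1)}\triangleright\underline{a})*(T_{(2)}\triangleright\underline{b}),\qquad\text{where } T_{(1)}\otimes T_{(2)}=\Delta_\Psi(T).$$ In particular, this applies to the twist $\Psi_c=\lambda^{-h_1\otimes h_2}$: the Hopf algebra $H_\lambda:=H_{\Psi_c}$ acts in this way on the isospectral deformation $\mathcal{A}_\lambda:=\mathcal{A}_{\Psi_c}$.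
   Context: Twisted Hopf algebra $H_\Psi$: as an algebra it is identical to $H$ (the element of $H_\Psi$ corresponding to $t\in H$ is written with the capital letter $T$). Its coproduct is $\Delta_\Psi(T)=\Psi\,\Delta(t)\,\Psi^{-1}$, its counit is $\epsilon(T)=\epsilon(t)$, and its antipode is $S_\Psi(T)=U\,S(t)\,U^{-1}$ with $U=\Psi_{(1)}S(\Psi_{(2)})$, where $\Psi=\Psi_{(1)}\otimes\Psi_{(2)}$ (summation understood). Here $\Psi_{12}=\Psi\otimes 1$ and $\Psi_{23}=1\otimes\Psi$. Deformed algebra $\mathcal{A}_\Psi$: as a vector space it is a copy of $\mathcal{A}$, via a linear bijection $\mathcal{A}\ni a\mapsto\underline{a}\in\mathcal{A}_\Psi$ (the quantization map). Its associative product is $\underline{a}*\underline{b}=\underline{m\left(\Psi^{-1}\triangleright(a\otimes b)\right)}$, where $m:\mathcal{A}\otimes\mathcal{A}\to\mathcal{A}$ is the multiplication of $\mathcal{A}$ and $H\otimes H$ acts on $\mathcal{A}\otimes\mathcal{A}$ factorwise. Isospectral (Cartan) case: $H$ contains two commuting elements $h_1,h_2$ with $\Delta h_i=1\otimes h_i+h_i\otimes 1$, acting on $\mathcal{A}$ as generators of independent $U(1)$ symmetries. Thus $\mathcal{A}$ is spanned by homogeneous elements, where $a$ has degree $(n_1^a,n_2^a)\in\mathbb{Z}^2$ if $h_i\triangleright a=n_i^a a$. Let $\lambda\in\mathbb{C}$ with $|\lambda|=1$. The element $\lambda^{-h_1\otimes h_2}$ is regarded as an invertible element of $H\otimes H$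 (suitably completed so that it contains such exponentials, with the usual rules for exponentials of commuting elements). It acts on $a\otimes b$, with $a,b$ homogeneous, by the scalar $\lambda^{-n_1^a n_2^b}$. Hence the product of $\mathcal{A}_\lambda$ is $\underline{a}*\underline{b}=\lambda^{n_1^a n_2^b}\,\underline{ab}$ on homogeneous elements, extended linearly, and the coproduct of $H_\lambda$ is $\Delta_\lambda(T)=\lambda^{-h_1\otimes h_2}\,\Delta(t)\,\lambda^{h_1\otimes h_2}$. *)

theory Defs
  imports Complex_Main "HOL-Library.Poly_Mapping"
begin

section \<open>Complex vector spaces and complex algebras\<close>

class scaleC =
  fixes scaleC :: "complex \<Rightarrow> 'a \<Rightarrow> 'a"  (infixr \<open>*\<^sub>C\<close> 75)

class complex_vector = scaleC + ab_group_add +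
  assumes scaleC_add_right: "c *\<^sub>C (x + y) = c *\<^sub>C x + c *\<^sub>C y"
    and scaleC_add_left: "(c + d) *\<^sub>C x = c *\<^sub>C x + d *\<^sub>C x"
    and scaleC_scaleC: "c *\<^sub>C d *\<^sub>C x = (c * d) *\<^sub>C x"
    and scaleC_one: "1 *\<^sub>C x = x"

text \<open>Associative unital algebras; unlike in \<^class>\<open>ring_1\<close>, the zero algebra is allowed.\<close>

class complex_algebra_1 = complex_vector + ring + monoid_mult +
  assumes mult_scaleC_left: "c *\<^sub>C x * y = c *\<^sub>C (x * y)"
    and mult_scaleC_right: "x * c *\<^sub>C y = c *\<^sub>C (x * y)"

instantiation complex :: complex_algebra_1
begin

definition scaleC_complex :: "complex \<Rightarrow> complex \<Rightarrow> complex"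
  where "scaleC_complex c x = c * x"

instance
  by standard (simp_all add: scaleC_complex_def algebra_simps)

end

global_interpretation complex_vector: vector_space "scaleC :: complex \<Rightarrow> 'a \<Rightarrow> 'a::complex_vector"
  by standard (simp_all add: scaleC_add_right scaleC_add_left scaleC_scaleC scaleC_one)

abbreviation clinear :: "('a::complex_vector \<Rightarrow> 'b::complex_vector) \<Rightarrow> bool"
  where "clinear \<equiv> Vector_Spaces.linear scaleC scaleC"

lemma clinear_iff:
  "clinear f \<longleftrightarrow> (\<forall>x y. f (x + y) = f x + f y) \<and> (\<forall>c x. f (c *\<^sub>C x) = c *\<^sub>C f x)"
  unfolding module_hom_iff_linear[symmetric] module_hom_iff
  using complex_vector.module_axioms[where 'a = 'a] complex_vector.module_axioms[where 'a = 'b]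
  by auto

definition cbilinear :: "('a::complex_vector \<Rightarrow> 'b::complex_vector \<Rightarrow> 'c::complex_vector) \<Rightarrow> bool"
  where "cbilinear f \<longleftrightarrow> (\<forall>a. clinear (f a)) \<and> (\<forall>b. clinear (\<lambda>a. f a b))"

lemma cbilinear_simps:
  assumes "cbilinear f"
  shows "f (a + a') b = f a b + f a' b" "f a (b + b') = f a b + f a b'"
    "f (c *\<^sub>C a) b = c *\<^sub>C f a b" "f a (c *\<^sub>C b) = c *\<^sub>C f a b"
  using assms by (auto simp: cbilinear_def clinear_iff)

lemma cbilinearI:
  assumes "\<And>a a' b. f (a + a') b = f a b + f a' b" "\<And>a b b'. f a (b + b') = f a b + f a b'"
    "\<And>c a b. f (c *\<^sub>C a) b = c *\<^sub>C f a b" "\<And>c a b. f a (c *\<^sub>C b) = c *\<^sub>C f a b"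
  shows "cbilinear f"
  using assms by (auto simp: cbilinear_def clinear_iff)


section \<open>The tensor product\<close>

text \<open>The quotient of the free vector space on \<open>'a \<times> 'b\<close> by the bilinearity relations.  As the
  relations are imposed with every coefficient \<open>d\<close>, the additive submonoid generated by them is
  a complex subspace.\<close>

inductive_set tensor_null :: "('a::complex_vector \<times> 'b::complex_vector \<Rightarrow>\<^sub>0 complex) set" where
  zero: "0 \<in> tensor_null"
| add: "p \<in> tensor_null \<Longrightarrow> r \<in> tensor_null \<Longrightarrow> p + r \<in> tensor_null"
| add_left: "Poly_Mapping.single (a + a', b) d - Poly_Mapping.single (a, b) d
      - Poly_Mapping.single (a', b) d \<in> tensor_null"
| add_right: "Poly_Mapping.single (a, b + b') d - Poly_Mapping.single (a, b) d
      - Poly_Mapping.single (a, b') d \<in> tensor_null"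
| scale_left: "Poly_Mapping.single (c *\<^sub>C a, b) d - Poly_Mapping.single (a, b) (d * c) \<in> tensor_null"
| scale_right: "Poly_Mapping.single (a, c *\<^sub>C b) d - Poly_Mapping.single (a, b) (d * c) \<in> tensor_null"

definition tensor_rel ::
    "('a::complex_vector \<times> 'b::complex_vector \<Rightarrow>\<^sub>0 complex) \<Rightarrow> ('a \<times> 'b \<Rightarrow>\<^sub>0 complex) \<Rightarrow> bool"
  where "tensor_rel p r \<longleftrightarrow> p - r \<in> tensor_null"

definition free_scale :: "complex \<Rightarrow> ('k \<Rightarrow>\<^sub>0 complex) \<Rightarrow> ('k \<Rightarrow>\<^sub>0 complex)"
  where "free_scale c p = Poly_Mapping.map ((*) c) p"

lemma lookup_free_scale [simp]: "Poly_Mapping.lookup (free_scale c p) k = c * Poly_Mapping.lookup p k"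
  by (simp add: free_scale_def Poly_Mapping.map.rep_eq when_def)

lemma free_scale_simps:
  "free_scale c (p + r) = free_scale c p + free_scale c r"
  "free_scale c (p - r) = free_scale c p - free_scale c r"
  "free_scale (c + d) p = free_scale c p + free_scale d p"
  "free_scale c (free_scale d p) = free_scale (c * d) p"
  "free_scale 1 p = p"
  "free_scale c 0 = 0"
  "free_scale c (Poly_Mapping.single k d) = Poly_Mapping.single k (c * d)"
  "free_scale (- 1) p = - p"
  by (rule poly_mapping_eqI; simp add: lookup_add lookup_minus lookup_single when_def algebra_simps)+

lemma tensor_null_scale: "p \<in> tensor_null \<Longrightarrow> free_scale c p \<in> tensor_null"
proof (induction rule: tensor_null.induct)
  case (scale_left e a b d)
  show ?case
    using tensor_null.scale_left[of e a b "c * d"] by (simp add: free_scale_simps mult.assoc)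
next
  case (scale_right a e b d)
  show ?case
    using tensor_null.scale_right[of a e b "c * d"] by (simp add: free_scale_simps mult.assoc)
next
  case (add_left a a' b d)
  show ?case
    using tensor_null.add_left[of a a' b "c * d"] by (simp add: free_scale_simps)
next
  case (add_right a b b' d)
  show ?case
    using tensor_null.add_right[of a b b' "c * d"] by (simp add: free_scale_simps)
qed (simp_all add: free_scale_simps tensor_null.zero tensor_null.add)

lemma tensor_null_uminus: "p \<in> tensor_null \<Longrightarrow> - p \<in> tensor_null"
  using tensor_null_scale[of p "- 1"] by (simp add: free_scale_simps)

lemma equivp_tensor_rel:
  "equivp (tensor_rel :: ('a::complex_vector \<times> 'b::complex_vector \<Rightarrow>\<^sub>0 complex) \<Rightarrow> _)"
proof (rule equivpI)
  show "reflp (tensor_rel :: ('a \<times> 'b \<Rightarrow>\<^sub>0 complex) \<Rightarrow> _)"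
    by (simp add: reflp_def tensor_rel_def tensor_null.zero)
  show "symp (tensor_rel :: ('a \<times> 'b \<Rightarrow>\<^sub>0 complex) \<Rightarrow> _)"
  proof (rule sympI)
    fix p r :: "('a \<times> 'b) \<Rightarrow>\<^sub>0 complex"
    assume "tensor_rel p r"
    then have "- (p - r) \<in> tensor_null"
      unfolding tensor_rel_def by (rule tensor_null_uminus)
    then show "tensor_rel r p"
      by (simp add: tensor_rel_def)
  qed
  show "transp (tensor_rel :: ('a \<times> 'b \<Rightarrow>\<^sub>0 complex) \<Rightarrow> _)"
  proof (rule transpI)
    fix p r s :: "('a \<times> 'b) \<Rightarrow>\<^sub>0 complex"
    assume "tensor_rel p r" "tensor_rel r s"
    then have "(p - r) + (r - s) \<in> tensor_null"
      unfolding tensor_rel_def by (rule tensor_null.add)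
    then show "tensor_rel p s"
      by (simp add: tensor_rel_def)
  qed
qed

quotient_type (overloaded) ('a, 'b) tensor =
    "'a::complex_vector \<times> 'b::complex_vector \<Rightarrow>\<^sub>0 complex" / tensor_rel
  by (rule equivp_tensor_rel)

type_notation tensor  (infixr \<open>\<otimes>\<close> 80)

instantiation tensor :: (complex_vector, complex_vector) complex_vector
begin

lift_definition zero_tensor :: "'a \<otimes> 'b" is 0 .

lift_definition plus_tensor :: "'a \<otimes> 'b \<Rightarrow> 'a \<otimes> 'b \<Rightarrow> 'a \<otimes> 'b" is "(+)"
  by (auto simp: tensor_rel_def add_diff_add intro: tensor_null.add)

lift_definition uminus_tensor :: "'a \<otimes> 'b \<Rightarrow> 'a \<otimes> 'b" is uminus
  using tensor_null_uminus by (fastforce simp: tensor_rel_def)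

lift_definition minus_tensor :: "'a \<otimes> 'b \<Rightarrow> 'a \<otimes> 'b \<Rightarrow> 'a \<otimes> 'b" is "(-)"
proof -
  fix p p' r r' :: "'a \<times> 'b \<Rightarrow>\<^sub>0 complex"
  assume "tensor_rel p p'" "tensor_rel r r'"
  then have "(p - p') + - (r - r') \<in> tensor_null"
    unfolding tensor_rel_def by (intro tensor_null.add tensor_null_uminus)
  then show "tensor_rel (p - r) (p' - r')"
    by (simp add: tensor_rel_def algebra_simps)
qed

lift_definition scaleC_tensor :: "complex \<Rightarrow> 'a \<otimes> 'b \<Rightarrow> 'a \<otimes> 'b" is free_scale
  by (simp add: tensor_rel_def tensor_null_scale flip: free_scale_simps(2))

instance
proof
  fix x y z :: "'a \<otimes> 'b" and c d :: complex
  show "x + y + z = x + (y + z)"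
    by transfer (simp add: tensor_rel_def tensor_null.zero add.assoc)
  show "x + y = y + x"
    by transfer (simp add: tensor_rel_def tensor_null.zero add.commute)
  show "0 + x = x"
    by transfer (simp add: tensor_rel_def tensor_null.zero)
  show "- x + x = 0"
    by transfer (simp add: tensor_rel_def tensor_null.zero)
  show "x - y = x + - y"
    by transfer (simp add: tensor_rel_def tensor_null.zero)
  show "c *\<^sub>C (x + y) = c *\<^sub>C x + c *\<^sub>C y"
    by transfer (simp add: tensor_rel_def tensor_null.zero free_scale_simps)
  show "(c + d) *\<^sub>C x = c *\<^sub>C x + d *\<^sub>C x"
    by transfer (simp add: tensor_rel_def tensor_null.zero free_scale_simps)
  show "c *\<^sub>C d *\<^sub>C x = (c * d) *\<^sub>C x"
    by transfer (simp add: tensor_rel_def tensor_null.zero free_scale_simps)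
  show "1 *\<^sub>C x = x"
    by transfer (simp add: tensor_rel_def tensor_null.zero free_scale_simps)
qed

end

lift_definition tensor_of :: "'a::complex_vector \<Rightarrow> 'b::complex_vector \<Rightarrow> 'a \<otimes> 'b"  (infixr \<open>\<otimes>\<close> 80)
  is "\<lambda>a b. Poly_Mapping.single (a, b) 1" .

lemma cbilinear_tensor_of: "cbilinear (\<otimes>)"
proof (rule cbilinearI)
  fix a a' :: 'a and b b' :: 'b and c :: complex
  show "(a + a') \<otimes> b = a \<otimes> b + a' \<otimes> b"
    by transfer (use tensor_null.add_left in \<open>simp add: tensor_rel_def diff_diff_eq\<close>)
  show "a \<otimes> (b + b') = a \<otimes> b + a \<otimes> b'"
    by transfer (use tensor_null.add_right in \<open>simp add: tensor_rel_def diff_diff_eq\<close>)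
  show "(c *\<^sub>C a) \<otimes> b = c *\<^sub>C (a \<otimes> b)"
    by transfer (use tensor_null.scale_left[of _ _ _ 1] in \<open>simp add: tensor_rel_def free_scale_simps\<close>)
  show "a \<otimes> (c *\<^sub>C b) = c *\<^sub>C (a \<otimes> b)"
    by transfer (use tensor_null.scale_right[of _ _ _ 1] in \<open>simp add: tensor_rel_def free_scale_simps\<close>)
qed

lemmas tensor_of_simps = cbilinear_simps[OF cbilinear_tensor_of]

lemma tensor_induct [case_names tensor_of add, induct type: tensor]:
  fixes x :: "'a::complex_vector \<otimes> 'b::complex_vector"
  assumes of: "\<And>a b. P (a \<otimes> b)" and add: "\<And>x y. P x \<Longrightarrow> P y \<Longrightarrow> P (x + y)"
  shows "P x"
proof (induction x rule: tensor.abs_induct)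
  case (1 p)
  have single: "abs_tensor (Poly_Mapping.single (a, b) d) = (d *\<^sub>C a) \<otimes> b" for a b and d :: complex
  proof -
    have "abs_tensor (Poly_Mapping.single (a, b) d) = d *\<^sub>C (a \<otimes> b)"
      by (simp only: tensor_of.abs_eq scaleC_tensor.abs_eq free_scale_simps mult_1_right)
    then show ?thesis
      by (simp add: tensor_of_simps)
  qed
  have zero: "P 0"
    using of[of "0" "0"] tensor_of_simps(3)[of 0 "0 :: 'a" "0 :: 'b"] by simp
  show ?case
  proof (induction p rule: Poly_Mapping.update_induct)
    case const
    then show ?case using zero by (simp add: zero_tensor.abs_eq)
  next
    case (update p k v)
    have "Poly_Mapping.update k v p = p + Poly_Mapping.single k v"
      using update by (intro poly_mapping_eqI)
        (auto simp: lookup_update lookup_add lookup_single in_keys_iff)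
    then have "abs_tensor (Poly_Mapping.update k v p) = abs_tensor p + (v *\<^sub>C fst k) \<otimes> snd k"
      by (simp only: plus_tensor.abs_eq[symmetric] single[symmetric] prod.collapse)
    then show ?case
      using add[OF update(3) of] by simp
  qed
qed

definition tensor_lift ::
    "('a::complex_vector \<Rightarrow> 'b::complex_vector \<Rightarrow> 'c::complex_vector) \<Rightarrow> 'a \<otimes> 'b \<Rightarrow> 'c"
  where "tensor_lift f = (THE g. clinear g \<and> (\<forall>a b. g (a \<otimes> b) = f a b))"


lemma tensor_lift_exists:
  fixes f :: "'a::complex_vector \<Rightarrow> 'b::complex_vector \<Rightarrow> 'c::complex_vector"
  assumes f: "cbilinear f"
  shows "\<exists>g. clinear g \<and> (\<forall>a b. g (a \<otimes> b) = f a b)"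
proof -
  note fs = cbilinear_simps[OF f] and vs = scaleC_add_right scaleC_add_left scaleC_scaleC
  define ev where "ev p = (\<Sum>k\<in>Poly_Mapping.keys p. Poly_Mapping.lookup p k *\<^sub>C f (fst k) (snd k))"
    for p :: "'a \<times> 'b \<Rightarrow>\<^sub>0 complex"
  have sup: "ev p = (\<Sum>k\<in>K. Poly_Mapping.lookup p k *\<^sub>C f (fst k) (snd k))"
    if "finite K" "Poly_Mapping.keys p \<subseteq> K" for p K
    unfolding ev_def using that by (intro sum.mono_neutral_left) (auto simp: in_keys_iff)
  have ev_add: "ev (p + r) = ev p + ev r" for p r
  proof -
    let ?K = "Poly_Mapping.keys p \<union> Poly_Mapping.keys r"
    have "ev (p + r) = (\<Sum>k\<in>?K. Poly_Mapping.lookup (p + r) k *\<^sub>C f (fst k) (snd k))"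
      using Poly_Mapping.keys_add[of p r] by (intro sup) auto
    also have "\<dots> = ev p + ev r"
      by (simp add: sup[of ?K p] sup[of ?K r] lookup_add vs sum.distrib)
    finally show ?thesis .
  qed
  have ev_scale: "ev (free_scale c p) = c *\<^sub>C ev p" for c p
  proof -
    have "ev (free_scale c p) =
        (\<Sum>k\<in>Poly_Mapping.keys p. Poly_Mapping.lookup (free_scale c p) k *\<^sub>C f (fst k) (snd k))"
      by (intro sup) (auto simp: in_keys_iff)
    then show ?thesis
      by (simp add: ev_def complex_vector.scale_sum_right vs)
  qed
  have ev_uminus: "ev (- p) = - ev p" for p
    using ev_scale[of "- 1" p] by (simp add: free_scale_simps)
  have ev_minus: "ev (p - r) = ev p - ev r" for p r
    using ev_add[of p "- r"] by (simp add: ev_uminus)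
  have ev_single: "ev (Poly_Mapping.single (a, b) d) = d *\<^sub>C f a b" for a b d
    using sup[of "{(a, b)}" "Poly_Mapping.single (a, b) d"] by (simp add: keys_single)
  have null: "ev p = 0" if "p \<in> tensor_null" for p
    using that
  proof induction
    case zero
    then show ?case using ev_scale[of 0 0] by (simp add: free_scale_simps)
  qed (simp_all add: ev_add ev_minus ev_single fs vs)
  define g where "g x = ev (rep_tensor x)" for x :: "'a \<otimes> 'b"
  have g_abs: "g (abs_tensor p) = ev p" for p
  proof -
    have "tensor_rel (rep_tensor (abs_tensor p)) p"
      using Quotient3_rep_abs[OF Quotient3_tensor] equivp_reflp[OF equivp_tensor_rel] by blast
    then show ?thesis
      using null ev_minus by (fastforce simp: tensor_rel_def g_def)
  qed
  have "g (x + y) = g x + g y" for x y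
    by (induction x rule: tensor.abs_induct; induction y rule: tensor.abs_induct)
      (simp add: plus_tensor.abs_eq g_abs ev_add)
  moreover have "g (c *\<^sub>C x) = c *\<^sub>C g x" for c x
    by (induction x rule: tensor.abs_induct) (simp add: scaleC_tensor.abs_eq g_abs ev_scale)
  moreover have "g (a \<otimes> b) = f a b" for a b
    by (simp add: tensor_of.abs_eq g_abs ev_single)
  ultimately show ?thesis
    unfolding clinear_iff by blast
qed

lemma tensor_ext:
  assumes "clinear g" "clinear h" "\<And>a b. g (a \<otimes> b) = h (a \<otimes> b)"
  shows "g x = h x"
  using assms(1,2) by (induction x) (simp_all add: assms(3) clinear_iff)

lemma
  assumes "cbilinear f"
  shows clinear_tensor_lift: "clinear (tensor_lift f)"
    and tensor_lift_of: "tensor_lift f (a \<otimes> b) = f a b"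
proof -
  have "\<exists>!g. clinear g \<and> (\<forall>a b. g (a \<otimes> b) = f a b)"
    using tensor_lift_exists[OF assms] by (metis tensor_ext ext)
  from theI'[OF this] show "clinear (tensor_lift f)" "tensor_lift f (a \<otimes> b) = f a b"
    unfolding tensor_lift_def by auto
qed

lemma tensor_lift_simps:
  assumes "cbilinear f"
  shows "tensor_lift f (x + y) = tensor_lift f x + tensor_lift f y"
    "tensor_lift f (c *\<^sub>C x) = c *\<^sub>C tensor_lift f x"
  using clinear_tensor_lift[OF assms] by (auto simp: clinear_iff)

lemma cbilinear_tensor_lift:
  assumes "\<And>x. cbilinear (f x)" "\<And>a b. clinear (\<lambda>x. f x a b)"
  shows "cbilinear (\<lambda>x. tensor_lift (f x))"
proof (rule cbilinearI)
  show "tensor_lift (f (x + x')) y = tensor_lift (f x) y + tensor_lift (f x') y" for x x' y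
    using assms(2) by (induction y)
      (simp_all add: assms(1) tensor_lift_of tensor_lift_simps clinear_iff)
  show "tensor_lift (f (c *\<^sub>C x)) y = c *\<^sub>C tensor_lift (f x) y" for c x y
    using assms(2) by (induction y)
      (simp_all add: assms(1) tensor_lift_of tensor_lift_simps clinear_iff scaleC_add_right)
qed (simp_all add: assms(1) tensor_lift_simps)

definition tensor_map ::
    "('a::complex_vector \<Rightarrow> 'c::complex_vector) \<Rightarrow> ('b::complex_vector \<Rightarrow> 'd::complex_vector) \<Rightarrow>
      'a \<otimes> 'b \<Rightarrow> 'c \<otimes> 'd"
  where "tensor_map f g = tensor_lift (\<lambda>a b. f a \<otimes> g b)"

definition tensor_assoc ::
    "('a::complex_vector \<otimes> 'b::complex_vector) \<otimes> 'c::complex_vector \<Rightarrow> 'a \<otimes> ('b \<otimes> 'c)"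
  where "tensor_assoc = tensor_lift (\<lambda>x c. tensor_lift (\<lambda>a b. a \<otimes> (b \<otimes> c)) x)"

instantiation tensor :: (complex_algebra_1, complex_algebra_1) complex_algebra_1
begin

definition one_tensor :: "'a \<otimes> 'b"
  where "one_tensor = 1 \<otimes> 1"

definition times_tensor :: "'a \<otimes> 'b \<Rightarrow> 'a \<otimes> 'b \<Rightarrow> 'a \<otimes> 'b"
  where "times_tensor x y = tensor_lift (\<lambda>a b. tensor_lift (\<lambda>c d. (a * c) \<otimes> (b * d)) y) x"

lemma cbilinear_times_tensor: "cbilinear (\<lambda>x y :: 'a \<otimes> 'b. x * y)"
  and tensor_of_times_aux: "(a \<otimes> b) * (c \<otimes> d) = (a * c) \<otimes> (b * d :: 'b)" for a c :: 'a
proof -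
  note simps = tensor_of_simps algebra_simps mult_scaleC_left mult_scaleC_right
    scaleC_add_right
  have 1: "cbilinear (\<lambda>c d. (a * c) \<otimes> (b * d))" for a :: 'a and b :: 'b
    by (rule cbilinearI) (simp_all add: simps)
  have 2: "cbilinear (\<lambda>a :: 'a. tensor_lift (\<lambda>c d. (a * c) \<otimes> (b * d :: 'b)))" for b
    by (rule cbilinear_tensor_lift[OF 1]) (simp add: clinear_iff simps)
  have 3: "cbilinear (\<lambda>b. tensor_lift (\<lambda>c d. (a * c) \<otimes> (b * d :: 'b)))" for a :: 'a
    by (rule cbilinear_tensor_lift[OF 1]) (simp add: clinear_iff simps)
  have 4: "cbilinear (\<lambda>a b. tensor_lift (\<lambda>c d. (a * c) \<otimes> (b * d)) y)" for y :: "'a \<otimes> 'b"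
    by (rule cbilinearI) (simp_all add: cbilinear_simps[OF 2] cbilinear_simps[OF 3])
  have "cbilinear (\<lambda>y x :: 'a \<otimes> 'b. x * y)"
    unfolding times_tensor_def
    by (rule cbilinear_tensor_lift[OF 4]) (simp add: clinear_tensor_lift[OF 1])
  then show "cbilinear (\<lambda>x y :: 'a \<otimes> 'b. x * y)"
    by (auto simp: cbilinear_def)
  show "(a \<otimes> b) * (c \<otimes> d) = (a * c) \<otimes> (b * d :: 'b)" for a c :: 'a
    unfolding times_tensor_def by (subst tensor_lift_of[OF 4], subst tensor_lift_of[OF 1]) (rule refl)
qed

instance
proof
  note bil = cbilinear_simps[OF cbilinear_times_tensor]
  fix x y z :: "'a \<otimes> 'b" and c :: complex
  have of: "(a \<otimes> b) * (d \<otimes> e) * z = (a \<otimes> b) * ((d \<otimes> e) * z)" for a d :: 'a and b e :: 'b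
    by (induction z) (simp_all add: tensor_of_times_aux bil mult.assoc)
  have of': "(a \<otimes> b) * y * z = (a \<otimes> b) * (y * z)" for a :: 'a and b :: 'b
    by (induction y) (simp_all add: of bil)
  show "x * y * z = x * (y * z)"
    by (induction x) (simp_all add: of' bil)
  show "1 * x = x" "x * 1 = x"
    by (induction x) (simp_all add: one_tensor_def tensor_of_times_aux bil)
qed (simp_all add: cbilinear_simps[OF cbilinear_times_tensor])

end

lemmas tensor_of_times = tensor_of_times_aux


section \<open>Hopf algebras, module algebras, and twists\<close>

text \<open>A sum \<open>\<Sum> f (x\<^sub>(\<^sub>1\<^sub>)) (x\<^sub>(\<^sub>2\<^sub>))\<close> in Sweedler notation, for \<open>x = \<Sum> x\<^sub>(\<^sub>1\<^sub>) \<otimes> x\<^sub>(\<^sub>2\<^sub>)\<close>, is \<open>tensor_lift f x\<close>.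
  In particular \<open>\<epsilon> \<otimes> id\<close> and \<open>id \<otimes> \<epsilon>\<close>, followed by the identification of
  \<open>\<complex> \<otimes> H\<close> and \<open>H \<otimes> \<complex>\<close> with \<open>H\<close>, are the following maps.\<close>

definition counit_left :: "('h::complex_vector \<Rightarrow> complex) \<Rightarrow> 'h \<otimes> 'h \<Rightarrow> 'h"
  where "counit_left \<epsilon> = tensor_lift (\<lambda>s t. \<epsilon> s *\<^sub>C t)"

definition counit_right :: "('h::complex_vector \<Rightarrow> complex) \<Rightarrow> 'h \<otimes> 'h \<Rightarrow> 'h"
  where "counit_right \<epsilon> = tensor_lift (\<lambda>s t. \<epsilon> t *\<^sub>C s)"

text \<open>\<open>\<Delta> \<otimes> id\<close> with values in \<open>H \<otimes> (H \<otimes> H)\<close>, and the embeddings \<open>x \<mapsto> x\<^sub>1\<^sub>2\<close>, \<open>x \<mapsto> x\<^sub>2\<^sub>3\<close>.\<close>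

definition coprod_left :: "('h::complex_vector \<Rightarrow> 'h \<otimes> 'h) \<Rightarrow> 'h \<otimes> 'h \<Rightarrow> 'h \<otimes> 'h \<otimes> 'h"
  where "coprod_left \<Delta> x = tensor_assoc (tensor_map \<Delta> id x)"

definition coprod_right :: "('h::complex_vector \<Rightarrow> 'h \<otimes> 'h) \<Rightarrow> 'h \<otimes> 'h \<Rightarrow> 'h \<otimes> 'h \<otimes> 'h"
  where "coprod_right \<Delta> = tensor_map id \<Delta>"

definition leg12 :: "'h::complex_algebra_1 \<otimes> 'h \<Rightarrow> 'h \<otimes> 'h \<otimes> 'h"
  where "leg12 x = tensor_assoc (x \<otimes> 1)"

definition leg23 :: "'h::complex_algebra_1 \<otimes> 'h \<Rightarrow> 'h \<otimes> 'h \<otimes> 'h"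
  where "leg23 x = 1 \<otimes> x"

locale hopf_algebra =
  fixes \<Delta> :: "'h::complex_algebra_1 \<Rightarrow> 'h \<otimes> 'h"
    and \<epsilon> :: "'h \<Rightarrow> complex"
    and S :: "'h \<Rightarrow> 'h"
  assumes clinear_coprod: "clinear \<Delta>"
    and coprod_mult: "\<Delta> (s * t) = \<Delta> s * \<Delta> t"
    and coprod_one: "\<Delta> 1 = 1"
    and clinear_counit: "clinear \<epsilon>"
    and counit_mult: "\<epsilon> (s * t) = \<epsilon> s * \<epsilon> t"
    and counit_one: "\<epsilon> 1 = 1"
    and coassoc: "coprod_left \<Delta> (\<Delta> t) = coprod_right \<Delta> (\<Delta> t)"
    and counit_left: "counit_left \<epsilon> (\<Delta> t) = t"
    and counit_right: "counit_right \<epsilon> (\<Delta> t) = t"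
    and clinear_antipode: "clinear S"
    and antipode_left: "tensor_lift (\<lambda>t\<^sub>1 t\<^sub>2. S t\<^sub>1 * t\<^sub>2) (\<Delta> t) = \<epsilon> t *\<^sub>C 1"
    and antipode_right: "tensor_lift (\<lambda>t\<^sub>1 t\<^sub>2. t\<^sub>1 * S t\<^sub>2) (\<Delta> t) = \<epsilon> t *\<^sub>C 1"

text \<open>The algebra acted upon and its deformation share one underlying vector space, so their
  products are explicit parameters.\<close>

locale unital_algebra =
  fixes m :: "'a::complex_vector \<Rightarrow> 'a \<Rightarrow> 'a" and e :: 'a
  assumes bilinear: "cbilinear m"
    and assoc: "m (m a b) c = m a (m b c)"
    and left_unit: "m e a = a"
    and right_unit: "m a e = a"

locale left_action =
  fixes act :: "'h::complex_algebra_1 \<Rightarrow> 'a::complex_vector \<Rightarrow> 'a"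
  assumes act_bilinear: "cbilinear act"
    and act_mult: "act (s * t) a = act s (act t a)"
    and act_one: "act 1 a = a"

locale module_algebra = hopf_algebra \<Delta> \<epsilon> S + left_action act + unital_algebra m e
  for \<Delta> :: "'h::complex_algebra_1 \<Rightarrow> 'h \<otimes> 'h" and \<epsilon> S
    and act :: "'h \<Rightarrow> 'a::complex_vector \<Rightarrow> 'a" and m e +
  assumes act_product: "act t (m a b) = tensor_lift (\<lambda>t\<^sub>1 t\<^sub>2. m (act t\<^sub>1 a) (act t\<^sub>2 b)) (\<Delta> t)"
    and act_unit: "act t e = \<epsilon> t *\<^sub>C e"

definition tensor_action ::
    "('h::complex_vector \<Rightarrow> 'a::complex_vector \<Rightarrow> 'a) \<Rightarrow> 'h \<otimes> 'h \<Rightarrow> 'a \<otimes> 'a \<Rightarrow> 'a \<otimes> 'a"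
  where "tensor_action act x v = tensor_lift (\<lambda>s t. tensor_map (act s) (act t) v) x"

definition is_inverse :: "'r::monoid_mult \<Rightarrow> 'r \<Rightarrow> bool"
  where "is_inverse x y \<longleftrightarrow> x * y = 1 \<and> y * x = 1"

definition inverse_of :: "'r::monoid_mult \<Rightarrow> 'r"
  where "inverse_of x = (THE y. is_inverse x y)"

definition drinfeld_twist ::
    "('h::complex_algebra_1 \<Rightarrow> 'h \<otimes> 'h) \<Rightarrow> ('h \<Rightarrow> complex) \<Rightarrow> 'h \<otimes> 'h \<Rightarrow> bool"
  where "drinfeld_twist \<Delta> \<epsilon> \<Psi> \<longleftrightarrow>
    (\<exists>\<Psi>'. is_inverse \<Psi> \<Psi>') \<and>
    leg12 \<Psi> * coprod_left \<Delta> \<Psi> = leg23 \<Psi> * coprod_right \<Delta> \<Psi> \<and>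
    counit_left \<epsilon> \<Psi> = 1 \<and> counit_right \<epsilon> \<Psi> = 1"

definition twisted_coprod ::
    "('h::complex_algebra_1 \<Rightarrow> 'h \<otimes> 'h) \<Rightarrow> 'h \<otimes> 'h \<Rightarrow> 'h \<Rightarrow> 'h \<otimes> 'h"
  where "twisted_coprod \<Delta> \<Psi> t = \<Psi> * \<Delta> t * inverse_of \<Psi>"

definition twisted_antipode :: "('h::complex_algebra_1 \<Rightarrow> 'h) \<Rightarrow> 'h \<otimes> 'h \<Rightarrow> 'h \<Rightarrow> 'h"
  where "twisted_antipode S \<Psi> t =
    (let U = tensor_lift (\<lambda>s t. s * S t) \<Psi> in U * S t * inverse_of U)"

text \<open>The deformed algebra lives on an arbitrary copy of the vector space \<open>A\<close>, with quantization
  map \<open>q\<close> (a linear bijection).  The twisted algebra is the algebra \<open>H\<close> itself, so that \<open>T\<close> and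
  \<open>t\<close> are the same element.\<close>

definition deformed_product ::
    "('a::complex_vector \<Rightarrow> 'b) \<Rightarrow> ('h::complex_algebra_1 \<Rightarrow> 'a \<Rightarrow> 'a) \<Rightarrow> ('a \<Rightarrow> 'a \<Rightarrow> 'a) \<Rightarrow>
      'h \<otimes> 'h \<Rightarrow> 'b \<Rightarrow> 'b \<Rightarrow> 'b"
  where "deformed_product q act m \<Psi> x y =
    q (tensor_lift m (tensor_action act (inverse_of \<Psi>) (inv q x \<otimes> inv q y)))"

definition quantized_action :: "('a \<Rightarrow> 'b) \<Rightarrow> ('h \<Rightarrow> 'a \<Rightarrow> 'a) \<Rightarrow> 'h \<Rightarrow> 'b \<Rightarrow> 'b"
  where "quantized_action q act t x = q (act t (inv q x))"


section \<open>Completion with respect to integral weight modules\<close>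

text \<open>Let \<open>C\<close> be a set of elements of an algebra \<open>R\<close>.  A left ideal \<open>I\<close> is a weight ideal if
  \<open>R / I\<close> is spanned by joint eigenvectors of \<open>C\<close> with integer eigenvalues.  The completion of
  \<open>R\<close> is the inverse limit of the quotients \<open>R / I\<close> over all weight ideals; an element is encoded
  as the family of cosets \<open>I \<mapsto> x I\<close>, with the dummy value \<open>{}\<close> if \<open>I\<close> is not a weight ideal.
  The completion acts on every \<open>R\<close>-module in which the vectors are sums of joint eigenvectors of
  \<open>C\<close> with integer eigenvalues, since there the annihilator of a vector is a weight ideal.\<close>

type_synonym 'r completed = "'r set \<Rightarrow> 'r set"

definition left_ideal :: "'r::complex_algebra_1 set \<Rightarrow> bool"
  where "left_ideal I \<longleftrightarrow> 0 \<in> I \<and> (\<forall>x\<in>I. \<forall>y\<in>I. x + y \<in> I) \<and> (\<forall>r. \<forall>x\<in>I. r * x \<in> I)"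

definition weight_ideal :: "'r::complex_algebra_1 set \<Rightarrow> 'r set \<Rightarrow> bool"
  where "weight_ideal C I \<longleftrightarrow> left_ideal I \<and>
    complex_vector.span {r. \<forall>c\<in>C. \<exists>n::int. c * r - of_int n *\<^sub>C r \<in> I} = UNIV"

definition completion :: "'r::complex_algebra_1 set \<Rightarrow> 'r completed set"
  where "completion C = {x.
    (\<forall>I. if weight_ideal C I then \<exists>r. x I = {s. s - r \<in> I} else x I = {}) \<and>
    (\<forall>I J. weight_ideal C I \<longrightarrow> weight_ideal C J \<longrightarrow> I \<subseteq> J \<longrightarrow> x I \<subseteq> x J)}"

definition completion_of :: "'r::complex_algebra_1 set \<Rightarrow> 'r \<Rightarrow> 'r completed"
  where "completion_of C r I = (if weight_ideal C I then {s. s - r \<in> I} else {})"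

text \<open>On \<open>R / I\<close> the element \<open>y\<close> sends \<open>1 + I\<close> to \<open>r + I\<close> for \<open>r \<in> y I\<close>, and the annihilator of
  \<open>r + I\<close> is \<open>{z. z * r \<in> I}\<close>.\<close>

definition completion_mult ::
    "'r::complex_algebra_1 set \<Rightarrow> 'r completed \<Rightarrow> 'r completed \<Rightarrow> 'r completed"
  where "completion_mult C x y I =
    (if weight_ideal C I then {s. \<exists>r\<in>y I. \<exists>u\<in>x {z. z * r \<in> I}. s - u * r \<in> I} else {})"

text \<open>The extension of an algebra homomorphism \<open>f\<close> to the completions, provided that preimages
  under \<open>f\<close> of weight ideals are weight ideals.\<close>

definition completion_map ::
    "'s::complex_algebra_1 set \<Rightarrow> ('r::complex_algebra_1 \<Rightarrow> 's) \<Rightarrow> 'r completed \<Rightarrow> 's completed"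
  where "completion_map D f x J =
    (if weight_ideal D J then {s. \<exists>r\<in>x (f -` J). s - f r \<in> J} else {})"

definition completion_act ::
    "('r \<Rightarrow> 'v::complex_vector \<Rightarrow> 'v) \<Rightarrow> 'r completed \<Rightarrow> 'v \<Rightarrow> 'v"
  where "completion_act act x v = (THE w. \<exists>r\<in>x {z. act z v = 0}. w = act r v)"

text \<open>The exponential \<open>\<lambda>\<^sup>y\<close> of an element \<open>y\<close> that is diagonalizable with integer eigenvalues on
  every \<open>R / I\<close>: it multiplies an eigenvector of eigenvalue \<open>n\<close> by \<open>\<lambda>\<^sup>n\<close>.  Below, \<open>1 + I\<close> is
  decomposed into eigenvectors \<open>r n + I\<close>.\<close>

definition completion_exp ::
    "'r::complex_algebra_1 set \<Rightarrow> complex \<Rightarrow> 'r \<Rightarrow> 'r completed"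
  where "completion_exp C lam y I = (if weight_ideal C I
    then {s. \<exists>N r. finite N \<and> (\<forall>n\<in>N. y * r n - of_int n *\<^sub>C r n \<in> I) \<and>
      1 - (\<Sum>n\<in>N. r n) \<in> I \<and> s - (\<Sum>n\<in>N. (lam powi n) *\<^sub>C r n) \<in> I}
    else {})"


section \<open>The Cartan twist\<close>

definition cartan_pair ::
    "('h::complex_algebra_1 \<Rightarrow> 'h \<otimes> 'h) \<Rightarrow> 'h \<Rightarrow> 'h \<Rightarrow> bool"
  where "cartan_pair \<Delta> h\<^sub>1 h\<^sub>2 \<longleftrightarrow> h\<^sub>1 * h\<^sub>2 = h\<^sub>2 * h\<^sub>1 \<and>
    \<Delta> h\<^sub>1 = 1 \<otimes> h\<^sub>1 + h\<^sub>1 \<otimes> 1 \<and> \<Delta> h\<^sub>2 = 1 \<otimes> h\<^sub>2 + h\<^sub>2 \<otimes> 1"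

definition homogeneous ::
    "('h \<Rightarrow> 'a::complex_vector \<Rightarrow> 'a) \<Rightarrow> 'h \<Rightarrow> 'h \<Rightarrow> int \<Rightarrow> int \<Rightarrow> 'a \<Rightarrow> bool"
  where "homogeneous act h\<^sub>1 h\<^sub>2 n\<^sub>1 n\<^sub>2 a \<longleftrightarrow>
    act h\<^sub>1 a = of_int n\<^sub>1 *\<^sub>C a \<and> act h\<^sub>2 a = of_int n\<^sub>2 *\<^sub>C a"

definition cartan2 :: "'h::complex_algebra_1 set \<Rightarrow> ('h \<otimes> 'h) set"
  where "cartan2 C = (\<lambda>h. h \<otimes> 1) ` C \<union> (\<lambda>h. 1 \<otimes> h) ` C"

definition cartan3 :: "'h::complex_algebra_1 set \<Rightarrow> ('h \<otimes> 'h \<otimes> 'h) set"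
  where "cartan3 C = (\<lambda>h. h \<otimes> 1) ` C \<union> (\<lambda>x. 1 \<otimes> x) ` cartan2 C"


text \<open>Twists, twisted coproducts and deformed products for \<open>\<Psi>\<close> in the completion of \<open>H \<otimes> H\<close>, with
  inverse \<open>\<Psi>'\<close>.\<close>

definition completed_twist ::
    "('h::complex_algebra_1 \<Rightarrow> 'h \<otimes> 'h) \<Rightarrow> ('h \<Rightarrow> complex) \<Rightarrow> 'h set \<Rightarrow>
      ('h \<otimes> 'h) completed \<Rightarrow> ('h \<otimes> 'h) completed \<Rightarrow> bool"
  where "completed_twist \<Delta> \<epsilon> C \<Psi> \<Psi>' \<longleftrightarrow>
    \<Psi> \<in> completion (cartan2 C) \<and> \<Psi>' \<in> completion (cartan2 C) \<and>
    completion_mult (cartan2 C) \<Psi> \<Psi>' = completion_of (cartan2 C) 1 \<and>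
    completion_mult (cartan2 C) \<Psi>' \<Psi> = completion_of (cartan2 C) 1 \<and>
    completion_mult (cartan3 C) (completion_map (cartan3 C) leg12 \<Psi>)
        (completion_map (cartan3 C) (coprod_left \<Delta>) \<Psi>) =
      completion_mult (cartan3 C) (completion_map (cartan3 C) leg23 \<Psi>)
        (completion_map (cartan3 C) (coprod_right \<Delta>) \<Psi>) \<and>
    completion_map C (counit_left \<epsilon>) \<Psi> = completion_of C 1 \<and>
    completion_map C (counit_right \<epsilon>) \<Psi> = completion_of C 1"

definition completed_twisted_coprod ::
    "('h::complex_algebra_1 \<Rightarrow> 'h \<otimes> 'h) \<Rightarrow> 'h set \<Rightarrow>
      ('h \<otimes> 'h) completed \<Rightarrow> ('h \<otimes> 'h) completed \<Rightarrow>
      'h \<Rightarrow> ('h \<otimes> 'h) completed"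
  where "completed_twisted_coprod \<Delta> C \<Psi> \<Psi>' t =
    completion_mult (cartan2 C)
      (completion_mult (cartan2 C) \<Psi> (completion_of (cartan2 C) (\<Delta> t))) \<Psi>'"

text \<open>For a coproduct \<open>D\<close> with values in the completion of \<open>H \<otimes> H\<close>, the extensions \<open>DL\<close> of
  \<open>D \<otimes> id\<close> and \<open>DR\<close> of \<open>id \<otimes> D\<close> to this completion have to be supplied.\<close>

definition completed_bialgebra ::
    "'h::complex_algebra_1 set \<Rightarrow> ('h \<Rightarrow> ('h \<otimes> 'h) completed) \<Rightarrow>
      (('h \<otimes> 'h) completed \<Rightarrow> ('h \<otimes> 'h \<otimes> 'h) completed) \<Rightarrow>
      (('h \<otimes> 'h) completed \<Rightarrow> ('h \<otimes> 'h \<otimes> 'h) completed) \<Rightarrow>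
      ('h \<Rightarrow> complex) \<Rightarrow> bool"
  where "completed_bialgebra C D DL DR \<epsilon> \<longleftrightarrow>
    (\<forall>t. D t \<in> completion (cartan2 C)) \<and>
    (\<forall>s t. D (s * t) = completion_mult (cartan2 C) (D s) (D t)) \<and>
    D 1 = completion_of (cartan2 C) 1 \<and>
    (\<forall>t. DL (D t) = DR (D t)) \<and>
    (\<forall>t. completion_map C (counit_left \<epsilon>) (D t) = completion_of C t) \<and>
    (\<forall>t. completion_map C (counit_right \<epsilon>) (D t) = completion_of C t)"

text \<open>As \<open>D T = \<Psi> \<Delta>(t) \<Psi>\<^sup>-\<^sup>1\<close>, the extension of \<open>D \<otimes> id\<close> is \<open>x \<mapsto> \<Psi>\<^sub>1\<^sub>2 (\<Delta> \<otimes> id)(x) \<Psi>\<^sub>1\<^sub>2\<^sup>-\<^sup>1\<close>.\<close>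

definition completed_coprod_left ::
    "('h::complex_algebra_1 \<Rightarrow> 'h \<otimes> 'h) \<Rightarrow> 'h set \<Rightarrow>
      ('h \<otimes> 'h) completed \<Rightarrow> ('h \<otimes> 'h) completed \<Rightarrow>
      ('h \<otimes> 'h) completed \<Rightarrow> ('h \<otimes> 'h \<otimes> 'h) completed"
  where "completed_coprod_left \<Delta> C \<Psi> \<Psi>' x =
    completion_mult (cartan3 C)
      (completion_mult (cartan3 C) (completion_map (cartan3 C) leg12 \<Psi>)
        (completion_map (cartan3 C) (coprod_left \<Delta>) x))
      (completion_map (cartan3 C) leg12 \<Psi>')"

definition completed_coprod_right ::
    "('h::complex_algebra_1 \<Rightarrow> 'h \<otimes> 'h) \<Rightarrow> 'h set \<Rightarrow>
      ('h \<otimes> 'h) completed \<Rightarrow> ('h \<otimes> 'h) completed \<Rightarrow>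
      ('h \<otimes> 'h) completed \<Rightarrow> ('h \<otimes> 'h \<otimes> 'h) completed"
  where "completed_coprod_right \<Delta> C \<Psi> \<Psi>' x =
    completion_mult (cartan3 C)
      (completion_mult (cartan3 C) (completion_map (cartan3 C) leg23 \<Psi>)
        (completion_map (cartan3 C) (coprod_right \<Delta>) x))
      (completion_map (cartan3 C) leg23 \<Psi>')"

definition completed_deformed_product ::
    "('a::complex_vector \<Rightarrow> 'b) \<Rightarrow> ('h::complex_algebra_1 \<Rightarrow> 'a \<Rightarrow> 'a) \<Rightarrow> ('a \<Rightarrow> 'a \<Rightarrow> 'a) \<Rightarrow>
      ('h \<otimes> 'h) completed \<Rightarrow> 'b \<Rightarrow> 'b \<Rightarrow> 'b"
  where "completed_deformed_product q act m \<Psi>' x y =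
    q (tensor_lift m (completion_act (tensor_action act) \<Psi>' (inv q x \<otimes> inv q y)))"

text \<open>\<open>(T\<^sub>(\<^sub>1\<^sub>) \<triangleright> a) * (T\<^sub>(\<^sub>2\<^sub>) \<triangleright> b)\<close> is obtained by letting \<open>D T\<close> act factorwise on \<open>a \<otimes> b\<close> and then
  multiplying.\<close>

definition completed_module_algebra ::
    "('h::complex_algebra_1 \<Rightarrow> ('h \<otimes> 'h) completed) \<Rightarrow> ('h \<Rightarrow> complex) \<Rightarrow>
      ('h \<Rightarrow> 'a::complex_vector \<Rightarrow> 'a) \<Rightarrow> ('a \<Rightarrow> 'a \<Rightarrow> 'a) \<Rightarrow> 'a \<Rightarrow> bool"
  where "completed_module_algebra D \<epsilon> act m e \<longleftrightarrow>
    left_action act \<and> unital_algebra m e \<and>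
    (\<forall>t a b. act t (m a b) = tensor_lift m (completion_act (tensor_action act) (D t) (a \<otimes> b))) \<and>
    (\<forall>t. act t e = \<epsilon> t *\<^sub>C e)"

definition cartan_twist :: "complex \<Rightarrow> 'h::complex_algebra_1 \<Rightarrow> 'h \<Rightarrow> ('h \<otimes> 'h) completed"
  where "cartan_twist lam h\<^sub>1 h\<^sub>2 = completion_exp (cartan2 {h\<^sub>1, h\<^sub>2}) lam (- (h\<^sub>1 \<otimes> h\<^sub>2))"

definition cartan_twist_inverse ::
    "complex \<Rightarrow> 'h::complex_algebra_1 \<Rightarrow> 'h \<Rightarrow> ('h \<otimes> 'h) completed"
  where "cartan_twist_inverse lam h\<^sub>1 h\<^sub>2 = completion_exp (cartan2 {h\<^sub>1, h\<^sub>2}) lam (h\<^sub>1 \<otimes> h\<^sub>2)"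

end

theory Submission
  imports Defs
begin

text \<open>
  For a twist \<open>\<Psi>\<close> in \<open>H \<otimes> H\<close>, with inverse \<open>F\<close>, compatibility of the action with the deformed product
  follows from the rule \<open>\<Delta>(t) F = F \<Delta>\<^sub>\<Psi>(t)\<close>.  Since \<open>a * b\<close> is the product of \<open>F \<triangleright> (a \<otimes> b)\<close>, and \<open>t\<close> passes
  through the product as \<open>\<Delta>(t)\<close>, acting with \<open>t\<close> on \<open>a * b\<close> means acting with \<open>\<Delta>(t) F\<close> on
  \<open>a \<otimes> b\<close>, which is \<open>F\<close> after \<open>\<Delta>\<^sub>\<Psi>(t)\<close> (\<open>act_action_product\<close>, \<open>tensor_lift_action_product\<close>).  The
  two bracketings of \<open>a * b * c\<close> are the triple product of the actions of \<open>(\<Delta> \<otimes> id)(F) F\<^sub>1\<^sub>2\<close> and of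
  \<open>(id \<otimes> \<Delta>)(F) F\<^sub>2\<^sub>3\<close>, and these two elements agree by the inverse of the twist equation
  (\<open>twist_inverse_identity\<close>).  The same equation gives coassociativity of \<open>\<Delta>\<^sub>\<Psi>\<close>.

  The antipode of the twisted Hopf algebra is the conjugate of \<open>S\<close> by \<open>U = \<Psi>\<^sub>(\<^sub>1\<^sub>) S(\<Psi>\<^sub>(\<^sub>2\<^sub>))\<close>.  That \<open>U\<close>
  is invertible, with inverse \<open>V = S(F\<^sub>(\<^sub>1\<^sub>)) F\<^sub>(\<^sub>2\<^sub>)\<close>, is seen by writing the twist equation in the form
  \<open>F\<^sub>2\<^sub>3 \<Psi>\<^sub>1\<^sub>2 = (id \<otimes> \<Delta>)(\<Psi>) (\<Delta> \<otimes> id)(F)\<close> and contracting the three legs with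
  \<open>a \<otimes> b \<otimes> c \<mapsto> a S(b) c\<close>: the left-hand side becomes \<open>U V\<close>, and on the right-hand side the antipode
  axioms leave only counits.  The product \<open>V U\<close> is treated in the same way.

  In the Cartan case the twist is not in \<open>H \<otimes> H\<close>, but it has a value on every cyclic weight module
  \<open>R / I\<close> of \<open>R = H \<otimes> H\<close>.  The point is that weight ideals are stable under all constructions that are needed:
  annihilators of elements of \<open>R / I\<close>, preimages under homomorphisms, annihilators of vectors of weight
  modules, and intersections.  All of this rests on the fact that an invariant subspace of a
  space spanned by eigenvectors is itself spanned by eigenvectors (\<open>eigenvectors_decompose\<close>).  Hence
  the completion is a monoid that acts linearly on weight modules, and suitable homomorphisms extend
  to it.  The exponential \<open>\<lambda>\<^sup>y\<close> is well defined because a decomposition of \<open>1\<close> into eigenvectors is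
  unique modulo \<open>I\<close>, and \<open>\<lambda>\<^sup>x \<lambda>\<^sup>y = \<lambda>\<^sup>x\<^sup>+\<^sup>y\<close> for commuting \<open>x\<close> and \<open>y\<close> (\<open>completion_exp_add\<close>).  As
  \<open>h\<^sub>1\<close> and \<open>h\<^sub>2\<close> are primitive, both sides of the twist equation for \<open>\<lambda>\<close> to the power
  \<open>- h\<^sub>1 \<otimes> h\<^sub>2\<close> are the exponential of \<open>- (h\<^sub>1 \<otimes> h\<^sub>2 \<otimes> 1 + h\<^sub>1 \<otimes> 1 \<otimes> h\<^sub>2 + 1 \<otimes> h\<^sub>1 \<otimes> h\<^sub>2)\<close>.  On homogeneous
  elements the deformed product is the original one times \<open>\<lambda>\<close> to the power \<open>n\<^sub>1 k\<^sub>2\<close>, so its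
  associativity is a comparison of exponents, and compatibility with the action is again
  \<open>\<Delta>(t) F = F \<Delta>\<^sub>\<Psi>(t)\<close>.
\<close>


section \<open>Linear maps out of tensor products\<close>

lemma cbilinearI':
  assumes "\<And>a. clinear (\<lambda>b. f a b)" "\<And>b. clinear (\<lambda>a. f a b)"
  shows "cbilinear f"
  using assms by (simp add: cbilinear_def)

lemma clinear_compose: "clinear f \<Longrightarrow> clinear g \<Longrightarrow> clinear (\<lambda>x. f (g x))"
  by (simp add: clinear_iff)

lemma clinear_compose_left: "cbilinear f \<Longrightarrow> clinear g \<Longrightarrow> clinear (\<lambda>x. f (g x) c)"
  by (simp add: clinear_iff cbilinear_simps)

lemma clinear_compose_right: "cbilinear f \<Longrightarrow> clinear g \<Longrightarrow> clinear (\<lambda>x. f c (g x))"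
  by (simp add: clinear_iff cbilinear_simps)

lemma clinear_ident: "clinear (\<lambda>x. x)"
  by (simp add: clinear_iff)

lemma cbilinear_times: "cbilinear (\<lambda>x y :: 'r::complex_algebra_1. x * y)"
  by (rule cbilinearI) (simp_all add: algebra_simps mult_scaleC_left mult_scaleC_right)

lemma cbilinear_scaleC: "cbilinear (\<lambda>c v :: 'v::complex_vector. c *\<^sub>C v)"
  by (rule cbilinearI)
    (simp_all add: scaleC_add_left scaleC_add_right scaleC_scaleC scaleC_complex_def mult.commute)

lemma clinear_lift_fun:
  assumes "\<And>a b. clinear (\<lambda>x. f x a b)"
    and "\<And>x a. clinear (\<lambda>b. f x a b)" "\<And>x b. clinear (\<lambda>a. f x a b)"
  shows "clinear (\<lambda>x. tensor_lift (f x) y)"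
  using cbilinear_tensor_lift[of f] assms by (simp add: cbilinear_def)

lemma clinear_lift_arg:
  assumes "clinear g" "\<And>a. clinear (\<lambda>b. f a b)" "\<And>b. clinear (\<lambda>a. f a b)"
  shows "clinear (\<lambda>x. tensor_lift f (g x))"
  by (rule clinear_compose[OF clinear_tensor_lift assms(1)]) (intro cbilinearI' assms)

text \<open>Backward chaining with these rules decides linearity of any expression in which the variable
  occurs once.\<close>

lemmas clinear_intros = cbilinearI' clinear_ident clinear_lift_arg clinear_lift_fun
  clinear_compose_left[OF cbilinear_times] clinear_compose_right[OF cbilinear_times]
  clinear_compose_left[OF cbilinear_tensor_of] clinear_compose_right[OF cbilinear_tensor_of]
  clinear_compose_left[OF cbilinear_scaleC] clinear_compose_right[OF cbilinear_scaleC]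

lemma clinear_simps:
  assumes "clinear f"
  shows "f (x + y) = f x + f y" "f (c *\<^sub>C x) = c *\<^sub>C f x" "f 0 = 0" "f (- x) = - f x"
    "f (x - y) = f x - f y"
proof -
  note lin = assms[unfolded clinear_iff]
  show "f (x + y) = f x + f y" "f (c *\<^sub>C x) = c *\<^sub>C f x"
    using lin by auto
  show 0: "f 0 = 0"
    using lin[THEN conjunct1, rule_format, of 0 0] by simp
  show neg: "f (- x) = - f x" for x
    using lin[THEN conjunct1, rule_format, of x "- x"] 0 by (simp add: eq_neg_iff_add_eq_0 add.commute)
  show "f (x - y) = f x - f y"
    using lin[THEN conjunct1, rule_format, of x "- y"] neg by simp
qed

lemma clinear_sum: "clinear f \<Longrightarrow> f (\<Sum>i\<in>A. v i) = (\<Sum>i\<in>A. f (v i))"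
  by (induction A rule: infinite_finite_induct) (simp_all add: clinear_simps)

lemma tensor_lift_comp:
  assumes "clinear h" "cbilinear f"
  shows "h (tensor_lift f x) = tensor_lift (\<lambda>a b. h (f a b)) x"
proof -
  have b: "cbilinear (\<lambda>a b. h (f a b))"
    using assms(2) by (intro cbilinearI' clinear_compose[OF assms(1)]) (simp_all add: cbilinear_def)
  show ?thesis
    by (rule tensor_ext[of "\<lambda>x. h (tensor_lift f x)" "tensor_lift (\<lambda>a b. h (f a b))"])
      (rule clinear_compose[OF assms(1) clinear_tensor_lift[OF assms(2)]] clinear_tensor_lift[OF b]
        | simp only: tensor_lift_of[OF b] tensor_lift_of[OF assms(2)])+
qed

lemma tensor_map_of:
  assumes "clinear f" "clinear g"
  shows "tensor_map f g (a \<otimes> b) = f a \<otimes> g b"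
  unfolding tensor_map_def
  by (subst tensor_lift_of) (intro clinear_intros clinear_compose[OF assms(1)] clinear_compose[OF assms(2)] refl)+

lemma clinear_tensor_map:
  assumes "clinear f" "clinear g"
  shows "clinear (tensor_map f g)"
  unfolding tensor_map_def
  by (intro clinear_tensor_lift clinear_intros clinear_compose[OF assms(1)] clinear_compose[OF assms(2)])

lemma tensor_assoc_of: "tensor_assoc ((a \<otimes> b) \<otimes> c) = a \<otimes> b \<otimes> c"
  unfolding tensor_assoc_def
  by (subst tensor_lift_of, intro clinear_intros, subst tensor_lift_of) (intro clinear_intros refl)+

lemma clinear_tensor_assoc: "clinear tensor_assoc"
  unfolding tensor_assoc_def by (intro clinear_tensor_lift clinear_intros)

text \<open>The Sweedler sum \<open>\<Sum> f (p\<^sub>(\<^sub>1\<^sub>)) (p\<^sub>(\<^sub>2\<^sub>)) (p\<^sub>(\<^sub>3\<^sub>))\<close> over three legs.\<close>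

definition tensor_lift3 ::
    "('a::complex_vector \<Rightarrow> 'b::complex_vector \<Rightarrow> 'c::complex_vector \<Rightarrow> 'd::complex_vector) \<Rightarrow>
      'a \<otimes> 'b \<otimes> 'c \<Rightarrow> 'd"
  where "tensor_lift3 f = tensor_lift (\<lambda>a. tensor_lift (f a))"

definition ctrilinear ::
    "('a::complex_vector \<Rightarrow> 'b::complex_vector \<Rightarrow> 'c::complex_vector \<Rightarrow> 'd::complex_vector) \<Rightarrow> bool"
  where "ctrilinear f \<longleftrightarrow> (\<forall>b c. clinear (\<lambda>a. f a b c)) \<and> (\<forall>a c. clinear (\<lambda>b. f a b c)) \<and>
    (\<forall>a b. clinear (\<lambda>c. f a b c))"

lemma ctrilinearI:
  assumes "\<And>b c. clinear (\<lambda>a. f a b c)" "\<And>a c. clinear (\<lambda>b. f a b c)" "\<And>a b. clinear (\<lambda>c. f a b c)"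
  shows "ctrilinear f"
  using assms by (simp add: ctrilinear_def)

context
  fixes f :: "'a::complex_vector \<Rightarrow> 'b::complex_vector \<Rightarrow> 'c::complex_vector \<Rightarrow> 'd::complex_vector"
  assumes f: "ctrilinear f"
begin

lemma ctrilinear_rules:
  "clinear (\<lambda>a. f a b c)" "clinear (\<lambda>b. f a b c)" "clinear (\<lambda>c. f a b c)"
  using f by (simp_all add: ctrilinear_def)

lemma clinear_tensor_lift3: "clinear (tensor_lift3 f)"
  unfolding tensor_lift3_def by (intro clinear_tensor_lift clinear_intros ctrilinear_rules)

lemma tensor_lift3_left: "tensor_lift3 f (a \<otimes> w) = tensor_lift (f a) w"
  unfolding tensor_lift3_def
  by (subst tensor_lift_of) (intro clinear_intros ctrilinear_rules refl)+

lemma tensor_lift3_of: "tensor_lift3 f (a \<otimes> b \<otimes> c) = f a b c"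
  unfolding tensor_lift3_left
  by (subst tensor_lift_of) (intro clinear_intros ctrilinear_rules refl)+

lemma tensor_lift3_assoc: "tensor_lift3 f (tensor_assoc (w \<otimes> c)) = tensor_lift (\<lambda>a b. f a b c) w"
proof (rule tensor_ext[of "\<lambda>w. tensor_lift3 f (tensor_assoc (w \<otimes> c))" "tensor_lift (\<lambda>a b. f a b c)"])
  show "clinear (\<lambda>w. tensor_lift3 f (tensor_assoc (w \<otimes> c)))"
    by (intro clinear_intros clinear_compose[OF clinear_tensor_lift3] clinear_compose[OF clinear_tensor_assoc])
  show "clinear (tensor_lift (\<lambda>a b. f a b c))"
    by (intro clinear_tensor_lift clinear_intros ctrilinear_rules)
  show "tensor_lift3 f (tensor_assoc ((a \<otimes> b) \<otimes> c)) = tensor_lift (\<lambda>a b. f a b c) (a \<otimes> b)" for a b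
    unfolding tensor_assoc_of tensor_lift3_of
    by (subst tensor_lift_of) (intro clinear_intros ctrilinear_rules refl)+
qed

end

text \<open>All computations in Sweedler notation below are reduced to elementary tensors by this lemma.\<close>

lemma cbilinear_tensor_ext:
  assumes "cbilinear f" "cbilinear g" "\<And>a b c d. f (a \<otimes> b) (c \<otimes> d) = g (a \<otimes> b) (c \<otimes> d)"
  shows "f x y = g x y"
proof -
  have "f (a \<otimes> b) y = g (a \<otimes> b) y" for a b
    by (rule tensor_ext[of "f (a \<otimes> b)" "g (a \<otimes> b)"]) (use assms in \<open>auto simp: cbilinear_def\<close>)
  then show ?thesis
    by (intro tensor_ext[of "\<lambda>x. f x y" "\<lambda>x. g x y" x]) (use assms in \<open>auto simp: cbilinear_def\<close>)
qed


section \<open>Algebra homomorphisms\<close>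

definition algebra_hom :: "('r::complex_algebra_1 \<Rightarrow> 's::complex_algebra_1) \<Rightarrow> bool"
  where "algebra_hom f \<longleftrightarrow> clinear f \<and> (\<forall>x y. f (x * y) = f x * f y) \<and> f 1 = 1"

lemma algebra_homD:
  assumes "algebra_hom f"
  shows "clinear f" "f (x * y) = f x * f y" "f 1 = 1"
  using assms by (auto simp: algebra_hom_def)

lemma algebra_hom_tensor_lift:
  assumes f: "cbilinear f" and "\<And>a b c d. f (a * c) (b * d) = f a b * f c d" "f 1 1 = 1"
  shows "algebra_hom (tensor_lift f)"
proof -
  have "tensor_lift f (x * y) = tensor_lift f x * tensor_lift f y" for x y
    by (rule cbilinear_tensor_ext[of "\<lambda>x y. tensor_lift f (x * y)" "\<lambda>x y. tensor_lift f x * tensor_lift f y"])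
      (auto intro!: clinear_intros clinear_compose[OF clinear_tensor_lift[OF f]]
        simp: tensor_of_times tensor_lift_of[OF f] assms)
  then show ?thesis
    by (simp add: algebra_hom_def clinear_tensor_lift[OF f] one_tensor_def tensor_lift_of[OF f] assms)
qed

lemma algebra_hom_id: "algebra_hom id"
  by (simp add: algebra_hom_def clinear_iff)

lemma algebra_hom_compose: "algebra_hom f \<Longrightarrow> algebra_hom g \<Longrightarrow> algebra_hom (\<lambda>x. f (g x))"
  unfolding algebra_hom_def using clinear_compose[of f g] by simp

lemma algebra_hom_tensor_map:
  assumes f: "algebra_hom f" and g: "algebra_hom g"
  shows "algebra_hom (tensor_map f g)"
  unfolding tensor_map_def
proof (rule algebra_hom_tensor_lift)
  show "cbilinear (\<lambda>a b. f a \<otimes> g b)"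
    by (intro clinear_intros clinear_compose[OF algebra_homD(1)[OF f]]
      clinear_compose[OF algebra_homD(1)[OF g]])
qed (simp_all add: algebra_homD[OF f] algebra_homD[OF g] tensor_of_times one_tensor_def)

lemma algebra_hom_tensor_assoc: "algebra_hom tensor_assoc"
proof -
  have "tensor_assoc (x * y) = tensor_assoc x * tensor_assoc y"
    for x y :: "('a::complex_algebra_1 \<otimes> 'b::complex_algebra_1) \<otimes> 'c::complex_algebra_1"
  proof (rule cbilinear_tensor_ext[of "\<lambda>x y. tensor_assoc (x * y)" "\<lambda>x y. tensor_assoc x * tensor_assoc y"])
    note assoc = clinear_compose[OF clinear_tensor_assoc]
    show "cbilinear (\<lambda>x y. tensor_assoc (x * y))" "cbilinear (\<lambda>x y. tensor_assoc x * tensor_assoc y)"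
      by (intro clinear_intros assoc)+
    fix a c :: "'a \<otimes> 'b" and b d :: 'c
    show "tensor_assoc ((a \<otimes> b) * (c \<otimes> d)) = tensor_assoc (a \<otimes> b) * tensor_assoc (c \<otimes> d)"
      by (rule cbilinear_tensor_ext[of "\<lambda>a c. tensor_assoc ((a \<otimes> b) * (c \<otimes> d))"
              "\<lambda>a c. tensor_assoc (a \<otimes> b) * tensor_assoc (c \<otimes> d)"])
        (auto intro!: clinear_intros assoc simp: tensor_assoc_of tensor_of_times)
  qed
  then show ?thesis
    by (simp add: algebra_hom_def clinear_tensor_assoc one_tensor_def tensor_assoc_of)
qed

lemma algebra_hom_leg12: "algebra_hom (leg12 :: 'r::complex_algebra_1 \<otimes> 'r \<Rightarrow> _)"
proof -
  have "algebra_hom (\<lambda>x :: 'r \<otimes> 'r. x \<otimes> (1 :: 'r))"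
    by (auto simp: algebra_hom_def tensor_of_times one_tensor_def intro!: clinear_intros)
  then have "algebra_hom (\<lambda>x :: 'r \<otimes> 'r. tensor_assoc (x \<otimes> (1 :: 'r)))"
    by (rule algebra_hom_compose[OF algebra_hom_tensor_assoc])
  then show ?thesis
    by (simp add: leg12_def[abs_def])
qed

lemma algebra_hom_leg23: "algebra_hom leg23"
  unfolding leg23_def by (auto simp: algebra_hom_def tensor_of_times one_tensor_def intro!: clinear_intros)

lemma leg12_of: "leg12 (a \<otimes> b) = a \<otimes> b \<otimes> 1"
  by (simp add: leg12_def tensor_assoc_of)

lemma algebra_hom_coprod_left: "algebra_hom D \<Longrightarrow> algebra_hom (coprod_left D)"
  unfolding coprod_left_def
  by (intro algebra_hom_compose[OF algebra_hom_tensor_assoc] algebra_hom_tensor_map algebra_hom_id)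

lemma algebra_hom_coprod_right: "algebra_hom D \<Longrightarrow> algebra_hom (coprod_right D)"
  unfolding coprod_right_def by (intro algebra_hom_tensor_map algebra_hom_id)

lemma coprod_left_of: "clinear D \<Longrightarrow> coprod_left D (a \<otimes> b) = tensor_assoc (D a \<otimes> b)"
  by (simp add: coprod_left_def tensor_map_of clinear_ident id_def)

lemma coprod_right_of: "clinear D \<Longrightarrow> coprod_right D (a \<otimes> b) = a \<otimes> D b"
  by (simp add: coprod_right_def tensor_map_of clinear_ident id_def)

lemma clinear_coprod_left: "clinear D \<Longrightarrow> clinear (coprod_left D)"
  unfolding coprod_left_def id_def
  by (intro clinear_compose[OF clinear_tensor_assoc] clinear_tensor_map clinear_ident)

lemma clinear_coprod_right: "clinear D \<Longrightarrow> clinear (coprod_right D)"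
  unfolding coprod_right_def id_def by (intro clinear_tensor_map clinear_ident)


section \<open>The twisted Hopf algebra\<close>

lemma inverse_of_eq:
  assumes "x * y = 1" "y * x = 1"
  shows "inverse_of x = y"
  unfolding inverse_of_def
proof (rule the_equality)
  show "is_inverse x y"
    using assms by (simp add: is_inverse_def)
  fix z assume "is_inverse x z"
  then have "z = z * (x * y)" "z * x = 1"
    using assms by (simp_all add: is_inverse_def)
  then show "z = y"
    by (simp flip: mult.assoc)
qed

context hopf_algebra
begin

lemmas hopf_clinear_intros = clinear_intros clinear_compose[OF clinear_coprod]
  clinear_compose[OF clinear_counit] clinear_compose[OF clinear_antipode]
  clinear_compose[OF clinear_coprod_left[OF clinear_coprod]]
  clinear_compose[OF clinear_coprod_right[OF clinear_coprod]]

lemma algebra_hom_coprod: "algebra_hom \<Delta>"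
  by (simp add: algebra_hom_def clinear_coprod coprod_mult coprod_one)

lemma counit_left_of: "counit_left \<epsilon> (s \<otimes> t) = \<epsilon> s *\<^sub>C t"
  and counit_right_of: "counit_right \<epsilon> (s \<otimes> t) = \<epsilon> t *\<^sub>C s"
  unfolding counit_left_def counit_right_def
  by (subst tensor_lift_of; intro hopf_clinear_intros refl)+

lemma algebra_hom_counit_left: "algebra_hom (counit_left \<epsilon>)"
  and algebra_hom_counit_right: "algebra_hom (counit_right \<epsilon>)"
  unfolding counit_left_def counit_right_def
  by (rule algebra_hom_tensor_lift;
      (intro hopf_clinear_intros |
        simp add: counit_mult counit_one mult_scaleC_left mult_scaleC_right scaleC_scaleC scaleC_one))+

lemmas clinear_counit_left = algebra_homD(1)[OF algebra_hom_counit_left]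
lemmas clinear_counit_right = algebra_homD(1)[OF algebra_hom_counit_right]

text \<open>The sums \<open>S(x\<^sub>(\<^sub>1\<^sub>)) v x\<^sub>(\<^sub>2\<^sub>)\<close> and \<open>x\<^sub>(\<^sub>1\<^sub>) v S(x\<^sub>(\<^sub>2\<^sub>))\<close>, for \<open>x\<close> in \<open>H \<otimes> H\<close>.  The variable \<open>v\<close> in
  the middle turns them into actions of \<open>H \<otimes> H\<close> on \<open>H\<close>, so that products such as
  \<open>\<Psi> \<Delta>(t) \<Psi>\<^sup>-\<^sup>1\<close> can be contracted one factor at a time.\<close>

definition antipode_left_act :: "'h \<Rightarrow> 'h \<otimes> 'h \<Rightarrow> 'h"
  where "antipode_left_act v = tensor_lift (\<lambda>s t. S s * v * t)"

definition antipode_right_act :: "'h \<Rightarrow> 'h \<otimes> 'h \<Rightarrow> 'h"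
  where "antipode_right_act v = tensor_lift (\<lambda>s t. s * v * S t)"

lemma antipode_act_of:
  "antipode_left_act v (s \<otimes> t) = S s * v * t"
  "antipode_right_act v (s \<otimes> t) = s * v * S t"
  unfolding antipode_left_act_def antipode_right_act_def
  by (subst tensor_lift_of; intro hopf_clinear_intros refl)+

lemma cbilinear_antipode_act: "cbilinear antipode_left_act" "cbilinear antipode_right_act"
  unfolding antipode_left_act_def[abs_def] antipode_right_act_def[abs_def]
  by (rule cbilinearI'; intro hopf_clinear_intros clinear_tensor_lift)+

lemmas antipode_clinear_intros = hopf_clinear_intros
  clinear_compose_left[OF cbilinear_antipode_act(1)] clinear_compose_left[OF cbilinear_antipode_act(2)]
  clinear_compose_right[OF cbilinear_antipode_act(1)] clinear_compose_right[OF cbilinear_antipode_act(2)]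

lemma antipode_act_coprod:
  "antipode_left_act (c *\<^sub>C 1) (\<Delta> t) = c *\<^sub>C \<epsilon> t *\<^sub>C 1"
  "antipode_right_act (c *\<^sub>C 1) (\<Delta> t) = c *\<^sub>C \<epsilon> t *\<^sub>C 1"
  "antipode_left_act 1 (\<Delta> t) = \<epsilon> t *\<^sub>C 1"
  "antipode_right_act 1 (\<Delta> t) = \<epsilon> t *\<^sub>C 1"
proof -
  show *: "antipode_left_act 1 (\<Delta> t) = \<epsilon> t *\<^sub>C 1" "antipode_right_act 1 (\<Delta> t) = \<epsilon> t *\<^sub>C 1"
    by (simp_all add: antipode_left_act_def antipode_right_act_def antipode_left antipode_right)
  show "antipode_left_act (c *\<^sub>C 1) (\<Delta> t) = c *\<^sub>C \<epsilon> t *\<^sub>C 1"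
    "antipode_right_act (c *\<^sub>C 1) (\<Delta> t) = c *\<^sub>C \<epsilon> t *\<^sub>C 1"
    by (simp_all add: cbilinear_simps[OF cbilinear_antipode_act(1)]
        cbilinear_simps[OF cbilinear_antipode_act(2)] *)
qed

lemma antipode_one: "S 1 = 1"
  using antipode_act_coprod(3)[of 1]
  by (simp add: coprod_one one_tensor_def antipode_act_of counit_one scaleC_one)

lemma antipode_act_scale:
  "antipode_left_act (c *\<^sub>C 1) x = c *\<^sub>C antipode_left_act 1 x"
  "antipode_right_act (c *\<^sub>C 1) x = c *\<^sub>C antipode_right_act 1 x"
  by (simp_all add: cbilinear_simps[OF cbilinear_antipode_act(1)]
        cbilinear_simps[OF cbilinear_antipode_act(2)])

text \<open>With \<open>G(p, r) = S(p\<^sub>1 r\<^sub>1) p\<^sub>2 r\<^sub>2 S(r\<^sub>3) S(p\<^sub>3)\<close>, where \<open>p\<close> and \<open>r\<close> are the iterated coproducts of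
  \<open>s\<close> and \<open>t\<close>, cancelling the first two legs leaves \<open>S(t) S(s)\<close>, and cancelling the last two
  legs leaves \<open>S(s t)\<close>.\<close>

lemma antipode_mult: "S (s * t) = S t * S s"
proof -
  define g where "g a b c r = tensor_lift3 (\<lambda>a' b' c'. S (a * a') * (b * b') * (S c' * S c)) r"
    for a b c r
  define G where "G p r = tensor_lift3 (\<lambda>a b c. g a b c r) p" for p r
  have tri1: "ctrilinear (\<lambda>a' b' c'. S (a * a') * (b * b') * (S c' * S c))" for a b c
    by (intro ctrilinearI antipode_clinear_intros)
  have g: "g a b c (a' \<otimes> b' \<otimes> c') = S (a * a') * (b * b') * (S c' * S c)" for a b c a' b' c'
    by (simp add: g_def tensor_lift3_of[OF tri1])
  have lin1: "clinear (g a b c)" for a b c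
    unfolding g_def by (rule clinear_tensor_lift3[OF tri1])
  have tri2: "ctrilinear (\<lambda>a b c. g a b c r)" for r
    unfolding g_def tensor_lift3_def by (intro ctrilinearI antipode_clinear_intros)
  have G: "G (a \<otimes> b \<otimes> c) r = g a b c r" for a b c r
    by (simp add: G_def tensor_lift3_of[OF tri2])
  have bil: "cbilinear G"
    unfolding G_def tensor_lift3_def
    by (intro cbilinearI' antipode_clinear_intros clinear_tensor_lift ctrilinear_rules[OF tri2]
        clinear_compose[OF lin1])
  note intros = antipode_clinear_intros clinear_compose_left[OF bil] clinear_compose_right[OF bil]
    clinear_compose[OF clinear_tensor_assoc]
    clinear_compose[OF clinear_counit_left] clinear_compose[OF clinear_counit_right]
  have first_legs: "G (tensor_assoc (w \<otimes> c)) (tensor_assoc (w' \<otimes> c')) =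
      antipode_left_act 1 (w * w') * (S c' * S c)" for w w' c c'
    by (rule cbilinear_tensor_ext[of "\<lambda>w w'. G (tensor_assoc (w \<otimes> c)) (tensor_assoc (w' \<otimes> c'))"])
      ((intro intros)+, simp add: tensor_assoc_of G g antipode_act_of tensor_of_times)
  have last_legs: "G (a \<otimes> w) (a' \<otimes> w') =
      S (a * a') * antipode_right_act (antipode_right_act 1 w') w" for w w' a a'
    by (rule cbilinear_tensor_ext[of "\<lambda>w w'. G (a \<otimes> w) (a' \<otimes> w')"])
      ((intro intros)+, simp add: G g antipode_act_of mult.assoc)
  have "G (coprod_left \<Delta> x) (coprod_left \<Delta> y) = S (counit_left \<epsilon> y) * S (counit_left \<epsilon> x)" for x y
    by (rule cbilinear_tensor_ext[of "\<lambda>x y. G (coprod_left \<Delta> x) (coprod_left \<Delta> y)"])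
      ((intro intros)+, simp add: coprod_left_of[OF clinear_coprod] first_legs counit_left_of
        clinear_simps[OF clinear_antipode] antipode_act_coprod counit_mult
        mult_scaleC_left mult_scaleC_right scaleC_scaleC flip: coprod_mult)
  from this[of "\<Delta> s" "\<Delta> t"]
  have "G (coprod_left \<Delta> (\<Delta> s)) (coprod_left \<Delta> (\<Delta> t)) = S t * S s"
    by (simp add: counit_left)
  moreover have "G (coprod_right \<Delta> x) (coprod_right \<Delta> y) =
      S (counit_right \<epsilon> x * counit_right \<epsilon> y)" for x y
    by (rule cbilinear_tensor_ext[of "\<lambda>x y. G (coprod_right \<Delta> x) (coprod_right \<Delta> y)"])
      ((intro intros)+, simp add: coprod_right_of[OF clinear_coprod] last_legs counit_right_of
        clinear_simps[OF clinear_antipode] antipode_act_coprod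
        mult_scaleC_left mult_scaleC_right scaleC_scaleC mult.commute)
  from this[of "\<Delta> s" "\<Delta> t"]
  have "G (coprod_right \<Delta> (\<Delta> s)) (coprod_right \<Delta> (\<Delta> t)) = S (s * t)"
    by (simp add: counit_right)
  ultimately show ?thesis
    by (simp add: coassoc)
qed

text \<open>Since \<open>S\<close> is antimultiplicative, \<open>antipode_left_act\<close> is a right action of \<open>H \<otimes> H\<close> and
  \<open>antipode_right_act\<close> is a left action.\<close>

lemma antipode_left_act_mult: "antipode_left_act v (x * y) = antipode_left_act (antipode_left_act v x) y"
  by (rule cbilinear_tensor_ext[of "\<lambda>x y. antipode_left_act v (x * y)"])
    ((intro antipode_clinear_intros)+, simp add: antipode_act_of tensor_of_times antipode_mult mult.assoc)

lemma antipode_right_act_mult: "antipode_right_act v (x * y) = antipode_right_act (antipode_right_act v y) x"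
  by (rule cbilinear_tensor_ext[of "\<lambda>x y. antipode_right_act v (x * y)"])
    ((intro antipode_clinear_intros)+, simp add: antipode_act_of tensor_of_times antipode_mult mult.assoc)

end

locale hopf_twist = hopf_algebra +
  fixes \<Psi> F :: "'a \<otimes> 'a"
  assumes twist_inverse: "\<Psi> * F = 1" "F * \<Psi> = 1"
    and twist: "leg12 \<Psi> * coprod_left \<Delta> \<Psi> = leg23 \<Psi> * coprod_right \<Delta> \<Psi>"
    and counit_left_twist: "counit_left \<epsilon> \<Psi> = 1"
    and counit_right_twist: "counit_right \<epsilon> \<Psi> = 1"
begin

lemma inverse_of_twist: "inverse_of \<Psi> = F"
  using twist_inverse by (rule inverse_of_eq)

lemma hom_twist:
  assumes "algebra_hom f"
  shows "f \<Psi> * f F = 1" "f F * f \<Psi> = 1" "f \<Psi> * (f F * x) = x" "f F * (f \<Psi> * x) = x"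
proof -
  show *: "f \<Psi> * f F = 1" "f F * f \<Psi> = 1"
    using twist_inverse algebra_homD[OF assms] by metis+
  show "f \<Psi> * (f F * x) = x" "f F * (f \<Psi> * x) = x"
    by (simp_all add: * flip: mult.assoc)
qed

lemma counit_left_inverse: "counit_left \<epsilon> F = 1"
  using hom_twist(1)[OF algebra_hom_counit_left] by (simp add: counit_left_twist)

lemma counit_right_inverse: "counit_right \<epsilon> F = 1"
  using hom_twist(1)[OF algebra_hom_counit_right] by (simp add: counit_right_twist)

lemmas homs = algebra_hom_leg12 algebra_hom_leg23 algebra_hom_coprod_left[OF algebra_hom_coprod]
  algebra_hom_coprod_right[OF algebra_hom_coprod]

lemma twist_inverse_identity: "coprod_left \<Delta> F * leg12 F = coprod_right \<Delta> F * leg23 F"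
proof -
  have "coprod_left \<Delta> F * leg12 F =
      coprod_left \<Delta> F * leg12 F * (leg23 \<Psi> * coprod_right \<Delta> \<Psi>) * (coprod_right \<Delta> F * leg23 F)"
    by (simp add: mult.assoc hom_twist[OF homs(4)] hom_twist[OF homs(2)])
  also have "\<dots> = coprod_right \<Delta> F * leg23 F"
    by (simp add: mult.assoc hom_twist[OF homs(3)] hom_twist[OF homs(1)] flip: twist)
  finally show ?thesis .
qed

text \<open>The twist equation with one factor moved to the other side.  Here the second leg of the
  left-hand side carries both \<open>F\<close> and \<open>\<Psi>\<close>, so that its contraction is a product of \<open>U\<close> and \<open>V\<close>.\<close>

lemma twist_mixed1: "leg23 F * leg12 \<Psi> = coprod_right \<Delta> \<Psi> * coprod_left \<Delta> F"
proof -
  have "leg23 F * leg12 \<Psi> = leg23 F * (leg12 \<Psi> * coprod_left \<Delta> \<Psi>) * coprod_left \<Delta> F"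
    by (simp add: mult.assoc hom_twist[OF homs(3)])
  then show ?thesis
    by (simp add: twist mult.assoc hom_twist[OF homs(2)])
qed

lemma twist_mixed2: "leg12 F * leg23 \<Psi> = coprod_left \<Delta> \<Psi> * coprod_right \<Delta> F"
proof -
  have "leg12 F * leg23 \<Psi> = leg12 F * (leg23 \<Psi> * coprod_right \<Delta> \<Psi>) * coprod_right \<Delta> F"
    by (simp add: mult.assoc hom_twist[OF homs(4)])
  then show ?thesis
    by (simp add: mult.assoc hom_twist[OF homs(1)] flip: twist)
qed

definition "U = antipode_right_act 1 \<Psi>"
definition "V = antipode_left_act 1 F"

text \<open>Contraction of \<open>twist_mixed1\<close> with \<open>a \<otimes> b \<otimes> c \<mapsto> a S(b) c\<close>.\<close>

lemma U_mult_V: "U * V = 1"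
proof -
  define \<phi> where "\<phi> = tensor_lift3 (\<lambda>a b c. a * S b * c)"
  have tri: "ctrilinear (\<lambda>a b c. a * S b * c)"
    by (intro ctrilinearI antipode_clinear_intros)
  have phi: "\<phi> (a \<otimes> b \<otimes> c) = a * S b * c" for a b c
    by (simp add: \<phi>_def tensor_lift3_of[OF tri])
  note intros = antipode_clinear_intros clinear_compose[OF clinear_tensor_lift3[OF tri], folded \<phi>_def]
    clinear_compose[OF clinear_tensor_assoc] clinear_compose[OF algebra_homD(1)[OF algebra_hom_leg12]]
    clinear_compose[OF algebra_homD(1)[OF algebra_hom_leg23]]
    clinear_compose[OF clinear_counit_left] clinear_compose[OF clinear_counit_right]
  have outer: "\<phi> (leg23 x * leg12 y) = antipode_right_act 1 y * antipode_left_act 1 x" for x y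
    by (rule cbilinear_tensor_ext[of "\<lambda>x y. \<phi> (leg23 x * leg12 y)"])
      ((intro intros)+, simp add: leg12_of leg23_def tensor_of_times phi antipode_act_of antipode_mult mult.assoc)
  have inner: "\<phi> (a \<otimes> w * tensor_assoc (v \<otimes> d)) =
      a * antipode_right_act 1 v * antipode_left_act 1 w * d" for a d w v
    by (rule cbilinear_tensor_ext[of "\<lambda>w v. \<phi> (a \<otimes> w * tensor_assoc (v \<otimes> d))"])
      ((intro intros)+, simp add: tensor_assoc_of tensor_of_times phi antipode_act_of antipode_mult mult.assoc)
  have "\<phi> (coprod_right \<Delta> x * coprod_left \<Delta> y) = counit_right \<epsilon> x * counit_left \<epsilon> y" for x y
    by (rule cbilinear_tensor_ext[of "\<lambda>x y. \<phi> (coprod_right \<Delta> x * coprod_left \<Delta> y)"])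
      ((intro intros)+, simp add: coprod_left_of[OF clinear_coprod] coprod_right_of[OF clinear_coprod]
        inner antipode_act_coprod counit_left_of counit_right_of
        mult_scaleC_left mult_scaleC_right scaleC_scaleC mult.commute)
  then have "\<phi> (leg23 F * leg12 \<Psi>) = 1"
    by (simp add: twist_mixed1 counit_right_twist counit_left_inverse)
  then show ?thesis
    by (simp add: outer U_def V_def)
qed

text \<open>Contraction of \<open>twist_mixed2\<close> with \<open>a \<otimes> b \<otimes> c \<mapsto> S(a) b S(c)\<close>.\<close>

lemma V_mult_U: "V * U = 1"
proof -
  define \<phi> where "\<phi> = tensor_lift3 (\<lambda>a b c. S a * b * S c)"
  have tri: "ctrilinear (\<lambda>a b c. S a * b * S c)"
    by (intro ctrilinearI antipode_clinear_intros)
  have phi: "\<phi> (a \<otimes> b \<otimes> c) = S a * b * S c" for a b c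
    by (simp add: \<phi>_def tensor_lift3_of[OF tri])
  note intros = antipode_clinear_intros clinear_compose[OF clinear_tensor_lift3[OF tri], folded \<phi>_def]
    clinear_compose[OF clinear_tensor_assoc] clinear_compose[OF algebra_homD(1)[OF algebra_hom_leg12]]
    clinear_compose[OF algebra_homD(1)[OF algebra_hom_leg23]]
    clinear_compose[OF clinear_counit_left] clinear_compose[OF clinear_counit_right]
  have outer: "\<phi> (leg12 x * leg23 y) = antipode_left_act 1 x * antipode_right_act 1 y" for x y
    by (rule cbilinear_tensor_ext[of "\<lambda>x y. \<phi> (leg12 x * leg23 y)"])
      ((intro intros)+, simp add: leg12_of leg23_def tensor_of_times phi antipode_act_of mult.assoc)
  have inner: "\<phi> (tensor_assoc (v \<otimes> d) * a \<otimes> w) =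
      S a * antipode_left_act 1 v * antipode_right_act 1 w * S d" for a d w v
    by (rule cbilinear_tensor_ext[of "\<lambda>v w. \<phi> (tensor_assoc (v \<otimes> d) * a \<otimes> w)"])
      ((intro intros)+, simp add: tensor_assoc_of tensor_of_times phi antipode_act_of antipode_mult mult.assoc)
  have "\<phi> (coprod_left \<Delta> x * coprod_right \<Delta> y) = S (counit_right \<epsilon> y) * S (counit_left \<epsilon> x)" for x y
    by (rule cbilinear_tensor_ext[of "\<lambda>x y. \<phi> (coprod_left \<Delta> x * coprod_right \<Delta> y)"])
      ((intro intros)+, simp add: coprod_left_of[OF clinear_coprod] coprod_right_of[OF clinear_coprod]
        inner antipode_act_coprod counit_left_of counit_right_of clinear_simps[OF clinear_antipode]
        mult_scaleC_left mult_scaleC_right scaleC_scaleC mult.commute)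
  then have "\<phi> (leg12 F * leg23 \<Psi>) = 1"
    by (simp add: twist_mixed2 counit_left_twist counit_right_inverse antipode_one)
  then show ?thesis
    by (simp add: outer U_def V_def)
qed

lemma twisted_antipode_eq: "twisted_antipode S \<Psi> t = U * S t * V"
proof -
  have "tensor_lift (\<lambda>s t. s * S t) \<Psi> = U"
    by (simp add: U_def antipode_right_act_def)
  then show ?thesis
    by (simp add: twisted_antipode_def inverse_of_eq[OF U_mult_V V_mult_U])
qed

lemma coprod_left_twisted:
  "coprod_left (twisted_coprod \<Delta> \<Psi>) x = leg12 \<Psi> * coprod_left \<Delta> x * leg12 F"
proof -
  have lin: "clinear (twisted_coprod \<Delta> \<Psi>)"
    unfolding twisted_coprod_def by (intro hopf_clinear_intros)
  have "coprod_left (twisted_coprod \<Delta> \<Psi>) (s \<otimes> t) = leg12 \<Psi> * coprod_left \<Delta> (s \<otimes> t) * leg12 F" for s t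
    by (simp add: coprod_left_of[OF lin] coprod_left_of[OF clinear_coprod] leg12_def tensor_of_times
        twisted_coprod_def inverse_of_twist flip: algebra_homD(2)[OF algebra_hom_tensor_assoc])
  then show ?thesis
    by (intro tensor_ext[of "coprod_left (twisted_coprod \<Delta> \<Psi>)" "\<lambda>x. leg12 \<Psi> * coprod_left \<Delta> x * leg12 F" x]
      clinear_coprod_left lin hopf_clinear_intros)
qed

lemma coprod_right_twisted:
  "coprod_right (twisted_coprod \<Delta> \<Psi>) x = leg23 \<Psi> * coprod_right \<Delta> x * leg23 F"
proof -
  have lin: "clinear (twisted_coprod \<Delta> \<Psi>)"
    unfolding twisted_coprod_def by (intro hopf_clinear_intros)
  have "coprod_right (twisted_coprod \<Delta> \<Psi>) (s \<otimes> t) = leg23 \<Psi> * coprod_right \<Delta> (s \<otimes> t) * leg23 F" for s t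
    by (simp add: coprod_right_of[OF lin] coprod_right_of[OF clinear_coprod] leg23_def tensor_of_times
        twisted_coprod_def inverse_of_twist)
  then show ?thesis
    by (intro tensor_ext[of "coprod_right (twisted_coprod \<Delta> \<Psi>)" "\<lambda>x. leg23 \<Psi> * coprod_right \<Delta> x * leg23 F" x]
      clinear_coprod_right lin hopf_clinear_intros)
qed

theorem twisted_hopf_algebra: "hopf_algebra (twisted_coprod \<Delta> \<Psi>) \<epsilon> (twisted_antipode S \<Psi>)"
proof (rule hopf_algebra.intro)
  show "clinear (twisted_coprod \<Delta> \<Psi>)"
    unfolding twisted_coprod_def by (intro hopf_clinear_intros)
  show "twisted_coprod \<Delta> \<Psi> (s * t) = twisted_coprod \<Delta> \<Psi> s * twisted_coprod \<Delta> \<Psi> t" for s t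
    using hom_twist[OF algebra_hom_id] by (simp add: twisted_coprod_def inverse_of_twist coprod_mult mult.assoc)
  show "twisted_coprod \<Delta> \<Psi> 1 = 1"
    by (simp add: twisted_coprod_def inverse_of_twist coprod_one twist_inverse)
  show "clinear \<epsilon>" "\<epsilon> (s * t) = \<epsilon> s * \<epsilon> t" "\<epsilon> 1 = 1" for s t
    by (fact clinear_counit counit_mult counit_one)+
  show "coprod_left (twisted_coprod \<Delta> \<Psi>) (twisted_coprod \<Delta> \<Psi> t) =
      coprod_right (twisted_coprod \<Delta> \<Psi>) (twisted_coprod \<Delta> \<Psi> t)" for t
  proof -
    have "coprod_left (twisted_coprod \<Delta> \<Psi>) (twisted_coprod \<Delta> \<Psi> t) =
        (leg12 \<Psi> * coprod_left \<Delta> \<Psi>) * coprod_left \<Delta> (\<Delta> t) * (coprod_left \<Delta> F * leg12 F)"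
      unfolding coprod_left_twisted
      by (simp add: twisted_coprod_def inverse_of_twist algebra_homD(2)[OF homs(3)] mult.assoc)
    also have "\<dots> = coprod_right (twisted_coprod \<Delta> \<Psi>) (twisted_coprod \<Delta> \<Psi> t)"
      unfolding coprod_right_twisted twist twist_inverse_identity coassoc
      by (simp add: twisted_coprod_def inverse_of_twist algebra_homD(2)[OF homs(4)] mult.assoc)
    finally show ?thesis .
  qed
  show "counit_left \<epsilon> (twisted_coprod \<Delta> \<Psi> t) = t" "counit_right \<epsilon> (twisted_coprod \<Delta> \<Psi> t) = t" for t
    by (simp_all add: twisted_coprod_def inverse_of_twist algebra_homD(2)[OF algebra_hom_counit_left]
        algebra_homD(2)[OF algebra_hom_counit_right] counit_left_twist counit_right_twist
        counit_left_inverse counit_right_inverse counit_left counit_right)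
  show "clinear (twisted_antipode S \<Psi>)"
    unfolding twisted_antipode_eq[abs_def] by (intro hopf_clinear_intros)
  show "tensor_lift (\<lambda>t\<^sub>1 t\<^sub>2. twisted_antipode S \<Psi> t\<^sub>1 * t\<^sub>2) (twisted_coprod \<Delta> \<Psi> t) = \<epsilon> t *\<^sub>C 1" for t
  proof -
    have "tensor_lift (\<lambda>t\<^sub>1 t\<^sub>2. twisted_antipode S \<Psi> t\<^sub>1 * t\<^sub>2) x = U * antipode_left_act V x" for x
    proof -
      have "(\<lambda>t\<^sub>1 t\<^sub>2. U * S t\<^sub>1 * V * t\<^sub>2) = (\<lambda>t\<^sub>1 t\<^sub>2. U * (S t\<^sub>1 * V * t\<^sub>2))"
        by (intro ext) (simp only: mult.assoc)
      then show ?thesis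
        unfolding antipode_left_act_def twisted_antipode_eq
        by (subst tensor_lift_comp[of "\<lambda>x. U * x"]) (simp_all | intro hopf_clinear_intros)+
    qed
    \<comment> \<open>\<open>V\<close> is the contraction of \<open>F\<close>, so acting with \<open>\<Psi>\<close> contracts \<open>F \<Psi> = 1\<close>.\<close>
    moreover have "antipode_left_act V \<Psi> = 1"
      by (simp add: V_def twist_inverse one_tensor_def antipode_act_of antipode_one
          flip: antipode_left_act_mult)
    ultimately show ?thesis
      by (simp add: twisted_coprod_def inverse_of_twist antipode_left_act_mult antipode_act_coprod
          antipode_act_scale mult_scaleC_right U_mult_V flip: V_def)
  qed
  show "tensor_lift (\<lambda>t\<^sub>1 t\<^sub>2. t\<^sub>1 * twisted_antipode S \<Psi> t\<^sub>2) (twisted_coprod \<Delta> \<Psi> t) = \<epsilon> t *\<^sub>C 1" for t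
  proof -
    have "tensor_lift (\<lambda>t\<^sub>1 t\<^sub>2. t\<^sub>1 * twisted_antipode S \<Psi> t\<^sub>2) x = antipode_right_act U x * V" for x
      unfolding antipode_right_act_def twisted_antipode_eq
      by (subst tensor_lift_comp[of "\<lambda>x. x * V"]) (simp_all add: mult.assoc | intro hopf_clinear_intros)+
    \<comment> \<open>\<open>U\<close> is the contraction of \<open>\<Psi>\<close>, so acting with \<open>F\<close> contracts \<open>F \<Psi> = 1\<close>.\<close>
    moreover have "antipode_right_act U F = 1"
      by (simp add: U_def twist_inverse one_tensor_def antipode_act_of antipode_one
          flip: antipode_right_act_mult)
    ultimately show ?thesis
      by (simp add: twisted_coprod_def inverse_of_twist antipode_right_act_mult antipode_act_coprod
          antipode_act_scale mult_scaleC_left U_mult_V flip: U_def)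
  qed
qed

end


section \<open>The deformed module algebra\<close>

text \<open>The product of \<open>x \<triangleright> (a \<otimes> b)\<close>: the original product for \<open>x = 1\<close>, and the deformed one for
  \<open>x = \<Psi>\<^sup>-\<^sup>1\<close>.\<close>

definition action_product ::
    "('h::complex_vector \<Rightarrow> 'a::complex_vector \<Rightarrow> 'a) \<Rightarrow> ('a \<Rightarrow> 'a \<Rightarrow> 'a) \<Rightarrow> 'h \<otimes> 'h \<Rightarrow> 'a \<Rightarrow> 'a \<Rightarrow> 'a"
  where "action_product act m x a b = tensor_lift m (tensor_action act x (a \<otimes> b))"

lemma tensor_action_of:
  assumes "cbilinear act"
  shows "tensor_action act x (a \<otimes> b) = tensor_lift (\<lambda>s t. act s a \<otimes> act t b) x"
    "tensor_action act (s \<otimes> t) (a \<otimes> b) = act s a \<otimes> act t b"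
proof -
  have "clinear (act s)" for s
    using assms by (simp add: cbilinear_def)
  then show *: "tensor_action act x (a \<otimes> b) = tensor_lift (\<lambda>s t. act s a \<otimes> act t b) x" for x
    by (simp add: tensor_action_def tensor_map_of)
  show "tensor_action act (s \<otimes> t) (a \<otimes> b) = act s a \<otimes> act t b"
    unfolding * by (subst tensor_lift_of) (intro clinear_intros clinear_compose_left[OF assms] refl)+
qed

lemma cbilinear_tensor_action:
  assumes "cbilinear act"
  shows "cbilinear (tensor_action act)"
  unfolding tensor_action_def[abs_def] tensor_map_def
  by (intro clinear_intros clinear_tensor_lift clinear_compose_left[OF assms] clinear_compose_right[OF assms])

lemma left_action_tensor:
  assumes "left_action act"
  shows "left_action (tensor_action act)"
proof (rule left_action.intro)
  interpret left_action act by fact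
  note bil = cbilinear_tensor_action[OF act_bilinear]
  show "cbilinear (tensor_action act)"
    by (fact bil)
  note intros = clinear_intros clinear_compose_left[OF bil] clinear_compose_right[OF bil]
  show "tensor_action act (x * y) v = tensor_action act x (tensor_action act y v)" for x y v
  proof (rule cbilinear_tensor_ext[of "\<lambda>x y. tensor_action act (x * y) v"])
    fix s t s' t'
    show "tensor_action act ((s \<otimes> t) * (s' \<otimes> t')) v =
        tensor_action act (s \<otimes> t) (tensor_action act (s' \<otimes> t') v)"
      by (rule tensor_ext[of "tensor_action act ((s \<otimes> t) * (s' \<otimes> t'))"])
        ((intro intros)+, simp add: tensor_of_times tensor_action_of(2)[OF act_bilinear] act_mult)
  qed (intro intros)+
  show "tensor_action act 1 v = v" for v
    by (rule tensor_ext[of "tensor_action act 1" "\<lambda>v. v"])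
      ((intro intros)+, simp add: one_tensor_def tensor_action_of(2)[OF act_bilinear] act_one)
qed

locale action_on_product = left_action act for act :: "'h::complex_algebra_1 \<Rightarrow> 'a::complex_vector \<Rightarrow> 'a" +
  fixes m :: "'a \<Rightarrow> 'a \<Rightarrow> 'a"
  assumes m_bilinear: "cbilinear m"
begin

lemmas module_clinear_intros = clinear_intros
  clinear_compose_left[OF m_bilinear] clinear_compose_right[OF m_bilinear]
  clinear_compose_left[OF act_bilinear] clinear_compose_right[OF act_bilinear]

lemma action_product_eq: "action_product act m x a b = tensor_lift (\<lambda>s t. m (act s a) (act t b)) x"
proof -
  have "tensor_lift m (tensor_lift (\<lambda>s t. act s a \<otimes> act t b) x) =
      tensor_lift (\<lambda>s t. tensor_lift m (act s a \<otimes> act t b)) x"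
    by (rule tensor_lift_comp) (intro module_clinear_intros clinear_tensor_lift m_bilinear)+
  then show ?thesis
    by (simp add: action_product_def tensor_action_of[OF act_bilinear] tensor_lift_of[OF m_bilinear])
qed

lemma action_product_of: "action_product act m (s \<otimes> t) a b = m (act s a) (act t b)"
  unfolding action_product_eq by (subst tensor_lift_of) (intro module_clinear_intros refl)+

lemma action_product_linear:
  "clinear f \<Longrightarrow> clinear (\<lambda>y. action_product act m (f y) a b)"
  "clinear g \<Longrightarrow> clinear (\<lambda>y. action_product act m x (g y) b)"
  "clinear g \<Longrightarrow> clinear (\<lambda>y. action_product act m x a (g y))"
  unfolding action_product_eq by (intro module_clinear_intros; assumption)+

lemma tensor_lift_action_product:
  "tensor_lift (\<lambda>s t. action_product act m x (act s a) (act t b)) y = action_product act m (x * y) a b"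
proof -
  note intros = module_clinear_intros action_product_linear
  have pure: "action_product act m x (act s a) (act t b) = action_product act m (x * (s \<otimes> t)) a b" for s t
    by (rule tensor_ext[of "\<lambda>x. action_product act m x (act s a) (act t b)"])
      ((intro intros)+, simp add: tensor_of_times action_product_of act_mult)
  show ?thesis
    unfolding pure
    by (rule tensor_ext[of "tensor_lift (\<lambda>s t. action_product act m (x * (s \<otimes> t)) a b)" _ y])
      ((subst tensor_lift_of | rule refl | intro intros clinear_tensor_lift)+)
qed

end

context module_algebra
begin

sublocale action_on_product act m
  by unfold_locales (fact bilinear)

lemma act_action_product: "act t (action_product act m x a b) = action_product act m (\<Delta> t * x) a b"
proof -
  have "act t (action_product act m (s \<otimes> u) a b) = action_product act m (\<Delta> t * (s \<otimes> u)) a b" for s u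
    using tensor_lift_action_product
    by (simp add: action_product_of act_product action_product_eq[symmetric])
      (rule tensor_ext[of "\<lambda>x. action_product act m x (act s a) (act u b)" _ "\<Delta> t"];
        (intro module_clinear_intros action_product_linear | simp add: tensor_of_times action_product_of act_mult))
  then show ?thesis
    by (intro tensor_ext[of "\<lambda>x. act t (action_product act m x a b)" "\<lambda>x. action_product act m (\<Delta> t * x) a b" x]
      module_clinear_intros action_product_linear)
qed

text \<open>The action of the first leg of \<open>x\<close> on the inner product distributes over it by the coproduct.\<close>

lemma action_product_assoc_left:
  "action_product act m x (action_product act m y a b) c =
    tensor_lift3 (\<lambda>r s t. m (m (act r a) (act s b)) (act t c)) (coprod_left \<Delta> x * leg12 y)"
proof -
  define \<phi> where "\<phi> = tensor_lift3 (\<lambda>r s t. m (m (act r a) (act s b)) (act t c))"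
  have tri: "ctrilinear (\<lambda>r s t. m (m (act r a) (act s b)) (act t c))"
    by (intro ctrilinearI module_clinear_intros)
  have phi: "\<phi> (tensor_assoc (w \<otimes> t)) = m (action_product act m w a b) (act t c)" for w t
    unfolding \<phi>_def tensor_lift3_assoc[OF tri] action_product_eq
    by (rule tensor_lift_comp[of "\<lambda>v. m v (act t c)", symmetric]) (intro module_clinear_intros)+
  note intros = module_clinear_intros action_product_linear
    clinear_compose[OF clinear_tensor_lift3[OF tri], folded \<phi>_def]
    clinear_compose[OF clinear_coprod_left[OF clinear_coprod]]
    clinear_compose[OF algebra_homD(1)[OF algebra_hom_leg12]]
  have "action_product act m x (action_product act m y a b) c = \<phi> (coprod_left \<Delta> x * leg12 y)"
    by (rule cbilinear_tensor_ext[of "\<lambda>x y. action_product act m x (action_product act m y a b) c"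
          "\<lambda>x y. \<phi> (coprod_left \<Delta> x * leg12 y)"])
      ((intro intros)+, simp add: action_product_of[of _ _ _ c] coprod_left_of[OF clinear_coprod] leg12_def
        act_action_product phi tensor_of_times flip: algebra_homD(2)[OF algebra_hom_tensor_assoc])
  then show ?thesis
    by (simp add: \<phi>_def)
qed

lemma action_product_assoc_right:
  "action_product act m x a (action_product act m y b c) =
    tensor_lift3 (\<lambda>r s t. m (m (act r a) (act s b)) (act t c)) (coprod_right \<Delta> x * leg23 y)"
proof -
  define \<phi> where "\<phi> = tensor_lift3 (\<lambda>r s t. m (m (act r a) (act s b)) (act t c))"
  have tri: "ctrilinear (\<lambda>r s t. m (m (act r a) (act s b)) (act t c))"
    by (intro ctrilinearI module_clinear_intros)
  have phi: "\<phi> (t \<otimes> w) = m (act t a) (action_product act m w b c)" for w t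
    unfolding \<phi>_def tensor_lift3_left[OF tri] unfolding action_product_eq assoc
    by (rule tensor_lift_comp[of "\<lambda>v. m (act t a) v", symmetric]) (intro module_clinear_intros)+
  note intros = module_clinear_intros action_product_linear
    clinear_compose[OF clinear_tensor_lift3[OF tri], folded \<phi>_def]
    clinear_compose[OF clinear_coprod_right[OF clinear_coprod]]
    clinear_compose[OF algebra_homD(1)[OF algebra_hom_leg23]]
  have "action_product act m x a (action_product act m y b c) = \<phi> (coprod_right \<Delta> x * leg23 y)"
    by (rule cbilinear_tensor_ext[of "\<lambda>x y. action_product act m x a (action_product act m y b c)"
          "\<lambda>x y. \<phi> (coprod_right \<Delta> x * leg23 y)"])
      ((intro intros)+, simp add: action_product_of[of _ _ a] coprod_right_of[OF clinear_coprod] leg23_def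
        act_action_product phi tensor_of_times)
  then show ?thesis
    by (simp add: \<phi>_def)
qed

lemma action_product_unit:
  "action_product act m x e b = act (counit_left \<epsilon> x) b"
  "action_product act m x b e = act (counit_right \<epsilon> x) b"
proof -
  note intros = module_clinear_intros action_product_linear
    clinear_compose[OF clinear_counit_left] clinear_compose[OF clinear_counit_right]
  note simps = action_product_of act_unit cbilinear_simps[OF bilinear] cbilinear_simps[OF act_bilinear]
    left_unit right_unit counit_left_of counit_right_of
  show "action_product act m x e b = act (counit_left \<epsilon> x) b"
    by (rule tensor_ext[of "\<lambda>x. action_product act m x e b"]) ((intro intros)+, simp add: simps)
  show "action_product act m x b e = act (counit_right \<epsilon> x) b"
    by (rule tensor_ext[of "\<lambda>x. action_product act m x b e"]) ((intro intros)+, simp add: simps)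
qed

theorem deformed_module_algebra:
  assumes "drinfeld_twist \<Delta> \<epsilon> \<Psi>"
  shows "module_algebra (twisted_coprod \<Delta> \<Psi>) \<epsilon> (twisted_antipode S \<Psi>) act
    (action_product act m (inverse_of \<Psi>)) e"
proof -
  obtain F where F: "is_inverse \<Psi> F"
    using assms by (auto simp: drinfeld_twist_def)
  interpret hopf_twist \<Delta> \<epsilon> S \<Psi> F
    by unfold_locales (use F assms in \<open>simp_all add: drinfeld_twist_def is_inverse_def\<close>)
  have bil: "cbilinear (action_product act m F)"
    by (intro cbilinearI' action_product_linear clinear_ident)
  have alg: "unital_algebra (action_product act m F) e"
    by (rule unital_algebra.intro)
      (simp_all add: bil action_product_assoc_left action_product_assoc_right twist_inverse_identity
        action_product_unit counit_left_inverse counit_right_inverse act_one)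
  have "act t (action_product act m F a b) =
      tensor_lift (\<lambda>t\<^sub>1 t\<^sub>2. action_product act m F (act t\<^sub>1 a) (act t\<^sub>2 b)) (twisted_coprod \<Delta> \<Psi> t)" for t a b
    by (simp add: act_action_product tensor_lift_action_product twisted_coprod_def inverse_of_twist
        hom_twist[OF algebra_hom_id, simplified] mult.assoc)
  then show ?thesis
    unfolding inverse_of_twist
    by (intro module_algebra.intro module_algebra_axioms.intro twisted_hopf_algebra alg
        left_action_axioms act_unit)
qed

end

section \<open>Transport along the quantization map\<close>

lemma bij_clinear_inv:
  assumes "clinear q" "bij q"
  shows "clinear (inv q)" "q (inv q x) = x" "inv q (q a) = a"
proof -
  show *: "q (inv q x) = x" "inv q (q a) = a" for x a
    using assms(2) by (simp_all add: bij_is_surj surj_f_inv_f bij_is_inj inv_f_f)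
  have "inv q (q a + q b) = a + b" "inv q (c *\<^sub>C q a) = c *\<^sub>C a" for a b c
    using * clinear_simps(1,2)[OF assms(1)] by metis+
  then show "clinear (inv q)"
    unfolding clinear_iff using * by metis
qed

context
  fixes q :: "'a::complex_vector \<Rightarrow> 'b::complex_vector"
  assumes q: "clinear q" "bij q"
begin

lemmas q_simps = bij_clinear_inv(2,3)[OF q]
lemmas q_intros = clinear_compose[OF q(1)] clinear_compose[OF bij_clinear_inv(1)[OF q]]

lemma quantized_left_action:
  assumes "left_action act"
  shows "left_action (quantized_action q act)"
proof -
  interpret left_action act by fact
  show ?thesis
    unfolding quantized_action_def
    by (rule left_action.intro; (intro cbilinearI' q_intros clinear_ident clinear_compose_left[OF act_bilinear]
        clinear_compose_right[OF act_bilinear] | simp add: act_mult act_one q_simps))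
qed

lemma quantized_module_algebra:
  assumes "module_algebra \<Delta> \<epsilon> S act m e"
  shows "module_algebra \<Delta> \<epsilon> S (quantized_action q act) (\<lambda>x y. q (m (inv q x) (inv q y))) (q e)"
proof -
  interpret module_algebra \<Delta> \<epsilon> S act m e by fact
  note intros = q_intros module_clinear_intros
  have "unital_algebra (\<lambda>x y. q (m (inv q x) (inv q y))) (q e)"
    by (rule unital_algebra.intro; (intro intros | simp add: assoc left_unit right_unit q_simps))
  moreover have "q (act t (m a b)) = tensor_lift (\<lambda>t\<^sub>1 t\<^sub>2. q (m (act t\<^sub>1 a) (act t\<^sub>2 b))) (\<Delta> t)" for t a b
    unfolding act_product by (rule tensor_lift_comp) (intro intros q)+
  ultimately show ?thesis
    by (intro module_algebra.intro module_algebra_axioms.intro hopf_algebra_axioms quantized_left_action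
        left_action_axioms)
      (simp_all add: quantized_action_def q_simps act_unit clinear_simps[OF q(1)])
qed

lemma quantized_tensor_action:
  assumes "cbilinear act"
  shows "tensor_map q q (tensor_action act x v) = tensor_action (quantized_action q act) x (tensor_map q q v)"
proof -
  have bil: "cbilinear (quantized_action q act)"
    unfolding quantized_action_def
    by (intro cbilinearI' q_intros clinear_ident clinear_compose_left[OF assms] clinear_compose_right[OF assms])
  note intros = clinear_intros clinear_compose[OF clinear_tensor_map[OF q(1) q(1)]]
    clinear_compose_left[OF cbilinear_tensor_action[OF assms]] clinear_compose_right[OF cbilinear_tensor_action[OF assms]]
    clinear_compose_left[OF cbilinear_tensor_action[OF bil]] clinear_compose_right[OF cbilinear_tensor_action[OF bil]]
  show ?thesis
    by (rule cbilinear_tensor_ext[of "\<lambda>x v. tensor_map q q (tensor_action act x v)"])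
      ((intro intros)+, simp add: tensor_action_of(2)[OF assms] tensor_action_of(2)[OF bil] tensor_map_of[OF q(1) q(1)],
        simp add: quantized_action_def q_simps)
qed

lemma quantized_tensor_lift:
  assumes "cbilinear m"
  shows "q (tensor_lift m v) = tensor_lift (\<lambda>x y. q (m (inv q x) (inv q y))) (tensor_map q q v)"
proof -
  have bil: "cbilinear (\<lambda>x y. q (m (inv q x) (inv q y)))"
    by (intro cbilinearI' q_intros clinear_ident clinear_compose_left[OF assms] clinear_compose_right[OF assms])
  note intros = q_intros clinear_compose[OF clinear_tensor_lift[OF bil]] clinear_tensor_map q
    clinear_tensor_lift assms
  show ?thesis
    by (rule tensor_ext[of "\<lambda>v. q (tensor_lift m v)"])
      ((intro intros)+, simp add: tensor_lift_of[OF bil] tensor_lift_of[OF assms] tensor_map_of[OF q(1) q(1)] q_simps)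
qed

lemma deformed_product_eq:
  assumes "cbilinear act" "cbilinear m"
  shows "deformed_product q act m \<Psi> =
    action_product (quantized_action q act) (\<lambda>x y. q (m (inv q x) (inv q y))) (inverse_of \<Psi>)"
  by (intro ext) (simp add: deformed_product_def action_product_def quantized_tensor_lift[OF assms(2)]
      quantized_tensor_action[OF assms(1)] tensor_map_of[OF q(1) q(1)] q_simps)

end


section \<open>Eigenvectors modulo a subspace\<close>

text \<open>Eigenvectors of \<open>T\<close> on the quotient by \<open>I\<close>, represented upstairs; elements of an invariant \<open>I\<close>
  are eigenvectors for every eigenvalue.\<close>

definition eigenvectors :: "('v::complex_vector \<Rightarrow> 'v) \<Rightarrow> 'v set \<Rightarrow> int \<Rightarrow> 'v set"
  where "eigenvectors T I n = {v. T v - of_int n *\<^sub>C v \<in> I}"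

abbreviation csubspace :: "'v::complex_vector set \<Rightarrow> bool"
  where "csubspace \<equiv> complex_vector.subspace"

abbreviation cspan :: "'v::complex_vector set \<Rightarrow> 'v set"
  where "cspan \<equiv> complex_vector.span"

lemmas csubspace_simps = complex_vector.subspace_0 complex_vector.subspace_add
  complex_vector.subspace_diff complex_vector.subspace_scale complex_vector.subspace_sum

lemma csubspace_eigenvectors:
  assumes "clinear T" "csubspace I"
  shows "csubspace (eigenvectors T I n)"
proof (rule complex_vector.subspaceI)
  show "0 \<in> eigenvectors T I n"
    using assms by (simp add: eigenvectors_def clinear_simps csubspace_simps)
  show "x + y \<in> eigenvectors T I n" if "x \<in> eigenvectors T I n" "y \<in> eigenvectors T I n" for x y
  proof -
    have "T (x + y) - of_int n *\<^sub>C (x + y) = (T x - of_int n *\<^sub>C x) + (T y - of_int n *\<^sub>C y)"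
      by (simp add: clinear_simps[OF assms(1)] scaleC_add_right)
    then show ?thesis
      using that assms(2) by (simp add: eigenvectors_def csubspace_simps)
  qed
  show "c *\<^sub>C x \<in> eigenvectors T I n" if "x \<in> eigenvectors T I n" for c x
  proof -
    have "T (c *\<^sub>C x) - of_int n *\<^sub>C (c *\<^sub>C x) = c *\<^sub>C (T x - of_int n *\<^sub>C x)"
      by (simp add: clinear_simps[OF assms(1)] complex_vector.scale_right_diff_distrib scaleC_scaleC mult.commute)
    then show ?thesis
      using that assms(2) by (simp add: eigenvectors_def csubspace_simps)
  qed
qed

text \<open>Applying \<open>T - k\<close> to the sum removes the component for \<open>k\<close> and rescales the others by nonzero
  factors, so the claim follows by induction on the number of components.  For \<open>W = I\<close> this is the
  uniqueness of eigenvector decompositions modulo \<open>I\<close>.\<close>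

lemma eigenvector_components:
  assumes T: "clinear T" and W: "csubspace W" "\<And>w. w \<in> W \<Longrightarrow> T w \<in> W"
    and "finite N" "\<And>n. n \<in> N \<Longrightarrow> v n \<in> eigenvectors T W n" "(\<Sum>n\<in>N. v n) \<in> W"
  shows "\<forall>n\<in>N. v n \<in> W"
  using assms(4-)
proof (induction N arbitrary: v rule: finite_induct)
  case (insert k N)
  let ?s = "\<Sum>n\<in>insert k N. v n"
  have eig: "T (v n) - of_int n *\<^sub>C v n \<in> W" if "n \<in> insert k N" for n
    using insert.prems(1) that by (simp add: eigenvectors_def)
  have "T ?s - of_int k *\<^sub>C ?s \<in> W"
    using insert.prems(2) W by (simp add: csubspace_simps del: sum.insert)
  moreover have "(\<Sum>n\<in>insert k N. T (v n) - of_int n *\<^sub>C v n) \<in> W"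
    by (rule complex_vector.subspace_sum[OF W(1) eig])
  ultimately have "(T ?s - of_int k *\<^sub>C ?s) - (\<Sum>n\<in>insert k N. T (v n) - of_int n *\<^sub>C v n) \<in> W"
    using W(1) by (simp add: complex_vector.subspace_diff del: sum.insert)
  also have "(T ?s - of_int k *\<^sub>C ?s) - (\<Sum>n\<in>insert k N. T (v n) - of_int n *\<^sub>C v n) =
      (\<Sum>n\<in>insert k N. (of_int n - of_int k) *\<^sub>C v n)"
    by (simp add: clinear_sum[OF T] complex_vector.scale_sum_right sum_subtractf
        complex_vector.scale_left_diff_distrib del: sum.insert)
  also have "\<dots> = (\<Sum>n\<in>N. (of_int n - of_int k) *\<^sub>C v n)"
    using insert.hyps by simp
  finally have "(\<Sum>n\<in>N. (of_int n - of_int k) *\<^sub>C v n) \<in> W" .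
  moreover have "(of_int n - of_int k) *\<^sub>C v n \<in> eigenvectors T W n" if "n \<in> N" for n
    using csubspace_eigenvectors[OF T W(1)] insert.prems(1)[of n] that by (simp add: csubspace_simps)
  ultimately have *: "\<forall>n\<in>N. (of_int n - of_int k) *\<^sub>C v n \<in> W"
    by (intro insert.IH)
  have N: "v n \<in> W" if "n \<in> N" for n
  proof -
    have "inverse (of_int n - of_int k) *\<^sub>C (of_int n - of_int k) *\<^sub>C v n \<in> W"
      using * that by (intro complex_vector.subspace_scale[OF W(1), of "_ *\<^sub>C _"]) auto
    moreover have "(of_int n :: complex) \<noteq> of_int k"
      using insert.hyps(2) that by auto
    ultimately show ?thesis
      by (simp add: scaleC_scaleC scaleC_one)
  qed
  then have "?s - (\<Sum>n\<in>N. v n) \<in> W"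
    by (rule complex_vector.subspace_diff[OF W(1) insert.prems(2) complex_vector.subspace_sum[OF W(1)]])
  then have "v k \<in> W"
    using insert.hyps by simp
  with N show ?case
    by simp
qed simp

lemma cspan_eigenvectors_decompose:
  assumes T: "clinear T" and I: "csubspace I" and "w \<in> cspan (\<Union>n. eigenvectors T I n)"
  obtains N v where "finite N" "\<And>n. v n \<in> eigenvectors T I n" "w = (\<Sum>n\<in>N. v n)"
proof -
  note E = csubspace_eigenvectors[OF T I]
  have "\<exists>N v. finite N \<and> (\<forall>n. v n \<in> eigenvectors T I n) \<and> w = (\<Sum>n\<in>N. v n)"
    using assms(3)
  proof (induction rule: complex_vector.span_induct_alt)
    case base
    have "(0::'a) = (\<Sum>n\<in>{}. 0)" "\<forall>n. 0 \<in> eigenvectors T I n"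
      using E by (auto simp: csubspace_simps)
    then show ?case
      by (intro exI[of _ "{}"] exI[of _ "\<lambda>_. 0"]) simp
  next
    case (step c x y)
    obtain k where k: "x \<in> eigenvectors T I k"
      using step.hyps by auto
    obtain N v where v: "finite N" "\<forall>n. v n \<in> eigenvectors T I n" "y = (\<Sum>n\<in>N. v n)"
      using step.IH by auto
    define u where "u n = (if n \<in> N then v n else 0) + (if n = k then c *\<^sub>C x else 0)" for n
    have "\<forall>n. u n \<in> eigenvectors T I n"
      using E k v by (auto simp: u_def csubspace_simps)
    moreover have "(\<Sum>n\<in>insert k N. u n) = c *\<^sub>C x + y"
    proof -
      have "(\<Sum>n\<in>insert k N. if n \<in> N then v n else 0) = y"
        unfolding v(3) using v(1) by (intro sum.mono_neutral_cong_right) auto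
      then show ?thesis
        using v(1) by (simp add: u_def sum.distrib add.commute)
    qed
    ultimately show ?case
      using v(1) by (intro exI[of _ "insert k N"] exI[of _ u]) simp
  qed
  then show ?thesis
    using that by blast
qed

text \<open>The components lie in \<open>W + I\<close> by the previous lemma, and their parts in \<open>W\<close> still are eigenvectors
  modulo \<open>I\<close>.\<close>

lemma eigenvectors_decompose:
  assumes T: "clinear T" and I: "csubspace I" "\<And>v. v \<in> I \<Longrightarrow> T v \<in> I"
    and W: "csubspace W" "\<And>w. w \<in> W \<Longrightarrow> T w \<in> W"
    and w: "w \<in> W" "w \<in> cspan (\<Union>n. eigenvectors T I n)"
  shows "\<exists>N v. finite N \<and> (\<forall>n\<in>N. v n \<in> W \<and> v n \<in> eigenvectors T I n) \<and> w - (\<Sum>n\<in>N. v n) \<in> I"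
proof -
  obtain N v where v: "finite N" "\<And>n. v n \<in> eigenvectors T I n" "w = (\<Sum>n\<in>N. v n)"
    using cspan_eigenvectors_decompose[OF T I(1) w(2)] by metis
  define V where "V = {x + y |x y. x \<in> W \<and> y \<in> I}"
  have sub: "csubspace V"
    unfolding V_def using W(1) I(1) by (rule complex_vector.subspace_sums)
  have "I \<subseteq> V" "W \<subseteq> V"
    unfolding V_def using complex_vector.subspace_0[OF W(1)] complex_vector.subspace_0[OF I(1)] by force+
  moreover have "T x \<in> V" if "x \<in> V" for x
    using that W(2) I(2) clinear_simps(1)[OF T] unfolding V_def by fast
  ultimately have "\<forall>n\<in>N. v n \<in> V"
    using v w(1) by (intro eigenvector_components[OF T sub]) (auto simp: eigenvectors_def)
  then have "\<forall>n\<in>N. \<exists>x. x \<in> W \<and> v n - x \<in> I"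
    unfolding V_def by force
  then obtain r where r: "\<And>n. n \<in> N \<Longrightarrow> r n \<in> W \<and> v n - r n \<in> I"
    by metis
  have "r n \<in> eigenvectors T I n" if "n \<in> N" for n
  proof -
    have "v n - r n \<in> eigenvectors T I n"
      using r[OF that] I by (simp add: eigenvectors_def csubspace_simps)
    from complex_vector.subspace_diff[OF csubspace_eigenvectors[OF T I(1)] v(2)[of n] this]
    show ?thesis by simp
  qed
  moreover have "w - (\<Sum>n\<in>N. r n) \<in> I"
    unfolding v(3) sum_subtractf[symmetric] using r by (intro complex_vector.subspace_sum[OF I(1)]) auto
  ultimately show ?thesis
    using v(1) r by (intro exI[of _ N] exI[of _ r]) simp
qed

lemma eigenvectors_spanI:
  assumes "csubspace I" "\<And>v. v \<in> I \<Longrightarrow> T v \<in> I"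
    and "\<And>n. n \<in> N \<Longrightarrow> v n \<in> eigenvectors T I (\<nu> n)" "w - (\<Sum>n\<in>N. v n) \<in> I"
  shows "w \<in> cspan (\<Union>n. eigenvectors T I n)"
proof -
  have "w - (\<Sum>n\<in>N. v n) \<in> eigenvectors T I 0"
    using assms by (simp add: eigenvectors_def csubspace_simps)
  then have "(w - (\<Sum>n\<in>N. v n)) + (\<Sum>n\<in>N. v n) \<in> cspan (\<Union>n. eigenvectors T I n)"
    using assms(3) by (intro complex_vector.span_add complex_vector.span_sum complex_vector.span_base) auto
  then show ?thesis
    by simp
qed

text \<open>The map \<open>g\<close> embeds the quotient by the preimage of \<open>I\<close> as an invariant subspace of the quotient by
  \<open>I\<close>.  With \<open>g\<close> a right multiplication, an algebra homomorphism, or the evaluation of an action at a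
  vector, this yields the stability properties of weight ideals.\<close>

lemma eigenvectors_span_vimage:
  fixes g :: "'r::complex_vector \<Rightarrow> 'v::complex_vector"
  assumes g: "clinear g" "\<And>r. g (S r) = T (g r)"
    and T: "clinear T" and I: "csubspace I" "\<And>v. v \<in> I \<Longrightarrow> T v \<in> I"
    and "g r \<in> cspan (\<Union>n. eigenvectors T I n)"
  shows "r \<in> cspan (\<Union>n. eigenvectors S (g -` I) n)"
proof -
  have range: "csubspace (range g)"
  proof (rule complex_vector.subspaceI)
    show "0 \<in> range g"
      using clinear_simps(3)[OF g(1)] by (metis rangeI)
    show "x + y \<in> range g" if "x \<in> range g" "y \<in> range g" for x y
      using that by (auto simp flip: clinear_simps(1)[OF g(1)])
    show "c *\<^sub>C x \<in> range g" if "x \<in> range g" for c x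
      using that by (auto simp flip: clinear_simps(2)[OF g(1)])
  qed
  have stable: "T w \<in> range g" if "w \<in> range g" for w
    using that by (auto simp flip: g(2))
  obtain N v where v: "\<forall>n\<in>N. v n \<in> range g \<and> v n \<in> eigenvectors T I n"
    "g r - (\<Sum>n\<in>N. v n) \<in> I"
    using eigenvectors_decompose[OF T I range stable rangeI assms(6)] by blast
  have "\<forall>n\<in>N. \<exists>s. v n = g s"
    using v(1) by blast
  then obtain s where s: "\<forall>n\<in>N. v n = g (s n)"
    by (rule bchoice[THEN exE])
  show ?thesis
  proof (rule eigenvectors_spanI)
    show "csubspace (g -` I)"
      using I(1) by (auto intro!: complex_vector.subspaceI simp: clinear_simps[OF g(1)] csubspace_simps)
    show "S x \<in> g -` I" if "x \<in> g -` I" for x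
      using that I(2) by (simp add: g(2))
    show "s n \<in> eigenvectors S (g -` I) n" if "n \<in> N" for n
      using v(1) s that by (simp add: eigenvectors_def g(2) clinear_simps[OF g(1)])
    show "r - (\<Sum>n\<in>N. s n) \<in> g -` I"
      using v(2) s by (simp add: clinear_simps[OF g(1)] clinear_sum[OF g(1)])
  qed
qed


section \<open>Weight ideals\<close>

lemma left_ideal_csubspace: "left_ideal I \<Longrightarrow> csubspace I"
proof (rule complex_vector.subspaceI)
  fix c x assume "left_ideal I" "x \<in> I"
  then have "(c *\<^sub>C 1) * x \<in> I"
    unfolding left_ideal_def by blast
  then show "c *\<^sub>C x \<in> I"
    by (simp add: mult_scaleC_left)
qed (auto simp: left_ideal_def)

lemma left_ideal_mult: "left_ideal I \<Longrightarrow> x \<in> I \<Longrightarrow> r * x \<in> I"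
  by (simp add: left_ideal_def)

lemma left_ideal_colon: "left_ideal I \<Longrightarrow> left_ideal {z. z * r \<in> I}"
  by (auto simp: left_ideal_def distrib_right mult.assoc)

lemma left_ideal_vimage:
  assumes "algebra_hom f" "left_ideal J"
  shows "left_ideal (f -` J)"
  using assms(2) by (auto simp: left_ideal_def algebra_homD(2)[OF assms(1)]
      clinear_simps[OF algebra_homD(1)[OF assms(1)]])

lemma clinear_mult_left: "clinear ((*) (x :: 'r::complex_algebra_1))"
  by (intro clinear_intros)

abbreviation weight_element :: "'r::complex_algebra_1 set \<Rightarrow> 'r \<Rightarrow> bool"
  where "weight_element I x \<equiv> weight_ideal {x} I"

lemma weight_element_iff:
  fixes x :: "'a::complex_algebra_1"
  shows "weight_element I x \<longleftrightarrow> left_ideal I \<and> (\<forall>r. r \<in> cspan (\<Union>n. eigenvectors ((*) x) I n))"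
proof -
  have "{r. \<forall>c\<in>{x}. \<exists>n::int. c * r - of_int n *\<^sub>C r \<in> I} = (\<Union>n. eigenvectors ((*) x) I n)"
    by (auto simp: eigenvectors_def)
  moreover have "X = UNIV \<longleftrightarrow> (\<forall>r. r \<in> X)" for X :: "'a set"
    by blast
  ultimately show ?thesis
    by (simp only: weight_ideal_def)
qed

lemma weight_ideal_left_ideal: "weight_ideal C I \<Longrightarrow> left_ideal I"
  by (simp add: weight_ideal_def)

lemma weight_ideal_antimono: "weight_ideal C I \<Longrightarrow> C' \<subseteq> C \<Longrightarrow> weight_ideal C' I"
proof -
  assume "weight_ideal C I" and "C' \<subseteq> C"
  have "{r. \<forall>c\<in>C. \<exists>n::int. c * r - of_int n *\<^sub>C r \<in> I} \<subseteq>
      {r. \<forall>c\<in>C'. \<exists>n::int. c * r - of_int n *\<^sub>C r \<in> I}"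
    using \<open>C' \<subseteq> C\<close> by blast
  from complex_vector.span_mono[OF this] show ?thesis
    using \<open>weight_ideal C I\<close> unfolding weight_ideal_def by auto
qed

lemma weight_element_colon:
  assumes "weight_element I x"
  shows "weight_element {z. z * r \<in> I} x"
proof -
  have I: "left_ideal I" "\<And>s. s \<in> cspan (\<Union>n. eigenvectors ((*) x) I n)"
    using assms by (simp_all add: weight_element_iff)
  have "s \<in> cspan (\<Union>n. eigenvectors ((*) x) ((\<lambda>z. z * r) -` I) n)" for s
    by (rule eigenvectors_span_vimage[where T = "(*) x"])
      (auto intro!: clinear_intros left_ideal_csubspace left_ideal_mult I simp: mult.assoc)
  then show ?thesis
    using left_ideal_colon[OF I(1)] by (simp add: weight_element_iff vimage_def)
qed

lemma weight_element_vimage: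
  assumes "algebra_hom f" "weight_element J (f x)"
  shows "weight_element (f -` J) x"
proof -
  have J: "left_ideal J" "\<And>s. s \<in> cspan (\<Union>n. eigenvectors ((*) (f x)) J n)"
    using assms(2) by (simp_all add: weight_element_iff)
  have "s \<in> cspan (\<Union>n. eigenvectors ((*) x) (f -` J) n)" for s
    by (rule eigenvectors_span_vimage[where T = "(*) (f x)"])
      (auto intro!: clinear_mult_left left_ideal_csubspace left_ideal_mult J
        simp: algebra_homD[OF assms(1)])
  then show ?thesis
    using left_ideal_vimage[OF assms(1) J(1)] by (simp add: weight_element_iff)
qed

text \<open>Joint eigenvectors of \<open>C\<close> with given eigenvalues form a subspace that is stable under \<open>x\<close>, so they
  decompose into eigenvectors of \<open>x\<close> inside this subspace.\<close>

lemma weight_ideal_insert: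
  assumes x: "weight_element I x" and C: "weight_ideal C I" and comm: "\<And>c. c \<in> C \<Longrightarrow> c * x = x * c"
  shows "weight_ideal (insert x C) I"
proof -
  have I: "left_ideal I" "csubspace I"
    using x by (simp_all add: weight_ideal_left_ideal left_ideal_csubspace)
  let ?E = "\<lambda>C. {r. \<forall>c\<in>C. \<exists>n::int. c * r - of_int n *\<^sub>C r \<in> I}"
  have "w \<in> cspan (?E (insert x C))" if "w \<in> ?E C" for w
  proof -
    obtain \<nu> :: "_ \<Rightarrow> int" where \<nu>: "\<And>c. c \<in> C \<Longrightarrow> w \<in> eigenvectors ((*) c) I (\<nu> c)"
      using \<open>w \<in> ?E C\<close> unfolding eigenvectors_def by simp metis
    let ?W = "\<Inter>c\<in>C. eigenvectors ((*) c) I (\<nu> c)"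
    have W: "csubspace ?W"
      by (auto intro!: complex_vector.subspace_Int csubspace_eigenvectors clinear_mult_left I)
    have stable: "x * v \<in> ?W" if "v \<in> ?W" for v
    proof
      fix c assume "c \<in> C"
      then have "c * (x * v) - of_int (\<nu> c) *\<^sub>C (x * v) = x * (c * v - of_int (\<nu> c) *\<^sub>C v)"
        by (simp add: right_diff_distrib mult_scaleC_right comm flip: mult.assoc)
      then show "x * v \<in> eigenvectors ((*) c) I (\<nu> c)"
        using left_ideal_mult[OF I(1)] that \<open>c \<in> C\<close> by (simp add: eigenvectors_def)
    qed
    have "w \<in> ?W" "w \<in> cspan (\<Union>n. eigenvectors ((*) x) I n)"
      using \<nu> x by (auto simp: weight_element_iff)
    then obtain N v where v: "\<forall>n\<in>N. v n \<in> ?W \<and> v n \<in> eigenvectors ((*) x) I n" "w - (\<Sum>n\<in>N. v n) \<in> I"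
      using eigenvectors_decompose[OF clinear_mult_left I(2) _ W, of x w]
        left_ideal_mult[OF I(1)] stable by blast
    have "w - (\<Sum>n\<in>N. v n) \<in> ?E (insert x C)"
      using v(2) I left_ideal_mult[OF I(1)] by (auto simp: csubspace_simps intro!: exI[of _ 0])
    moreover have "v n \<in> ?E (insert x C)" if "n \<in> N" for n
      using v(1) that by (auto simp: eigenvectors_def)
    ultimately have "(w - (\<Sum>n\<in>N. v n)) + (\<Sum>n\<in>N. v n) \<in> cspan (?E (insert x C))"
      by (intro complex_vector.span_add complex_vector.span_sum complex_vector.span_base)
    then show ?thesis
      by simp
  qed
  then have "cspan (?E C) \<subseteq> cspan (?E (insert x C))"
    by (intro complex_vector.span_minimal) auto
  then show ?thesis
    using C by (auto simp: weight_ideal_def)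
qed

lemma weight_ideal_iff:
  assumes "finite C" "\<And>c d. c \<in> C \<Longrightarrow> d \<in> C \<Longrightarrow> c * d = d * c"
  shows "weight_ideal C I \<longleftrightarrow> left_ideal I \<and> (\<forall>c\<in>C. weight_element I c)"
proof
  assume "left_ideal I \<and> (\<forall>c\<in>C. weight_element I c)"
  then have "left_ideal I" "\<forall>c\<in>C. weight_element I c"
    by auto
  with assms show "weight_ideal C I"
  proof (induction C rule: finite_induct)
    case empty
    then show ?case by (simp add: weight_ideal_def)
  next
    case (insert x C)
    then show ?case by (intro weight_ideal_insert[of x I C]) blast+
  qed
next
  assume "weight_ideal C I"
  then show "left_ideal I \<and> (\<forall>c\<in>C. weight_element I c)"
    using weight_ideal_left_ideal[of C I] weight_ideal_antimono[of C I] by simp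
qed

lemma weight_element_add_mult:
  assumes "weight_element I x" "weight_element I y" "x * y = y * x"
  shows "weight_element I (x + y)" "weight_element I (x * y)"
proof -
  let ?E = "\<lambda>C. {r. \<forall>c\<in>C. \<exists>n::int. c * r - of_int n *\<^sub>C r \<in> I}"
  have I: "left_ideal I" "csubspace I"
    using assms(1) by (simp_all add: weight_ideal_left_ideal left_ideal_csubspace)
  have "weight_ideal (insert x {y}) I"
    using assms by (intro weight_ideal_insert[of x I "{y}"]) auto
  then have "cspan (?E {x, y}) = UNIV"
    by (simp add: weight_ideal_def)
  moreover have "?E {x, y} \<subseteq> ?E {x + y}" "?E {x, y} \<subseteq> ?E {x * y}"
  proof safe
    fix r
    assume "\<forall>c\<in>{x, y}. \<exists>n::int. c * r - of_int n *\<^sub>C r \<in> I"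
    then obtain n k :: int where nk: "x * r - of_int n *\<^sub>C r \<in> I" "y * r - of_int k *\<^sub>C r \<in> I"
      by auto
    have "(x + y) * r - of_int (n + k) *\<^sub>C r = (x * r - of_int n *\<^sub>C r) + (y * r - of_int k *\<^sub>C r)"
      by (simp add: distrib_right scaleC_add_left)
    then have "(x + y) * r - of_int (n + k) *\<^sub>C r \<in> I"
      using complex_vector.subspace_add[OF I(2) nk] by simp
    then show "\<exists>n::int. (x + y) * r - of_int n *\<^sub>C r \<in> I" ..
    have "x * y * r - of_int (n * k) *\<^sub>C r =
        x * (y * r - of_int k *\<^sub>C r) + of_int k *\<^sub>C (x * r - of_int n *\<^sub>C r)"
      by (simp add: right_diff_distrib mult_scaleC_right mult.assoc scaleC_scaleC mult.commute[of "of_int k"]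
          complex_vector.scale_right_diff_distrib)
    then have "x * y * r - of_int (n * k) *\<^sub>C r \<in> I"
      using complex_vector.subspace_add[OF I(2) left_ideal_mult[OF I(1) nk(2), of x]
          complex_vector.subspace_scale[OF I(2) nk(1), of "of_int k"]] by simp
    then show "\<exists>n::int. x * y * r - of_int n *\<^sub>C r \<in> I" ..
  qed
  ultimately have "cspan (?E {x + y}) = UNIV" "cspan (?E {x * y}) = UNIV"
    using complex_vector.span_mono[of "?E {x, y}" "?E {x + y}"]
      complex_vector.span_mono[of "?E {x, y}" "?E {x * y}"] by (simp_all only: UNIV_I top.extremum_unique)
  then show "weight_element I (x + y)" "weight_element I (x * y)"
    using I(1) by (simp_all only: weight_ideal_def simp_thms)
qed

lemma weight_element_uminus:
  assumes "weight_element I x"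
  shows "weight_element I (- x)"
proof -
  let ?E = "\<lambda>c. {r. \<exists>n::int. c * r - of_int n *\<^sub>C r \<in> I}"
  have I: "left_ideal I" "csubspace I"
    using assms(1) by (simp_all add: weight_ideal_left_ideal left_ideal_csubspace)
  have "?E x \<subseteq> ?E (- x)"
  proof safe
    fix r and n :: int assume "x * r - of_int n *\<^sub>C r \<in> I"
    then have "- (x * r - of_int n *\<^sub>C r) \<in> I"
      using I(2) by (rule complex_vector.subspace_neg[rotated])
    then show "\<exists>n::int. - x * r - of_int n *\<^sub>C r \<in> I"
      by (intro exI[of _ "- n"]) simp
  qed
  from complex_vector.span_mono[OF this] show ?thesis
    using assms by (auto simp: weight_ideal_def)
qed

lemma weight_element_0: "left_ideal I \<Longrightarrow> weight_element I 0"
proof -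
  assume I: "left_ideal I"
  then have "{r. \<exists>n::int. 0 * r - of_int n *\<^sub>C r \<in> I} = UNIV"
    by (auto simp: left_ideal_def intro!: exI[of _ 0])
  with I show ?thesis
    by (simp add: weight_ideal_def)
qed

text \<open>An eigenvector modulo \<open>I\<close> with eigenvalue \<open>n\<close> decomposes modulo \<open>J\<close> into vectors \<open>r\<close> that have
  eigenvalue \<open>n\<close> modulo \<open>I\<close> and eigenvalue \<open>k\<close> modulo \<open>J\<close>.  For \<open>k \<noteq> n\<close> the vectors \<open>x r - k r\<close> in
  \<open>J\<close> and \<open>x r - n r\<close> in \<open>I\<close> are eigenvectors modulo \<open>I \<inter> J\<close>, and \<open>r\<close> is a multiple of their
  difference.\<close>

lemma weight_element_Int:
  assumes "weight_element I x" "weight_element J x"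
  shows "weight_element (I \<inter> J) x"
proof -
  have I: "left_ideal I" "csubspace I" and J: "left_ideal J" "csubspace J"
    using assms by (simp_all add: weight_ideal_left_ideal left_ideal_csubspace)
  let ?eig = "eigenvectors ((*) x)"
  let ?E = "\<Union>n. ?eig (I \<inter> J) n"
  note lin = clinear_mult_left[of x]
  have "v \<in> cspan ?E" if "v \<in> ?eig I n" for v n
  proof -
    have stable: "x * w \<in> ?eig I n" if "w \<in> ?eig I n" for w
    proof -
      have "x * (x * w) - of_int n *\<^sub>C (x * w) = x * (x * w - of_int n *\<^sub>C w)"
        by (simp add: right_diff_distrib mult_scaleC_right)
      then show ?thesis
        using left_ideal_mult[OF I(1)] that by (simp add: eigenvectors_def)
    qed
    have span: "v \<in> cspan (\<Union>n. ?eig J n)"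
      using assms(2) by (simp add: weight_element_iff)
    have "\<exists>N r. finite N \<and> (\<forall>k\<in>N. r k \<in> ?eig I n \<and> r k \<in> ?eig J k) \<and> v - (\<Sum>k\<in>N. r k) \<in> J"
      by (rule eigenvectors_decompose[OF lin J(2) _ csubspace_eigenvectors[OF lin I(2)] stable that span])
        (rule left_ideal_mult[OF J(1)])
    then obtain N r where r: "\<forall>k\<in>N. r k \<in> ?eig I n \<and> r k \<in> ?eig J k"
      "v - (\<Sum>k\<in>N. r k) \<in> J"
      by blast
    have "r k \<in> cspan ?E" if "k \<in> N" for k
    proof (cases "k = n")
      case True
      then have "r k \<in> ?eig (I \<inter> J) n"
        using r(1) that by (auto simp: eigenvectors_def)
      then show ?thesis
        by (intro complex_vector.span_base) blast
    next
      case False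
      define a where "a = x * r k - of_int k *\<^sub>C r k"
      define b where "b = x * r k - of_int n *\<^sub>C r k"
      have ab: "a \<in> J" "b \<in> I"
        using r(1) that by (simp_all add: a_def b_def eigenvectors_def)
      have "x * a - of_int n *\<^sub>C a = x * b - of_int k *\<^sub>C b"
        by (simp add: a_def b_def right_diff_distrib mult_scaleC_right scaleC_scaleC mult.commute
            complex_vector.scale_right_diff_distrib)
      moreover have "x * a - of_int n *\<^sub>C a \<in> J" "x * b - of_int k *\<^sub>C b \<in> I"
        using ab I J left_ideal_mult[OF I(1)] left_ideal_mult[OF J(1)] by (simp_all add: csubspace_simps)
      ultimately have "a \<in> ?eig (I \<inter> J) n" "b \<in> ?eig (I \<inter> J) k"
        by (simp_all add: eigenvectors_def)
      then have "inverse (of_int n - of_int k) *\<^sub>C (a - b) \<in> cspan ?E"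
        by (intro complex_vector.span_scale complex_vector.span_diff complex_vector.span_base) auto
      moreover have "a - b = (of_int n - of_int k) *\<^sub>C r k"
        by (simp add: a_def b_def complex_vector.scale_left_diff_distrib)
      ultimately show ?thesis
        using False by (simp add: scaleC_scaleC scaleC_one)
    qed
    moreover have "v - (\<Sum>k\<in>N. r k) \<in> cspan ?E"
    proof -
      have "v - (\<Sum>k\<in>N. r k) \<in> ?eig I n"
        using r(1) that csubspace_eigenvectors[OF lin I(2)] by (simp add: csubspace_simps)
      moreover have "v - (\<Sum>k\<in>N. r k) \<in> ?eig J n"
        using r(2) J left_ideal_mult[OF J(1)] by (simp add: eigenvectors_def csubspace_simps)
      ultimately have "v - (\<Sum>k\<in>N. r k) \<in> ?eig (I \<inter> J) n"
        by (simp add: eigenvectors_def)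
      then show ?thesis
        by (intro complex_vector.span_base) blast
    qed
    ultimately have "(v - (\<Sum>k\<in>N. r k)) + (\<Sum>k\<in>N. r k) \<in> cspan ?E"
      by (intro complex_vector.span_add complex_vector.span_sum)
    then show ?thesis
      by simp
  qed
  then have "cspan (\<Union>n. ?eig I n) \<subseteq> cspan ?E"
    by (intro complex_vector.span_minimal) auto
  moreover have "left_ideal (I \<inter> J)"
    using I(1) J(1) by (simp add: left_ideal_def)
  ultimately show ?thesis
    using assms(1) by (auto simp: weight_element_iff)
qed

lemma weight_element_annihilator:
  assumes "left_action act" "\<And>v. v \<in> cspan (\<Union>n. eigenvectors (act x) {0} n)"
  shows "weight_element {z. act z v = 0} x"
proof -
  interpret left_action act by fact
  have lin: "clinear (act z)" "clinear (\<lambda>z. act z v)" for z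
    using act_bilinear by (simp_all add: cbilinear_def)
  have "r \<in> cspan (\<Union>n. eigenvectors ((*) x) ((\<lambda>z. act z v) -` {0}) n)" for r
    by (rule eigenvectors_span_vimage[where T = "act x"])
      (auto simp: lin act_mult clinear_simps[OF lin(1)] complex_vector.subspace_single_0 assms(2))
  moreover have "left_ideal {z. act z v = 0}"
    by (auto simp: left_ideal_def act_mult clinear_simps[OF lin(1)] clinear_simps[OF lin(2)])
  ultimately show ?thesis
    by (simp add: weight_element_iff vimage_def)
qed


section \<open>The completed algebra\<close>

definition coset :: "'r::complex_algebra_1 set \<Rightarrow> 'r \<Rightarrow> 'r set"
  where "coset I r = {s. s - r \<in> I}"

lemma coset_eq:
  assumes "left_ideal I" "r - s \<in> I"
  shows "coset I r = coset I s"
proof -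
  note I = left_ideal_csubspace[OF assms(1)]
  have "x - r \<in> I \<longleftrightarrow> x - s \<in> I" for x
    using complex_vector.subspace_add[OF I _ assms(2), of "x - r"]
      complex_vector.subspace_diff[OF I _ assms(2), of "x - s"] by auto
  then show ?thesis
    by (simp add: coset_def)
qed

lemma coset_self: "left_ideal I \<Longrightarrow> r \<in> coset I r"
  by (simp add: coset_def left_ideal_def)

lemma completion_of_coset: "weight_ideal C I \<Longrightarrow> completion_of C r I = coset I r"
  by (simp add: completion_of_def coset_def)

lemma completion_of_self: "weight_ideal C I \<Longrightarrow> r \<in> completion_of C r I"
  by (simp add: completion_of_coset coset_self[OF weight_ideal_left_ideal])

lemma completion_value:
  assumes "x \<in> completion C"
  shows "if weight_ideal C I then \<exists>s. x I = coset I s else x I = {}"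
  using assms unfolding completion_def coset_def by blast

lemma completion_coset:
  assumes "x \<in> completion C" "weight_ideal C I" "r \<in> x I"
  shows "x I = coset I r"
proof -
  obtain s where "x I = coset I s"
    using completion_value[OF assms(1), of I] assms(2) by auto
  with assms(3) have "x I = coset I s" "r - s \<in> I"
    by (simp_all add: coset_def)
  then show ?thesis
    using coset_eq[OF weight_ideal_left_ideal[OF assms(2)]] by simp
qed

lemma completion_nonempty:
  assumes "x \<in> completion C" "weight_ideal C I"
  obtains r where "r \<in> x I"
proof -
  obtain s where "x I = coset I s"
    using completion_value[OF assms(1), of I] assms(2) by auto
  then show ?thesis
    using coset_self[OF weight_ideal_left_ideal[OF assms(2)]] that by blast
qed

lemma completion_mono:
  "x \<in> completion C \<Longrightarrow> weight_ideal C I \<Longrightarrow> weight_ideal C J \<Longrightarrow> I \<subseteq> J \<Longrightarrow> r \<in> x I \<Longrightarrow> r \<in> x J"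
  unfolding completion_def by blast

lemma completionI:
  assumes "\<And>I. \<not> weight_ideal C I \<Longrightarrow> x I = {}"
    and "\<And>I. weight_ideal C I \<Longrightarrow> \<exists>r. x I = coset I r \<and>
      (\<forall>J. weight_ideal C J \<longrightarrow> I \<subseteq> J \<longrightarrow> x J = coset J r)"
  shows "x \<in> completion C"
  unfolding completion_def
proof safe
  fix I show "if weight_ideal C I then \<exists>r. x I = {s. s - r \<in> I} else x I = {}"
    using assms(1)[of I] assms(2)[of I] unfolding coset_def by meson
next
  fix I J s assume "weight_ideal C I" "weight_ideal C J" "I \<subseteq> J" "s \<in> x I"
  with assms(2)[of I] obtain r where "s \<in> coset I r" "x J = coset J r"
    by auto
  with \<open>I \<subseteq> J\<close> show "s \<in> x J"
    by (auto simp: coset_def)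
qed

lemma completion_of_closed: "completion_of C r \<in> completion C"
  by (rule completionI) (auto simp: completion_of_def coset_def)

locale commuting_set =
  fixes C :: "'r::complex_algebra_1 set"
  assumes finite: "finite C" and commute: "c \<in> C \<Longrightarrow> d \<in> C \<Longrightarrow> c * d = d * c"
begin

lemma weight_ideal_iff: "weight_ideal C I \<longleftrightarrow> left_ideal I \<and> (\<forall>c\<in>C. weight_element I c)"
  using finite commute by (rule weight_ideal_iff)

lemma weight_ideal_colon: "weight_ideal C I \<Longrightarrow> weight_ideal C {z. z * r \<in> I}"
  by (simp add: weight_ideal_iff left_ideal_colon weight_element_colon)

lemma weight_ideal_Int: "weight_ideal C I \<Longrightarrow> weight_ideal C J \<Longrightarrow> weight_ideal C (I \<inter> J)"
  unfolding weight_ideal_iff by (auto simp: left_ideal_def intro: weight_element_Int)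

lemma completion_mult_coset:
  assumes "x \<in> completion C" "y \<in> completion C" "weight_ideal C I"
    and "r \<in> y I" "u \<in> x {z. z * r \<in> I}"
  shows "completion_mult C x y I = coset I (u * r)"
proof -
  note I = weight_ideal_left_ideal[OF assms(3)]
  have same: "coset I (u' * r') = coset I (u * r)" if "r' \<in> y I" "u' \<in> x {z. z * r' \<in> I}" for r' u'
  proof -
    have r: "r' - r \<in> I"
      using that(1) completion_coset[OF assms(2,3,4)] by (simp add: coset_def)
    have "z * r' \<in> I \<longleftrightarrow> z * r \<in> I" for z
    proof
      have z: "z * r' - z * r \<in> I"
        using left_ideal_mult[OF I r, of z] by (simp add: right_diff_distrib)
      show "z * r' \<in> I" if "z * r \<in> I"
        using complex_vector.subspace_add[OF left_ideal_csubspace[OF I] z that] by simp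
      show "z * r \<in> I" if "z * r' \<in> I"
        using complex_vector.subspace_diff[OF left_ideal_csubspace[OF I] that z] by simp
    qed
    then have "u' \<in> x {z. z * r \<in> I}"
      using that(2) by simp
    then have "(u' - u) * r \<in> I"
      using completion_coset[OF assms(1) weight_ideal_colon[OF assms(3)] assms(5)] by (simp add: coset_def)
    moreover have "u' * (r' - r) \<in> I"
      using left_ideal_mult[OF I r] .
    ultimately have "u' * (r' - r) + (u' - u) * r \<in> I"
      by (intro complex_vector.subspace_add[OF left_ideal_csubspace[OF I]])
    then show ?thesis
      by (intro coset_eq[OF I]) (simp add: right_diff_distrib left_diff_distrib)
  qed
  have "completion_mult C x y I = (\<Union>r'\<in>y I. \<Union>u'\<in>x {z. z * r' \<in> I}. coset I (u' * r'))"
    using assms(3) unfolding completion_mult_def coset_def by (simp only: if_True) blast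
  moreover have "\<dots> = (\<Union>r'\<in>y I. \<Union>u'\<in>x {z. z * r' \<in> I}. coset I (u * r))"
    by (intro SUP_cong refl same)
  ultimately show ?thesis
    using assms(4,5) by auto
qed

lemma completion_mult_closed:
  assumes "x \<in> completion C" "y \<in> completion C"
  shows "completion_mult C x y \<in> completion C"
proof (rule completionI)
  show "completion_mult C x y I = {}" if "\<not> weight_ideal C I" for I
    using that by (simp add: completion_mult_def)
  fix I assume I: "weight_ideal C I"
  obtain r where r: "r \<in> y I"
    by (rule completion_nonempty[OF assms(2) I])
  obtain u where u: "u \<in> x {z. z * r \<in> I}"
    by (rule completion_nonempty[OF assms(1) weight_ideal_colon[OF I]])
  have "completion_mult C x y J = coset J (u * r)" if "weight_ideal C J" "I \<subseteq> J" for J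
  proof -
    have "{z. z * r \<in> I} \<subseteq> {z. z * r \<in> J}"
      using that(2) by auto
    from completion_mult_coset[OF assms that(1) completion_mono[OF assms(2) I that r]
        completion_mono[OF assms(1) weight_ideal_colon[OF I] weight_ideal_colon[OF that(1)] this u]]
    show ?thesis .
  qed
  then show "\<exists>r. completion_mult C x y I = coset I r \<and>
      (\<forall>J. weight_ideal C J \<longrightarrow> I \<subseteq> J \<longrightarrow> completion_mult C x y J = coset J r)"
    using I by blast
qed

lemma completion_mult_assoc:
  assumes "x \<in> completion C" "y \<in> completion C" "z \<in> completion C"
  shows "completion_mult C (completion_mult C x y) z = completion_mult C x (completion_mult C y z)"
proof
  fix I
  show "completion_mult C (completion_mult C x y) z I = completion_mult C x (completion_mult C y z) I"
  proof (cases "weight_ideal C I")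
    case I: True
    obtain r where r: "r \<in> z I"
      by (rule completion_nonempty[OF assms(3) I])
    obtain v where v: "v \<in> y {t. t * r \<in> I}"
      by (rule completion_nonempty[OF assms(2) weight_ideal_colon[OF I]])
    obtain w where w: "w \<in> x {t. t * v \<in> {t. t * r \<in> I}}"
      by (rule completion_nonempty[OF assms(1) weight_ideal_colon[OF weight_ideal_colon[OF I]]])
    have "w * v \<in> completion_mult C x y {t. t * r \<in> I}"
      using completion_mult_coset[OF assms(1,2) weight_ideal_colon[OF I] v w]
        coset_self[OF weight_ideal_left_ideal[OF weight_ideal_colon[OF I]]] by simp
    then have 1: "completion_mult C (completion_mult C x y) z I = coset I (w * v * r)"
      by (rule completion_mult_coset[OF completion_mult_closed[OF assms(1,2)] assms(3) I r])
    have 2: "v * r \<in> completion_mult C y z I"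
      using completion_mult_coset[OF assms(2,3) I r v] coset_self[OF weight_ideal_left_ideal[OF I]] by simp
    have "completion_mult C x (completion_mult C y z) I = coset I (w * (v * r))"
      by (rule completion_mult_coset[OF assms(1) completion_mult_closed[OF assms(2,3)] I 2])
        (use w in \<open>simp add: mult.assoc\<close>)
    with 1 show ?thesis
      by (simp add: mult.assoc)
  qed (simp add: completion_mult_def)
qed

lemma completion_of_mult: "completion_mult C (completion_of C s) (completion_of C t) = completion_of C (s * t)"
proof
  fix I
  show "completion_mult C (completion_of C s) (completion_of C t) I = completion_of C (s * t) I"
  proof (cases "weight_ideal C I")
    case I: True
    show ?thesis
        using completion_mult_coset[OF completion_of_closed completion_of_closed I
          completion_of_self[OF I, of t] completion_of_self[OF weight_ideal_colon[OF I], of s]]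
        completion_of_coset[OF I, of "s * t"] by (rule trans[OF _ sym])
  qed (simp add: completion_mult_def completion_of_def)
qed

lemma completion_mult_one:
  assumes x: "x \<in> completion C"
  shows "completion_mult C (completion_of C 1) x = x" "completion_mult C x (completion_of C 1) = x"
proof -
  have empty: "x I = {}" if "\<not> weight_ideal C I" for I
    using completion_value[OF x, of I] that by simp
  show "completion_mult C (completion_of C 1) x = x"
  proof
    fix I
    show "completion_mult C (completion_of C 1) x I = x I"
    proof (cases "weight_ideal C I")
      case I: True
      obtain r where r: "r \<in> x I"
        by (rule completion_nonempty[OF x I])
      have "1 \<in> completion_of C 1 {z. z * r \<in> I}"
        by (rule completion_of_self[OF weight_ideal_colon[OF I]])
      from completion_mult_coset[OF completion_of_closed x I r this] show ?thesis
        by (simp add: completion_coset[OF x I r])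
    qed (simp add: completion_mult_def empty)
  qed
  show "completion_mult C x (completion_of C 1) = x"
  proof
    fix I
    show "completion_mult C x (completion_of C 1) I = x I"
    proof (cases "weight_ideal C I")
      case I: True
      obtain r where r: "r \<in> x I"
        by (rule completion_nonempty[OF x I])
      have 1: "1 \<in> completion_of C 1 I"
        by (rule completion_of_self[OF I])
      show ?thesis
        using completion_mult_coset[OF x completion_of_closed I 1, of r] r
        by (simp add: completion_coset[OF x I r])
    qed (simp add: completion_mult_def empty)
  qed
qed

end

subsection \<open>Extension of homomorphisms\<close>

locale completion_hom = C: commuting_set C + D: commuting_set D
  for C :: "'r::complex_algebra_1 set" and D :: "'s::complex_algebra_1 set" +
  fixes f :: "'r \<Rightarrow> 's"
  assumes hom: "algebra_hom f"
    and weight_element_image: "c \<in> C \<Longrightarrow> weight_ideal D J \<Longrightarrow> weight_element J (f c)"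
begin

lemma weight_ideal_vimage: "weight_ideal D J \<Longrightarrow> weight_ideal C (f -` J)"
  using left_ideal_vimage[OF hom] weight_element_vimage[OF hom] weight_element_image
  by (simp add: C.weight_ideal_iff weight_ideal_left_ideal)

lemma completion_map_coset:
  assumes "x \<in> completion C" "weight_ideal D J" "r \<in> x (f -` J)"
  shows "completion_map D f x J = coset J (f r)"
proof -
  note J = weight_ideal_left_ideal[OF assms(2)]
  have same: "coset J (f r') = coset J (f r)" if "r' \<in> x (f -` J)" for r'
    using that completion_coset[OF assms(1) weight_ideal_vimage[OF assms(2)] assms(3)]
    by (intro coset_eq[OF J]) (simp add: coset_def clinear_simps[OF algebra_homD(1)[OF hom]])
  have "completion_map D f x J = (\<Union>r'\<in>x (f -` J). coset J (f r'))"
    using assms(2) unfolding completion_map_def coset_def by (simp only: if_True) blast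
  moreover have "\<dots> = (\<Union>r'\<in>x (f -` J). coset J (f r))"
    by (intro SUP_cong refl same)
  ultimately show ?thesis
    using assms(3) by auto
qed

lemma completion_map_closed:
  assumes "x \<in> completion C"
  shows "completion_map D f x \<in> completion D"
proof (rule completionI)
  show "completion_map D f x J = {}" if "\<not> weight_ideal D J" for J
    using that by (simp add: completion_map_def)
  fix I assume I: "weight_ideal D I"
  obtain r where r: "r \<in> x (f -` I)"
    by (rule completion_nonempty[OF assms weight_ideal_vimage[OF I]])
  have "completion_map D f x J = coset J (f r)" if "weight_ideal D J" "I \<subseteq> J" for J
    using completion_map_coset[OF assms that(1)]
      completion_mono[OF assms weight_ideal_vimage[OF I] weight_ideal_vimage[OF that(1)] vimage_mono[OF that(2)] r]
    by blast
  then show "\<exists>r. completion_map D f x I = coset I r \<and>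
      (\<forall>J. weight_ideal D J \<longrightarrow> I \<subseteq> J \<longrightarrow> completion_map D f x J = coset J r)"
    using I by blast
qed

lemma completion_map_mult:
  assumes "x \<in> completion C" "y \<in> completion C"
  shows "completion_map D f (completion_mult C x y) =
    completion_mult D (completion_map D f x) (completion_map D f y)"
proof
  fix J
  show "completion_map D f (completion_mult C x y) J =
      completion_mult D (completion_map D f x) (completion_map D f y) J"
  proof (cases "weight_ideal D J")
    case J: True
    note fJ = weight_ideal_vimage[OF J]
    obtain r where r: "r \<in> y (f -` J)"
      by (rule completion_nonempty[OF assms(2) fJ])
    obtain u where u: "u \<in> x {z. z * r \<in> f -` J}"
      by (rule completion_nonempty[OF assms(1) C.weight_ideal_colon[OF fJ]])
    have eq: "{z. z * r \<in> f -` J} = f -` {z. z * f r \<in> J}"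
      by (auto simp: algebra_homD(2)[OF hom])
    have "u * r \<in> completion_mult C x y (f -` J)"
      using C.completion_mult_coset[OF assms fJ r u] coset_self[OF weight_ideal_left_ideal[OF fJ]] by simp
    from completion_map_coset[OF C.completion_mult_closed[OF assms] J this]
    have 1: "completion_map D f (completion_mult C x y) J = coset J (f u * f r)"
      by (simp add: algebra_homD(2)[OF hom])
    have 2: "f r \<in> completion_map D f y J"
      using completion_map_coset[OF assms(2) J r] coset_self[OF weight_ideal_left_ideal[OF J]] by simp
    have 3: "f u \<in> completion_map D f x {z. z * f r \<in> J}"
      using completion_map_coset[OF assms(1) D.weight_ideal_colon[OF J] u[unfolded eq]]
        coset_self[OF weight_ideal_left_ideal[OF D.weight_ideal_colon[OF J]]] by simp
    show ?thesis
      using D.completion_mult_coset[OF completion_map_closed[OF assms(1)] completion_map_closed[OF assms(2)] J 2 3]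
      by (simp add: 1)
  qed (simp add: completion_map_def completion_mult_def)
qed

lemma completion_map_of: "completion_map D f (completion_of C r) = completion_of D (f r)"
proof
  fix J
  show "completion_map D f (completion_of C r) J = completion_of D (f r) J"
  proof (cases "weight_ideal D J")
    case J: True
    have "r \<in> completion_of C r (f -` J)"
      by (rule completion_of_self[OF weight_ideal_vimage[OF J]])
    from completion_map_coset[OF completion_of_closed J this] J show ?thesis
      by (simp add: completion_of_coset)
  qed (simp add: completion_map_def completion_of_def)
qed

end


subsection \<open>Weight modules\<close>

locale weight_module = commuting_set C + left_action act
  for C :: "'r::complex_algebra_1 set" and act :: "'r \<Rightarrow> 'v::complex_vector \<Rightarrow> 'v" +
  assumes weight_span: "c \<in> C \<Longrightarrow> cspan (\<Union>n. eigenvectors (act c) {0} n) = UNIV"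
begin

lemma clinear_act: "clinear (act r)" "clinear (\<lambda>r. act r v)"
  using act_bilinear by (simp_all add: cbilinear_def)

lemma weight_ideal_annihilator: "weight_ideal C {r. act r v = 0}"
proof -
  have "left_ideal {r. act r v = 0}"
    by (auto simp: left_ideal_def act_mult clinear_simps[OF clinear_act(1)] clinear_simps[OF clinear_act(2)])
  moreover have "weight_element {r. act r v = 0} c" if "c \<in> C" for c
    by (rule weight_element_annihilator[OF left_action_axioms]) (simp add: weight_span[OF that])
  ultimately show ?thesis
    by (simp add: weight_ideal_iff)
qed

lemma completion_act_eq:
  assumes "x \<in> completion C" "r \<in> x {r. act r v = 0}"
  shows "completion_act act x v = act r v"
  unfolding completion_act_def
proof (rule the_equality)
  show "\<exists>s\<in>x {r. act r v = 0}. act r v = act s v"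
    using assms(2) by blast
next
  fix w assume "\<exists>s\<in>x {r. act r v = 0}. w = act s v"
  then obtain s where s: "s \<in> x {r. act r v = 0}" "w = act s v"
    by blast
  then have "act (s - r) v = 0"
    using completion_coset[OF assms(1) weight_ideal_annihilator assms(2)] by (simp add: coset_def)
  with s(2) show "w = act r v"
    by (simp add: clinear_simps[OF clinear_act(2)])
qed

text \<open>Two vectors are treated simultaneously by a representative modulo the intersection of their
  annihilators.\<close>

lemma clinear_completion_act:
  assumes x: "x \<in> completion C"
  shows "clinear (completion_act act x)"
  unfolding clinear_iff
proof safe
  fix v w
  let ?K = "{r. act r v = 0} \<inter> {r. act r w = 0}"
  have K: "weight_ideal C ?K"
    by (intro weight_ideal_Int weight_ideal_annihilator)
  obtain r where r: "r \<in> x ?K"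
    by (rule completion_nonempty[OF x K])
  have eq: "completion_act act x u = act r u" if "?K \<subseteq> {r. act r u = 0}" for u
    by (rule completion_act_eq[OF x completion_mono[OF x K weight_ideal_annihilator that r]])
  have "?K \<subseteq> {r. act r (v + w) = 0}"
    by (auto simp: clinear_simps[OF clinear_act(1)])
  then show "completion_act act x (v + w) = completion_act act x v + completion_act act x w"
    by (simp add: eq clinear_simps[OF clinear_act(1)])
next
  fix c v
  let ?K = "{r. act r v = 0}"
  note K = weight_ideal_annihilator[of v]
  obtain r where r: "r \<in> x ?K"
    by (rule completion_nonempty[OF x K])
  have eq: "completion_act act x u = act r u" if "?K \<subseteq> {r. act r u = 0}" for u
    by (rule completion_act_eq[OF x completion_mono[OF x K weight_ideal_annihilator that r]])
  have "?K \<subseteq> {r. act r (c *\<^sub>C v) = 0}"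
    by (auto simp: clinear_simps[OF clinear_act(1)])
  then show "completion_act act x (c *\<^sub>C v) = c *\<^sub>C completion_act act x v"
    by (simp add: eq clinear_simps[OF clinear_act(1)])
qed

lemma completion_act_mult:
  assumes "x \<in> completion C" "y \<in> completion C"
  shows "completion_act act (completion_mult C x y) v = completion_act act x (completion_act act y v)"
proof -
  let ?K = "{r. act r v = 0}"
  note K = weight_ideal_annihilator[of v]
  obtain r where r: "r \<in> y ?K"
    by (rule completion_nonempty[OF assms(2) K])
  obtain u where u: "u \<in> x {z. z * r \<in> ?K}"
    by (rule completion_nonempty[OF assms(1) weight_ideal_colon[OF K]])
  have "u * r \<in> completion_mult C x y ?K"
    using completion_mult_coset[OF assms K r u] coset_self[OF weight_ideal_left_ideal[OF K]] by simp
  from completion_act_eq[OF completion_mult_closed[OF assms] this]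
  have "completion_act act (completion_mult C x y) v = act u (act r v)"
    by (simp add: act_mult)
  moreover have "completion_act act x (act r v) = act u (act r v)"
    by (rule completion_act_eq[OF assms(1)]) (use u in \<open>simp add: act_mult\<close>)
  ultimately show ?thesis
    by (simp add: completion_act_eq[OF assms(2) r])
qed

lemma completion_act_of: "completion_act act (completion_of C r) v = act r v"
  by (rule completion_act_eq[OF completion_of_closed]) (rule completion_of_self[OF weight_ideal_annihilator])

end


section \<open>Exponentials\<close>

definition diagonal_on :: "'r::complex_algebra_1 set \<Rightarrow> 'r \<Rightarrow> bool"
  where "diagonal_on C y \<longleftrightarrow> (\<forall>I. weight_ideal C I \<longrightarrow> weight_element I y)"

lemma diagonal_on_mem: "c \<in> C \<Longrightarrow> diagonal_on C c"
  unfolding diagonal_on_def using weight_ideal_antimono[of C _ "{c}"] by simp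

lemma diagonal_on_simps:
  "diagonal_on C x \<Longrightarrow> diagonal_on C y \<Longrightarrow> x * y = y * x \<Longrightarrow> diagonal_on C (x + y)"
  "diagonal_on C x \<Longrightarrow> diagonal_on C y \<Longrightarrow> x * y = y * x \<Longrightarrow> diagonal_on C (x * y)"
  "diagonal_on C x \<Longrightarrow> diagonal_on C (- x)"
  "diagonal_on C 0"
  using weight_ideal_left_ideal
  by (auto simp: diagonal_on_def intro!: weight_element_add_mult weight_element_uminus weight_element_0)

text \<open>Two decompositions of \<open>1\<close> have the same components modulo \<open>I\<close>, by \<open>eigenvector_components\<close>; hence
  any one of them computes the exponential.  Several components may share an eigenvalue here, which
  is convenient for products of decompositions.\<close>

lemma completion_exp_coset:
  assumes I: "weight_ideal C I" and A: "finite A" "\<And>a. a \<in> A \<Longrightarrow> v a \<in> eigenvectors ((*) y) I (\<nu> a)"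
    and one: "1 - (\<Sum>a\<in>A. v a) \<in> I"
  shows "completion_exp C lam y I = coset I (\<Sum>a\<in>A. (lam powi \<nu> a) *\<^sub>C v a)"
proof -
  note left = weight_ideal_left_ideal[OF I]
  note sub = left_ideal_csubspace[OF left]
  note E = csubspace_eigenvectors[OF clinear_mult_left sub]
  define u where "u n = (\<Sum>a\<in>{a \<in> A. \<nu> a = n}. v a)" for n
  have u: "u n \<in> eigenvectors ((*) y) I n" for n
    unfolding u_def by (rule complex_vector.subspace_sum[OF E]) (use A(2) in auto)
  have regroup: "(\<Sum>n\<in>\<nu> ` A. c n *\<^sub>C u n) = (\<Sum>a\<in>A. c (\<nu> a) *\<^sub>C v a)" for c
    unfolding sum.image_gen[OF A(1), of "\<lambda>a. c (\<nu> a) *\<^sub>C v a" \<nu>] u_def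
    by (intro sum.cong) (auto simp: complex_vector.scale_sum_right)
  have regroup1: "(\<Sum>n\<in>\<nu> ` A. u n) = (\<Sum>a\<in>A. v a)"
    using regroup[of "\<lambda>_. 1"] by (simp add: scaleC_one)
  have unique: "(\<Sum>n\<in>N. (lam powi n) *\<^sub>C r n) - (\<Sum>a\<in>A. (lam powi \<nu> a) *\<^sub>C v a) \<in> I"
    if N: "finite N" "\<And>n. n \<in> N \<Longrightarrow> r n \<in> eigenvectors ((*) y) I n" "1 - (\<Sum>n\<in>N. r n) \<in> I" for N r
  proof -
    let ?M = "N \<union> \<nu> ` A"
    define d where "d n = (if n \<in> N then r n else 0) - (if n \<in> \<nu> ` A then u n else 0)" for n
    have sum_d: "(\<Sum>n\<in>?M. c n *\<^sub>C d n) = (\<Sum>n\<in>N. c n *\<^sub>C r n) - (\<Sum>a\<in>A. c (\<nu> a) *\<^sub>C v a)" for c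
    proof -
      have "(\<Sum>n\<in>?M. if n \<in> N then c n *\<^sub>C r n else 0) = (\<Sum>n\<in>N. c n *\<^sub>C r n)"
        "(\<Sum>n\<in>?M. if n \<in> \<nu> ` A then c n *\<^sub>C u n else 0) = (\<Sum>n\<in>\<nu> ` A. c n *\<^sub>C u n)"
        using N(1) A(1) by (auto intro!: sum.mono_neutral_cong_right)
      moreover have "c n *\<^sub>C d n = (if n \<in> N then c n *\<^sub>C r n else 0) - (if n \<in> \<nu> ` A then c n *\<^sub>C u n else 0)" for n
        by (simp add: d_def complex_vector.scale_right_diff_distrib)
      ultimately show ?thesis
        by (simp add: sum_subtractf regroup)
    qed
    have "(1 - (\<Sum>a\<in>A. v a)) - (1 - (\<Sum>n\<in>N. r n)) \<in> I"
      using one N(3) by (rule complex_vector.subspace_diff[OF sub])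
    then have "(\<Sum>n\<in>?M. d n) \<in> I"
      using sum_d[of "\<lambda>_. 1"] by (simp add: scaleC_one)
    moreover have "d n \<in> eigenvectors ((*) y) I n" for n
      unfolding d_def using N(2) u complex_vector.subspace_0[OF E]
      by (intro complex_vector.subspace_diff[OF E]) auto
    ultimately have "\<forall>n\<in>?M. d n \<in> I"
      using N(1) A(1) by (intro eigenvector_components[OF clinear_mult_left sub left_ideal_mult[OF left]]) auto
    then have "(\<Sum>n\<in>?M. (lam powi n) *\<^sub>C d n) \<in> I"
      by (intro complex_vector.subspace_sum[OF sub] complex_vector.subspace_scale[OF sub]) auto
    then show ?thesis
      by (simp add: sum_d)
  qed
  show ?thesis
  proof (intro set_eqI iffI)
    fix s assume "s \<in> completion_exp C lam y I"
    then obtain N r where N: "finite N" "\<And>n. n \<in> N \<Longrightarrow> r n \<in> eigenvectors ((*) y) I n"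
      "1 - (\<Sum>n\<in>N. r n) \<in> I" and s: "s - (\<Sum>n\<in>N. (lam powi n) *\<^sub>C r n) \<in> I"
      using I unfolding completion_exp_def eigenvectors_def by auto
    from complex_vector.subspace_add[OF sub s unique[OF N]]
    show "s \<in> coset I (\<Sum>a\<in>A. (lam powi \<nu> a) *\<^sub>C v a)"
      by (simp add: coset_def)
  next
    fix s assume "s \<in> coset I (\<Sum>a\<in>A. (lam powi \<nu> a) *\<^sub>C v a)"
    then have "s - (\<Sum>n\<in>\<nu> ` A. (lam powi n) *\<^sub>C u n) \<in> I"
      by (simp add: coset_def regroup)
    moreover have "1 - (\<Sum>n\<in>\<nu> ` A. u n) \<in> I"
      using one by (simp add: regroup1)
    ultimately show "s \<in> completion_exp C lam y I"
      using I A(1) u unfolding completion_exp_def eigenvectors_def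
      by (auto intro!: exI[of _ "\<nu> ` A"] exI[of _ u])
  qed
qed

text \<open>The components of \<open>1\<close> can be taken in the bicommutant of \<open>y\<close>: this subspace contains \<open>1\<close> and is
  stable under multiplication by \<open>y\<close>.\<close>

lemma bicommutant_decomposition:
  fixes y :: "'r::complex_algebra_1"
  assumes "weight_element I y"
  obtains N r where "finite N" "\<forall>n\<in>N. r n \<in> eigenvectors ((*) y) I n"
    "\<forall>n\<in>N. \<forall>z. z * y = y * z \<longrightarrow> z * r n = r n * z" "1 - (\<Sum>n\<in>N. r n) \<in> I"
proof -
  note left = weight_ideal_left_ideal[OF assms]
  define W where "W = {p. \<forall>z. z * y = y * z \<longrightarrow> z * p = p * z}"
  have W: "csubspace W"
    by (rule complex_vector.subspaceI)
      (auto simp: W_def distrib_left distrib_right mult_scaleC_left mult_scaleC_right)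
  have stable: "y * p \<in> W" if "p \<in> W" for p
    unfolding W_def
  proof safe
    fix z assume z: "z * y = y * z"
    then have "z * (y * p) = y * (z * p)"
      by (simp flip: mult.assoc)
    also have "z * p = p * z"
      using that z by (simp add: W_def)
    finally show "z * (y * p) = y * p * z"
      by (simp add: mult.assoc)
  qed
  have "1 \<in> W"
    by (simp add: W_def)
  moreover have "1 \<in> cspan (\<Union>n. eigenvectors ((*) y) I n)"
    using assms by (simp add: weight_element_iff)
  ultimately have "\<exists>N r. finite N \<and> (\<forall>n\<in>N. r n \<in> W \<and> r n \<in> eigenvectors ((*) y) I n) \<and> 1 - (\<Sum>n\<in>N. r n) \<in> I"
    by (intro eigenvectors_decompose[OF clinear_mult_left left_ideal_csubspace[OF left] _ W stable]
        left_ideal_mult[OF left])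
  then obtain N r where "finite N" "\<forall>n\<in>N. r n \<in> W \<and> r n \<in> eigenvectors ((*) y) I n" "1 - (\<Sum>n\<in>N. r n) \<in> I"
    by blast
  then show ?thesis
    by (intro that[of N r]) (auto simp: W_def)
qed

lemma eigenvectors_mono: "I \<subseteq> J \<Longrightarrow> eigenvectors T I n \<subseteq> eigenvectors T J n"
  by (auto simp: eigenvectors_def)

lemma completion_exp_closed:
  assumes "diagonal_on C y"
  shows "completion_exp C lam y \<in> completion C"
proof (rule completionI)
  show "completion_exp C lam y I = {}" if "\<not> weight_ideal C I" for I
    using that by (simp add: completion_exp_def)
  fix I assume I: "weight_ideal C I"
  then have "weight_element I y"
    using assms by (simp add: diagonal_on_def)
  then obtain N r where N: "finite N" "\<forall>n\<in>N. r n \<in> eigenvectors ((*) y) I n" "1 - (\<Sum>n\<in>N. r n) \<in> I"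
    by (rule bicommutant_decomposition)
  have "completion_exp C lam y J = coset J (\<Sum>n\<in>N. (lam powi n) *\<^sub>C r n)"
    if "weight_ideal C J" "I \<subseteq> J" for J
    using that N eigenvectors_mono[OF that(2)] by (intro completion_exp_coset) blast+
  then show "\<exists>r. completion_exp C lam y I = coset I r \<and>
      (\<forall>J. weight_ideal C J \<longrightarrow> I \<subseteq> J \<longrightarrow> completion_exp C lam y J = coset J r)"
    using I by blast
qed

lemma completion_exp_0: "completion_exp C lam 0 = completion_of C 1"
proof
  fix I
  show "completion_exp C lam 0 I = completion_of C 1 I"
  proof (cases "weight_ideal C I")
    case True
    have "0 \<in> I"
      using weight_ideal_left_ideal[OF True] by (simp add: left_ideal_def)
    then show ?thesis
      using completion_exp_coset[OF True, of "{0}" "\<lambda>_. 1" 0 "\<lambda>_. 0"] True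
      by (simp add: eigenvectors_def completion_of_coset scaleC_one)
  qed (simp add: completion_exp_def completion_of_def)
qed

text \<open>Multiply a decomposition of \<open>1\<close> for \<open>x\<close> with one for \<open>y\<close>, both taken in the bicommutants.  They
  commute with each other, so the products are joint eigenvectors; and since the components for \<open>x\<close>
  commute with the value \<open>\<tau>\<close> of the second exponential, they also decompose \<open>1\<close> modulo the
  annihilator of \<open>\<tau> + I\<close>, which is where the first exponential has to be evaluated.\<close>

lemma (in commuting_set) completion_exp_add:
  assumes xy: "x * y = y * x" and diag: "diagonal_on C x" "diagonal_on C y" and "lam \<noteq> 0"
  shows "completion_mult C (completion_exp C lam x) (completion_exp C lam y) = completion_exp C lam (x + y)"
proof
  fix I
  show "completion_mult C (completion_exp C lam x) (completion_exp C lam y) I = completion_exp C lam (x + y) I"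
  proof (cases "weight_ideal C I")
    case I: True
    note left = weight_ideal_left_ideal[OF I]
    note sub = left_ideal_csubspace[OF left]
    obtain N r where r: "finite N" "\<forall>n\<in>N. r n \<in> eigenvectors ((*) x) I n"
      "\<forall>n\<in>N. \<forall>z. z * x = x * z \<longrightarrow> z * r n = r n * z" "1 - (\<Sum>n\<in>N. r n) \<in> I"
      by (rule bicommutant_decomposition[of x I]) (use diag I in \<open>simp add: diagonal_on_def\<close>)
    obtain K t where t: "finite K" "\<forall>n\<in>K. t n \<in> eigenvectors ((*) y) I n"
      "\<forall>n\<in>K. \<forall>z. z * y = y * z \<longrightarrow> z * t n = t n * z" "1 - (\<Sum>n\<in>K. t n) \<in> I"
      by (rule bicommutant_decomposition[of y I]) (use diag I in \<open>simp add: diagonal_on_def\<close>)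
    have yr: "y * r n = r n * y" if "n \<in> N" for n
      using r(3) xy that by auto
    have rt: "t k * r n = r n * t k" if "n \<in> N" "k \<in> K" for n k
      using t(3) yr that by auto
    have xt: "x * t k = t k * x" if "k \<in> K" for k
      using t(3) xy that by auto
    define \<rho> where "\<rho> = (\<Sum>n\<in>N. (lam powi n) *\<^sub>C r n)"
    define \<tau> where "\<tau> = (\<Sum>k\<in>K. (lam powi k) *\<^sub>C t k)"
    have "\<tau> \<in> completion_exp C lam y I"
      using completion_exp_coset[OF I t(1) _ t(4), of y "\<lambda>k. k" lam] t(2) coset_self[OF left] by (simp add: \<tau>_def)
    moreover have "\<rho> \<in> completion_exp C lam x {z. z * \<tau> \<in> I}"
    proof -
      have comm: "r n * \<tau> = \<tau> * r n" if "n \<in> N" for n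
        unfolding \<tau>_def sum_distrib_left sum_distrib_right
        using rt that by (intro sum.cong) (auto simp: mult_scaleC_left mult_scaleC_right)
      have x\<tau>: "x * \<tau> = \<tau> * x"
        unfolding \<tau>_def sum_distrib_left sum_distrib_right
        using xt by (intro sum.cong) (auto simp: mult_scaleC_left mult_scaleC_right)
      have "r n \<in> eigenvectors ((*) x) {z. z * \<tau> \<in> I} n" if "n \<in> N" for n
      proof -
        have "(x * r n - of_int n *\<^sub>C r n) * \<tau> = \<tau> * (x * r n - of_int n *\<^sub>C r n)"
          using comm[OF that] x\<tau>
          by (simp add: left_diff_distrib right_diff_distrib mult_scaleC_left mult_scaleC_right mult.assoc)
            (simp flip: mult.assoc)
        then show ?thesis
          using r(2) that left_ideal_mult[OF left] by (simp add: eigenvectors_def)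
      qed
      moreover have "(1 - (\<Sum>n\<in>N. r n)) * \<tau> \<in> I"
      proof -
        have "(\<Sum>n\<in>N. r n) * \<tau> = \<tau> * (\<Sum>n\<in>N. r n)"
          unfolding sum_distrib_left sum_distrib_right using comm by (intro sum.cong) auto
        then have "(1 - (\<Sum>n\<in>N. r n)) * \<tau> = \<tau> * (1 - (\<Sum>n\<in>N. r n))"
          by (simp add: left_diff_distrib right_diff_distrib)
        then show ?thesis
          using r(4) left_ideal_mult[OF left] by simp
      qed
      ultimately have "completion_exp C lam x {z. z * \<tau> \<in> I} = coset {z. z * \<tau> \<in> I} \<rho>"
        unfolding \<rho>_def by (intro completion_exp_coset weight_ideal_colon I r(1)) auto
      then show ?thesis
        using coset_self[OF left_ideal_colon[OF left]] by simp
    qed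
    ultimately have "completion_mult C (completion_exp C lam x) (completion_exp C lam y) I = coset I (\<rho> * \<tau>)"
      by (rule completion_mult_coset[OF completion_exp_closed[OF diag(1)] completion_exp_closed[OF diag(2)] I])
    also have "\<rho> * \<tau> = (\<Sum>(n, k)\<in>N \<times> K. (lam powi (n + k)) *\<^sub>C (r n * t k))"
      unfolding \<rho>_def \<tau>_def sum_product sum.cartesian_product
      by (intro sum.cong) (auto simp: mult_scaleC_left mult_scaleC_right scaleC_scaleC power_int_add \<open>lam \<noteq> 0\<close>)
    also have "coset I \<dots> = completion_exp C lam (x + y) I"
    proof -
      have eig: "r n * t k \<in> eigenvectors ((*) (x + y)) I (n + k)" if "n \<in> N" "k \<in> K" for n k
      proof -
        have "(x + y) * (r n * t k) - of_int (n + k) *\<^sub>C (r n * t k) =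
            t k * (x * r n - of_int n *\<^sub>C r n) + r n * (y * t k - of_int k *\<^sub>C t k)"
        proof -
          have "x * (r n * t k) = t k * (x * r n)" "y * (r n * t k) = r n * (y * t k)"
            using rt[OF that] xt[OF that(2)] yr[OF that(1)] by (metis mult.assoc)+
          then show ?thesis
            using rt[OF that]
            by (simp add: distrib_right right_diff_distrib scaleC_add_left mult_scaleC_right)
        qed
        then show ?thesis
          using r(2) t(2) that left_ideal_mult[OF left] complex_vector.subspace_add[OF sub]
          by (simp add: eigenvectors_def)
      qed
      have "1 - (\<Sum>(n, k)\<in>N \<times> K. r n * t k) =
          (1 - (\<Sum>n\<in>N. r n)) + (\<Sum>n\<in>N. r n) * (1 - (\<Sum>k\<in>K. t k))"
        by (simp add: right_diff_distrib sum_product sum.cartesian_product)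
      also have "\<dots> \<in> I"
        using r(4) t(4) left_ideal_mult[OF left] by (intro complex_vector.subspace_add[OF sub])
      finally have "1 - (\<Sum>a\<in>N \<times> K. r (fst a) * t (snd a)) \<in> I"
        by (simp add: case_prod_unfold)
      from completion_exp_coset[OF I _ _ this, of "x + y" "\<lambda>a. fst a + snd a" lam] eig r(1) t(1)
      show ?thesis
        by (auto simp: case_prod_unfold)
    qed
    finally show ?thesis .
  qed (simp add: completion_mult_def completion_exp_def)
qed

lemma (in completion_hom) completion_map_exp:
  assumes "diagonal_on C y"
  shows "completion_map D f (completion_exp C lam y) = completion_exp D lam (f y)"
proof
  fix J
  show "completion_map D f (completion_exp C lam y) J = completion_exp D lam (f y) J"
  proof (cases "weight_ideal D J")
    case J: True
    note fJ = weight_ideal_vimage[OF J]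
    note lin = algebra_homD(1)[OF hom]
    have "weight_element (f -` J) y"
      using fJ assms by (simp add: diagonal_on_def)
    then obtain N r where N: "finite N" "\<forall>n\<in>N. r n \<in> eigenvectors ((*) y) (f -` J) n"
      "1 - (\<Sum>n\<in>N. r n) \<in> f -` J"
      by (rule bicommutant_decomposition)
    have "completion_exp C lam y (f -` J) = coset (f -` J) (\<Sum>n\<in>N. (lam powi n) *\<^sub>C r n)"
      using N by (intro completion_exp_coset fJ) auto
    then have "(\<Sum>n\<in>N. (lam powi n) *\<^sub>C r n) \<in> completion_exp C lam y (f -` J)"
      using coset_self[OF weight_ideal_left_ideal[OF fJ]] by simp
    then have "completion_map D f (completion_exp C lam y) J = coset J (f (\<Sum>n\<in>N. (lam powi n) *\<^sub>C r n))"
      by (rule completion_map_coset[OF completion_exp_closed[OF assms] J])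
    also have "\<dots> = completion_exp D lam (f y) J"
    proof -
      have "completion_exp D lam (f y) J = coset J (\<Sum>n\<in>N. (lam powi n) *\<^sub>C f (r n))"
        using N by (intro completion_exp_coset J)
          (auto simp: eigenvectors_def clinear_simps[OF lin] clinear_sum[OF lin] algebra_homD[OF hom])
      then show ?thesis
        by (simp add: clinear_sum[OF lin] clinear_simps[OF lin])
    qed
    finally show ?thesis .
  qed (simp add: completion_map_def completion_exp_def)
qed

lemma (in weight_module) completion_act_exp:
  assumes "diagonal_on C y" "act y v = of_int n *\<^sub>C v"
  shows "completion_act act (completion_exp C lam y) v = (lam powi n) *\<^sub>C v"
proof -
  note K = weight_ideal_annihilator[of v]
  have simps: "act (c *\<^sub>C r) v = c *\<^sub>C act r v" "act (r - s) v = act r v - act s v" for c r s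
    by (simp_all add: clinear_simps[OF clinear_act(2)])
  have "completion_exp C lam y {r. act r v = 0} = coset {r. act r v = 0} ((lam powi n) *\<^sub>C 1)"
    using completion_exp_coset[OF K, of "{n}" "\<lambda>_. 1" y "\<lambda>n. n" lam] assms(2)
    by (simp add: eigenvectors_def simps act_one clinear_simps(3)[OF clinear_act(2)])
  then have "(lam powi n) *\<^sub>C 1 \<in> completion_exp C lam y {r. act r v = 0}"
    using coset_self[OF weight_ideal_left_ideal[OF K]] by simp
  from completion_act_eq[OF completion_exp_closed[OF assms(1)] this] show ?thesis
    by (simp add: simps act_one)
qed


section \<open>The Cartan twist\<close>

lemma clinear_span_image:
  assumes "clinear g" "v \<in> cspan A" "\<And>a. a \<in> A \<Longrightarrow> g a \<in> cspan B"
  shows "g v \<in> cspan B"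
  using assms(2)
proof (induction rule: complex_vector.span_induct_alt)
  case base
  then show ?case
    by (simp add: clinear_simps[OF assms(1)] complex_vector.span_zero)
next
  case (step c x y)
  then show ?case
    using assms(3) by (simp add: clinear_simps[OF assms(1)] complex_vector.span_add complex_vector.span_scale)
qed

lemma clinear_eq_on_span:
  assumes "clinear f" "clinear g" "\<And>a. a \<in> A \<Longrightarrow> f a = g a" "v \<in> cspan A"
  shows "f v = g v"
  using assms(4)
  by (induction rule: complex_vector.span_induct_alt)
    (simp_all add: clinear_simps[OF assms(1)] clinear_simps[OF assms(2)] assms(3))

lemma completion_homI:
  assumes "commuting_set C" "commuting_set D" "algebra_hom f" "\<And>c. c \<in> C \<Longrightarrow> diagonal_on D (f c)"
  shows "completion_hom C D f"
  using assms by (simp add: completion_hom_def completion_hom_axioms_def diagonal_on_def)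

lemma commuting_set_tensor:
  assumes "commuting_set A" "commuting_set B"
  shows "commuting_set ((\<lambda>a. a \<otimes> 1) ` A \<union> (\<lambda>b. 1 \<otimes> b) ` B)"
proof
  interpret A: commuting_set A by fact
  interpret B: commuting_set B by fact
  show "finite ((\<lambda>a. a \<otimes> 1) ` A \<union> (\<lambda>b. 1 \<otimes> b) ` B)"
    using A.finite B.finite by simp
  have A: "(a \<otimes> 1) * (a' \<otimes> 1) = (a' \<otimes> 1) * (a \<otimes> 1)" if "a \<in> A" "a' \<in> A" for a a'
    unfolding tensor_of_times using A.commute[OF that] by (rule arg_cong)
  have B: "(1 \<otimes> b) * (1 \<otimes> b') = (1 \<otimes> b') * (1 \<otimes> b)" if "b \<in> B" "b' \<in> B" for b b'
    unfolding tensor_of_times mult_1_left using B.commute[OF that] by (rule arg_cong)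
  show "c * d = d * c" if "c \<in> (\<lambda>a. a \<otimes> 1) ` A \<union> (\<lambda>b. 1 \<otimes> b) ` B"
    "d \<in> (\<lambda>a. a \<otimes> 1) ` A \<union> (\<lambda>b. 1 \<otimes> b) ` B" for c d
    using that
  proof (elim UnE imageE)
    fix a b assume "a \<in> A" "b \<in> B" "c = a \<otimes> 1" "d = 1 \<otimes> b"
    then show ?thesis by (simp add: tensor_of_times)
  next
    fix a b assume "a \<in> A" "b \<in> B" "d = a \<otimes> 1" "c = 1 \<otimes> b"
    then show ?thesis by (simp add: tensor_of_times)
  qed (simp_all only: A B)
qed

locale cartan_hopf_algebra = hopf_algebra \<Delta> \<epsilon> S
  for \<Delta> :: "'h::complex_algebra_1 \<Rightarrow> 'h \<otimes> 'h" and \<epsilon> S +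
  fixes h\<^sub>1 h\<^sub>2 :: 'h and lam :: complex
  assumes cartan: "cartan_pair \<Delta> h\<^sub>1 h\<^sub>2" and lam: "lam \<noteq> 0"
begin

abbreviation "C1 \<equiv> {h\<^sub>1, h\<^sub>2}"
abbreviation "C2 \<equiv> cartan2 C1"
abbreviation "C3 \<equiv> cartan3 C1"

lemma comm: "h\<^sub>1 * h\<^sub>2 = h\<^sub>2 * h\<^sub>1"
  using cartan by (simp only: cartan_pair_def)

lemma comm_C1: "c \<in> C1 \<Longrightarrow> d \<in> C1 \<Longrightarrow> c * d = d * c"
  using comm by (elim insertE) simp_all

lemma coprod_primitive: "h \<in> C1 \<Longrightarrow> \<Delta> h = 1 \<otimes> h + h \<otimes> 1"
  using cartan by (elim insertE) (simp_all add: cartan_pair_def)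

lemma counit_primitive:
  assumes "h \<in> C1"
  shows "\<epsilon> h = 0"
proof -
  have "\<epsilon> h *\<^sub>C (1 :: 'h) = 0"
    using counit_left[of h]
    by (auto simp: coprod_primitive[OF assms] clinear_simps[OF clinear_counit_left] counit_left_of
        counit_one scaleC_one)
  then have "\<epsilon> (\<epsilon> h *\<^sub>C 1) = 0"
    by (simp only: clinear_simps(3)[OF clinear_counit])
  then show ?thesis
    by (simp add: clinear_simps(2)[OF clinear_counit] counit_one scaleC_complex_def)
qed

sublocale C1: commuting_set C1
  by unfold_locales (simp, rule comm_C1)

sublocale C2: commuting_set C2
  unfolding cartan2_def by (intro commuting_set_tensor C1.commuting_set_axioms)

sublocale C3: commuting_set C3
  unfolding cartan3_def by (intro commuting_set_tensor C1.commuting_set_axioms C2.commuting_set_axioms)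

lemma diagonal_C2:
  assumes "h \<in> C1"
  shows "diagonal_on C2 (h \<otimes> 1)" "diagonal_on C2 (1 \<otimes> h)"
  using assms by (auto intro!: diagonal_on_mem simp: cartan2_def)

lemma diagonal_C3:
  assumes "h \<in> C1"
  shows "diagonal_on C3 (h \<otimes> 1 \<otimes> 1)" "diagonal_on C3 (1 \<otimes> h \<otimes> 1)" "diagonal_on C3 (1 \<otimes> 1 \<otimes> h)"
  using assms by (auto intro!: diagonal_on_mem simp: cartan2_def cartan3_def one_tensor_def)

sublocale L12: completion_hom C2 C3 leg12
proof (intro completion_homI C2.commuting_set_axioms C3.commuting_set_axioms algebra_hom_leg12)
  show "diagonal_on C3 (leg12 c)" if "c \<in> C2" for c
    using that by (auto simp: cartan2_def leg12_of diagonal_C3)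
qed

sublocale L23: completion_hom C2 C3 leg23
proof (intro completion_homI C2.commuting_set_axioms C3.commuting_set_axioms algebra_hom_leg23)
  show "diagonal_on C3 (leg23 c)" if "c \<in> C2" for c
    using that by (auto simp: cartan2_def leg23_def diagonal_C3)
qed

lemma coprod_left_primitive:
  assumes "h \<in> C1"
  shows "coprod_left \<Delta> (h \<otimes> t) = 1 \<otimes> h \<otimes> t + h \<otimes> 1 \<otimes> t" "coprod_left \<Delta> (1 \<otimes> t) = 1 \<otimes> 1 \<otimes> t"
  by (simp_all add: coprod_left_of[OF clinear_coprod] coprod_primitive[OF assms] tensor_of_simps coprod_one
      clinear_simps[OF clinear_tensor_assoc] tensor_assoc_of one_tensor_def)

lemma coprod_right_primitive:
  assumes "h \<in> C1"
  shows "coprod_right \<Delta> (t \<otimes> h) = t \<otimes> 1 \<otimes> h + t \<otimes> h \<otimes> 1" "coprod_right \<Delta> (t \<otimes> 1) = t \<otimes> 1 \<otimes> 1"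
  by (simp_all add: coprod_right_of[OF clinear_coprod] coprod_primitive[OF assms] tensor_of_simps coprod_one
      one_tensor_def)

sublocale CL: completion_hom C2 C3 "coprod_left \<Delta>"
proof (intro completion_homI C2.commuting_set_axioms C3.commuting_set_axioms
    algebra_hom_coprod_left algebra_hom_coprod)
  fix c assume "c \<in> C2"
  then obtain h where h: "h \<in> C1" "c = h \<otimes> 1 \<or> c = 1 \<otimes> h"
    by (auto simp: cartan2_def)
  have *: "diagonal_on C3 (1 \<otimes> h \<otimes> 1 + h \<otimes> 1 \<otimes> 1)"
    by (intro diagonal_on_simps diagonal_C3 h) (simp add: tensor_of_times)
  from h(2) show "diagonal_on C3 (coprod_left \<Delta> c)"
    by (elim disjE) (simp_all add: coprod_left_primitive[OF h(1)] * diagonal_C3[OF h(1)])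
qed

sublocale CR: completion_hom C2 C3 "coprod_right \<Delta>"
proof (intro completion_homI C2.commuting_set_axioms C3.commuting_set_axioms
    algebra_hom_coprod_right algebra_hom_coprod)
  fix c assume "c \<in> C2"
  then obtain h where h: "h \<in> C1" "c = h \<otimes> 1 \<or> c = 1 \<otimes> h"
    by (auto simp: cartan2_def)
  have *: "diagonal_on C3 (1 \<otimes> 1 \<otimes> h + 1 \<otimes> h \<otimes> 1)"
    by (intro diagonal_on_simps diagonal_C3 h) (simp add: tensor_of_times)
  from h(2) show "diagonal_on C3 (coprod_right \<Delta> c)"
    by (elim disjE) (simp_all add: coprod_right_primitive[OF h(1)] * diagonal_C3[OF h(1)])
qed

sublocale EL: completion_hom C2 C1 "counit_left \<epsilon>"
proof (intro completion_homI C2.commuting_set_axioms C1.commuting_set_axioms algebra_hom_counit_left)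
  show "diagonal_on C1 (counit_left \<epsilon> c)" if "c \<in> C2" for c
    using that diagonal_on_mem[of _ C1]
    by (auto simp: cartan2_def counit_left_of counit_primitive counit_one scaleC_one diagonal_on_simps)
qed

sublocale ER: completion_hom C2 C1 "counit_right \<epsilon>"
proof (intro completion_homI C2.commuting_set_axioms C1.commuting_set_axioms algebra_hom_counit_right)
  show "diagonal_on C1 (counit_right \<epsilon> c)" if "c \<in> C2" for c
    using that diagonal_on_mem[of _ C1]
    by (auto simp: cartan2_def counit_right_of counit_primitive counit_one scaleC_one diagonal_on_simps)
qed

abbreviation "\<Psi> \<equiv> cartan_twist lam h\<^sub>1 h\<^sub>2"
abbreviation "\<Psi>' \<equiv> cartan_twist_inverse lam h\<^sub>1 h\<^sub>2"

lemma diagonal_exponent: "diagonal_on C2 (h\<^sub>1 \<otimes> h\<^sub>2)" "diagonal_on C2 (- (h\<^sub>1 \<otimes> h\<^sub>2))"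
proof -
  have "diagonal_on C2 ((h\<^sub>1 \<otimes> 1) * (1 \<otimes> h\<^sub>2))"
    by (intro diagonal_on_simps diagonal_C2) (simp_all add: tensor_of_times)
  then show "diagonal_on C2 (h\<^sub>1 \<otimes> h\<^sub>2)"
    by (simp add: tensor_of_times)
  then show "diagonal_on C2 (- (h\<^sub>1 \<otimes> h\<^sub>2))"
    by (rule diagonal_on_simps)
qed

lemma twist_closed: "\<Psi> \<in> completion C2" "\<Psi>' \<in> completion C2"
  by (simp_all add: cartan_twist_def cartan_twist_inverse_def completion_exp_closed diagonal_exponent)

lemma twist_inverse:
  "completion_mult C2 \<Psi> \<Psi>' = completion_of C2 1" "completion_mult C2 \<Psi>' \<Psi> = completion_of C2 1"
  unfolding cartan_twist_def cartan_twist_inverse_def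
  by (subst C2.completion_exp_add; simp add: diagonal_exponent lam completion_exp_0)+

lemma tensor_of_uminus_right: "a \<otimes> (- b) = - (a \<otimes> b)"
  by (rule clinear_simps(4)[OF clinear_compose_right[OF cbilinear_tensor_of clinear_ident]])

lemma map_twist:
  "completion_map C3 leg12 \<Psi> = completion_exp C3 lam (- (h\<^sub>1 \<otimes> h\<^sub>2 \<otimes> 1))"
  "completion_map C3 leg12 \<Psi>' = completion_exp C3 lam (h\<^sub>1 \<otimes> h\<^sub>2 \<otimes> 1)"
  "completion_map C3 leg23 \<Psi> = completion_exp C3 lam (- (1 \<otimes> h\<^sub>1 \<otimes> h\<^sub>2))"
  "completion_map C3 leg23 \<Psi>' = completion_exp C3 lam (1 \<otimes> h\<^sub>1 \<otimes> h\<^sub>2)"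
  "completion_map C3 (coprod_left \<Delta>) \<Psi> = completion_exp C3 lam (- (1 \<otimes> h\<^sub>1 \<otimes> h\<^sub>2 + h\<^sub>1 \<otimes> 1 \<otimes> h\<^sub>2))"
  "completion_map C3 (coprod_left \<Delta>) \<Psi>' = completion_exp C3 lam (1 \<otimes> h\<^sub>1 \<otimes> h\<^sub>2 + h\<^sub>1 \<otimes> 1 \<otimes> h\<^sub>2)"
  "completion_map C3 (coprod_right \<Delta>) \<Psi> = completion_exp C3 lam (- (h\<^sub>1 \<otimes> 1 \<otimes> h\<^sub>2 + h\<^sub>1 \<otimes> h\<^sub>2 \<otimes> 1))"
  "completion_map C3 (coprod_right \<Delta>) \<Psi>' = completion_exp C3 lam (h\<^sub>1 \<otimes> 1 \<otimes> h\<^sub>2 + h\<^sub>1 \<otimes> h\<^sub>2 \<otimes> 1)"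
  unfolding cartan_twist_def cartan_twist_inverse_def
  by (simp_all add: L12.completion_map_exp L23.completion_map_exp CL.completion_map_exp CR.completion_map_exp
      diagonal_exponent clinear_simps(4)[OF algebra_homD(1)[OF algebra_hom_leg12]]
      tensor_of_uminus_right
      clinear_simps(4)[OF clinear_coprod_left[OF clinear_coprod]]
      clinear_simps(4)[OF clinear_coprod_right[OF clinear_coprod]]
      leg12_of leg23_def coprod_left_primitive coprod_right_primitive del: minus_add_distrib)

lemma counit_twist:
  "completion_map C1 (counit_left \<epsilon>) \<Psi> = completion_of C1 1"
  "completion_map C1 (counit_left \<epsilon>) \<Psi>' = completion_of C1 1"
  "completion_map C1 (counit_right \<epsilon>) \<Psi> = completion_of C1 1"
  "completion_map C1 (counit_right \<epsilon>) \<Psi>' = completion_of C1 1"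
  unfolding cartan_twist_def cartan_twist_inverse_def
  by (simp_all add: EL.completion_map_exp ER.completion_map_exp diagonal_exponent
      clinear_simps(4)[OF clinear_counit_left] clinear_simps(4)[OF clinear_counit_right]
      counit_left_of counit_right_of counit_primitive completion_exp_0)

lemma diagonal_exponents3:
  "diagonal_on C3 (h\<^sub>1 \<otimes> h\<^sub>2 \<otimes> 1)" "diagonal_on C3 (h\<^sub>1 \<otimes> 1 \<otimes> h\<^sub>2)" "diagonal_on C3 (1 \<otimes> h\<^sub>1 \<otimes> h\<^sub>2)"
  "diagonal_on C3 (1 \<otimes> h\<^sub>1 \<otimes> h\<^sub>2 + h\<^sub>1 \<otimes> 1 \<otimes> h\<^sub>2)"
  "diagonal_on C3 (h\<^sub>1 \<otimes> 1 \<otimes> h\<^sub>2 + h\<^sub>1 \<otimes> h\<^sub>2 \<otimes> 1)"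
proof -
  have "diagonal_on C3 ((h\<^sub>1 \<otimes> 1 \<otimes> 1) * (1 \<otimes> h\<^sub>2 \<otimes> 1))" "diagonal_on C3 ((h\<^sub>1 \<otimes> 1 \<otimes> 1) * (1 \<otimes> 1 \<otimes> h\<^sub>2))"
    "diagonal_on C3 ((1 \<otimes> h\<^sub>1 \<otimes> 1) * (1 \<otimes> 1 \<otimes> h\<^sub>2))"
    by (intro diagonal_on_simps diagonal_C3; simp add: tensor_of_times)+
  then show *: "diagonal_on C3 (h\<^sub>1 \<otimes> h\<^sub>2 \<otimes> 1)" "diagonal_on C3 (h\<^sub>1 \<otimes> 1 \<otimes> h\<^sub>2)" "diagonal_on C3 (1 \<otimes> h\<^sub>1 \<otimes> h\<^sub>2)"
    by (simp_all add: tensor_of_times)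
  show "diagonal_on C3 (1 \<otimes> h\<^sub>1 \<otimes> h\<^sub>2 + h\<^sub>1 \<otimes> 1 \<otimes> h\<^sub>2)"
    "diagonal_on C3 (h\<^sub>1 \<otimes> 1 \<otimes> h\<^sub>2 + h\<^sub>1 \<otimes> h\<^sub>2 \<otimes> 1)"
    by (intro diagonal_on_simps *; simp add: tensor_of_times)+
qed

text \<open>Both sides are the exponential of \<open>- (h\<^sub>1 \<otimes> h\<^sub>2 \<otimes> 1 + h\<^sub>1 \<otimes> 1 \<otimes> h\<^sub>2 + 1 \<otimes> h\<^sub>1 \<otimes> h\<^sub>2)\<close>.\<close>

lemma twist_identity:
  "completion_mult C3 (completion_map C3 leg12 \<Psi>) (completion_map C3 (coprod_left \<Delta>) \<Psi>) =
    completion_mult C3 (completion_map C3 leg23 \<Psi>) (completion_map C3 (coprod_right \<Delta>) \<Psi>)"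
proof -
  have "completion_mult C3 (completion_map C3 leg12 \<Psi>) (completion_map C3 (coprod_left \<Delta>) \<Psi>) =
      completion_exp C3 lam (- (h\<^sub>1 \<otimes> h\<^sub>2 \<otimes> 1) + - (1 \<otimes> h\<^sub>1 \<otimes> h\<^sub>2 + h\<^sub>1 \<otimes> 1 \<otimes> h\<^sub>2))"
    unfolding map_twist
    by (intro C3.completion_exp_add diagonal_on_simps(3) diagonal_exponents3 lam)
      (simp add: algebra_simps tensor_of_times comm)
  also have "- (h\<^sub>1 \<otimes> h\<^sub>2 \<otimes> 1) + - (1 \<otimes> h\<^sub>1 \<otimes> h\<^sub>2 + h\<^sub>1 \<otimes> 1 \<otimes> h\<^sub>2) =
      - (1 \<otimes> h\<^sub>1 \<otimes> h\<^sub>2) + - (h\<^sub>1 \<otimes> 1 \<otimes> h\<^sub>2 + h\<^sub>1 \<otimes> h\<^sub>2 \<otimes> 1)"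
    by simp
  also have "completion_exp C3 lam \<dots> =
      completion_mult C3 (completion_map C3 leg23 \<Psi>) (completion_map C3 (coprod_right \<Delta>) \<Psi>)"
    unfolding map_twist
    by (intro C3.completion_exp_add[symmetric] diagonal_on_simps(3) diagonal_exponents3 lam)
      (simp add: algebra_simps tensor_of_times comm)
  finally show ?thesis .
qed

lemma twist_inverse_identity:
  "completion_mult C3 (completion_map C3 (coprod_left \<Delta>) \<Psi>') (completion_map C3 leg12 \<Psi>') =
    completion_mult C3 (completion_map C3 (coprod_right \<Delta>) \<Psi>') (completion_map C3 leg23 \<Psi>')"
proof -
  have "completion_mult C3 (completion_map C3 (coprod_left \<Delta>) \<Psi>') (completion_map C3 leg12 \<Psi>') =
      completion_exp C3 lam ((1 \<otimes> h\<^sub>1 \<otimes> h\<^sub>2 + h\<^sub>1 \<otimes> 1 \<otimes> h\<^sub>2) + h\<^sub>1 \<otimes> h\<^sub>2 \<otimes> 1)"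
    unfolding map_twist
    by (intro C3.completion_exp_add diagonal_exponents3 lam) (simp add: algebra_simps tensor_of_times comm)
  also have "(1 \<otimes> h\<^sub>1 \<otimes> h\<^sub>2 + h\<^sub>1 \<otimes> 1 \<otimes> h\<^sub>2) + h\<^sub>1 \<otimes> h\<^sub>2 \<otimes> 1 =
      (h\<^sub>1 \<otimes> 1 \<otimes> h\<^sub>2 + h\<^sub>1 \<otimes> h\<^sub>2 \<otimes> 1) + 1 \<otimes> h\<^sub>1 \<otimes> h\<^sub>2"
    by simp
  also have "completion_exp C3 lam \<dots> =
      completion_mult C3 (completion_map C3 (coprod_right \<Delta>) \<Psi>') (completion_map C3 leg23 \<Psi>')"
    unfolding map_twist
    by (intro C3.completion_exp_add[symmetric] diagonal_exponents3 lam) (simp add: algebra_simps tensor_of_times comm)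
  finally show ?thesis .
qed

theorem completed_cartan_twist: "completed_twist \<Delta> \<epsilon> C1 \<Psi> \<Psi>'"
  unfolding completed_twist_def using twist_closed twist_inverse twist_identity counit_twist by simp

abbreviation "D \<equiv> completed_twisted_coprod \<Delta> C1 \<Psi> \<Psi>'"

lemmas closed2 = C2.completion_mult_closed completion_of_closed twist_closed
lemmas closed3 = C3.completion_mult_closed completion_of_closed
  L12.completion_map_closed L23.completion_map_closed CL.completion_map_closed CR.completion_map_closed twist_closed

lemma twist_cancel: "x \<in> completion C2 \<Longrightarrow> completion_mult C2 \<Psi>' (completion_mult C2 \<Psi> x) = x"
  by (simp add: closed2 twist_inverse C2.completion_mult_one flip: C2.completion_mult_assoc)

theorem completed_twisted_bialgebra:
  "completed_bialgebra C1 D (completed_coprod_left \<Delta> C1 \<Psi> \<Psi>') (completed_coprod_right \<Delta> C1 \<Psi> \<Psi>') \<epsilon>"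
  unfolding completed_bialgebra_def
proof (intro conjI allI)
  show "D t \<in> completion C2" for t
    by (simp add: completed_twisted_coprod_def closed2)
  show "D (s * t) = completion_mult C2 (D s) (D t)" for s t
    by (simp add: completed_twisted_coprod_def coprod_mult C2.completion_mult_assoc closed2 twist_cancel
        flip: C2.completion_of_mult)
  show "D 1 = completion_of C2 1"
    by (simp add: completed_twisted_coprod_def coprod_one C2.completion_mult_one closed2 twist_inverse)
  show "completion_map C1 (counit_left \<epsilon>) (D t) = completion_of C1 t" for t
    by (simp add: completed_twisted_coprod_def EL.completion_map_mult EL.completion_map_of closed2 counit_twist
        counit_left C1.completion_mult_one)
  show "completion_map C1 (counit_right \<epsilon>) (D t) = completion_of C1 t" for t
    by (simp add: completed_twisted_coprod_def ER.completion_map_mult ER.completion_map_of closed2 counit_twist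
        counit_right C1.completion_mult_one)
  show "completed_coprod_left \<Delta> C1 \<Psi> \<Psi>' (D t) = completed_coprod_right \<Delta> C1 \<Psi> \<Psi>' (D t)" for t
  proof -
    let ?m = "completion_mult C3"
    have "completed_coprod_left \<Delta> C1 \<Psi> \<Psi>' (D t) =
        ?m (?m (completion_map C3 leg12 \<Psi>) (completion_map C3 (coprod_left \<Delta>) \<Psi>))
          (?m (completion_of C3 (coprod_left \<Delta> (\<Delta> t)))
            (?m (completion_map C3 (coprod_left \<Delta>) \<Psi>') (completion_map C3 leg12 \<Psi>')))"
      by (simp add: completed_coprod_left_def completed_twisted_coprod_def CL.completion_map_mult
          CL.completion_map_of closed2 closed3 C3.completion_mult_assoc)
    also have "\<dots> = completed_coprod_right \<Delta> C1 \<Psi> \<Psi>' (D t)"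
      unfolding twist_identity twist_inverse_identity coassoc
      by (simp add: completed_coprod_right_def completed_twisted_coprod_def CR.completion_map_mult
          CR.completion_map_of closed2 closed3 C3.completion_mult_assoc)
    finally show ?thesis .
  qed
qed

end


section \<open>The isospectral deformation\<close>

text \<open>A representative modulo the annihilator of \<open>v\<close> is also one modulo the larger annihilator of \<open>Q v\<close>.\<close>

lemma completion_act_equivariant:
  assumes "weight_module C act" "weight_module C act'" "clinear Q" "\<And>r v. Q (act r v) = act' r (Q v)"
    and x: "x \<in> completion C"
  shows "Q (completion_act act x v) = completion_act act' x (Q v)"
proof -
  interpret V: weight_module C act by fact
  interpret V': weight_module C act' by fact
  obtain r where r: "r \<in> x {r. act r v = 0}"
    by (rule completion_nonempty[OF x V.weight_ideal_annihilator])
  have "{r. act r v = 0} \<subseteq> {r. act' r (Q v) = 0}"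
    by (auto simp: clinear_simps[OF assms(3)] simp flip: assms(4))
  from completion_mono[OF x V.weight_ideal_annihilator V'.weight_ideal_annihilator this r]
  show ?thesis
    by (simp add: V.completion_act_eq[OF x r] V'.completion_act_eq[OF x] assms(4))
qed

locale isospectral_module = cartan_hopf_algebra \<Delta> \<epsilon> S h\<^sub>1 h\<^sub>2 lam + module_algebra \<Delta> \<epsilon> S act m e
  for \<Delta> :: "'h::complex_algebra_1 \<Rightarrow> 'h \<otimes> 'h" and \<epsilon> S h\<^sub>1 h\<^sub>2 lam
    and act :: "'h \<Rightarrow> 'a::complex_vector \<Rightarrow> 'a" and m e +
  assumes homogeneous_span: "cspan {a. \<exists>n\<^sub>1 n\<^sub>2. homogeneous act h\<^sub>1 h\<^sub>2 n\<^sub>1 n\<^sub>2 a} = UNIV"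
begin

abbreviation "tact \<equiv> tensor_action act"

lemma homogeneous_induct:
  assumes "clinear f" "clinear g" "\<And>n\<^sub>1 n\<^sub>2 a. homogeneous act h\<^sub>1 h\<^sub>2 n\<^sub>1 n\<^sub>2 a \<Longrightarrow> f a = g a"
  shows "f a = g a"
  by (rule clinear_eq_on_span[OF assms(1,2), of "{a. \<exists>n\<^sub>1 n\<^sub>2. homogeneous act h\<^sub>1 h\<^sub>2 n\<^sub>1 n\<^sub>2 a}"])
    (use assms(3) homogeneous_span in auto)

sublocale tensor: weight_module C2 tact
proof (intro weight_module.intro weight_module_axioms.intro C2.commuting_set_axioms
    left_action_tensor left_action_axioms)
  fix c assume "c \<in> C2"
  then obtain h where h: "h \<in> C1" "c = h \<otimes> 1 \<or> c = 1 \<otimes> h"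
    by (auto simp: cartan2_def)
  let ?E = "\<Union>n. eigenvectors (tact c) {0} n"
  let ?H = "{a. \<exists>n::int. act h a = of_int n *\<^sub>C a}"
  have "{a. \<exists>n\<^sub>1 n\<^sub>2. homogeneous act h\<^sub>1 h\<^sub>2 n\<^sub>1 n\<^sub>2 a} \<subseteq> ?H"
    using h(1) by (auto simp: homogeneous_def)
  then have H: "a \<in> cspan ?H" for a
    using complex_vector.span_mono homogeneous_span by blast
  note lin = clinear_compose_left[OF cbilinear_tensor_of clinear_ident]
    clinear_compose_right[OF cbilinear_tensor_of clinear_ident]
  have pure: "a \<otimes> b \<in> cspan ?E" for a b
  proof (cases "c = h \<otimes> 1")
    case True
    have "a' \<otimes> b \<in> cspan ?E" if "a' \<in> ?H" for a'
      using that by (intro complex_vector.span_base)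
        (auto simp: True eigenvectors_def tensor_action_of(2)[OF act_bilinear] act_one tensor_of_simps)
    then show ?thesis
      by (rule clinear_span_image[OF lin(1) H])
  next
    case False
    then have c: "c = 1 \<otimes> h"
      using h(2) by simp
    have "a \<otimes> b' \<in> cspan ?E" if "b' \<in> ?H" for b'
      using that by (intro complex_vector.span_base)
        (auto simp: c eigenvectors_def tensor_action_of(2)[OF act_bilinear] act_one tensor_of_simps)
    then show ?thesis
      by (rule clinear_span_image[OF lin(2) H])
  qed
  have "x \<in> cspan ?E" for x
    by (induction x) (simp_all add: pure complex_vector.span_add)
  then show "cspan ?E = UNIV"
    by blast
qed

abbreviation "cact \<equiv> completion_act tact"

definition star :: "'a \<Rightarrow> 'a \<Rightarrow> 'a"
  where "star a b = tensor_lift m (cact \<Psi>' (a \<otimes> b))"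

lemma twist_act_homogeneous:
  assumes "homogeneous act h\<^sub>1 h\<^sub>2 n\<^sub>1 n\<^sub>2 a" "homogeneous act h\<^sub>1 h\<^sub>2 k\<^sub>1 k\<^sub>2 b"
  shows "cact \<Psi> (a \<otimes> b) = (lam powi (- (n\<^sub>1 * k\<^sub>2))) *\<^sub>C (a \<otimes> b)"
    and "cact \<Psi>' (a \<otimes> b) = (lam powi (n\<^sub>1 * k\<^sub>2)) *\<^sub>C (a \<otimes> b)"
proof -
  have *: "tact (h\<^sub>1 \<otimes> h\<^sub>2) (a \<otimes> b) = of_int (n\<^sub>1 * k\<^sub>2) *\<^sub>C (a \<otimes> b)"
    using assms by (simp add: tensor_action_of(2)[OF act_bilinear] homogeneous_def tensor_of_simps
        scaleC_scaleC mult.commute)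
  then have "tact (- (h\<^sub>1 \<otimes> h\<^sub>2)) (a \<otimes> b) = of_int (- (n\<^sub>1 * k\<^sub>2)) *\<^sub>C (a \<otimes> b)"
    by (simp add: clinear_simps[OF tensor.clinear_act(2)])
  then show "cact \<Psi> (a \<otimes> b) = (lam powi (- (n\<^sub>1 * k\<^sub>2))) *\<^sub>C (a \<otimes> b)"
    unfolding cartan_twist_def by (rule tensor.completion_act_exp[OF diagonal_exponent(2)])
  from * show "cact \<Psi>' (a \<otimes> b) = (lam powi (n\<^sub>1 * k\<^sub>2)) *\<^sub>C (a \<otimes> b)"
    unfolding cartan_twist_inverse_def by (rule tensor.completion_act_exp[OF diagonal_exponent(1)])
qed

lemma star_homogeneous:
  assumes "homogeneous act h\<^sub>1 h\<^sub>2 n\<^sub>1 n\<^sub>2 a" "homogeneous act h\<^sub>1 h\<^sub>2 k\<^sub>1 k\<^sub>2 b"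
  shows "star a b = (lam powi (n\<^sub>1 * k\<^sub>2)) *\<^sub>C m a b"
  by (simp add: star_def twist_act_homogeneous[OF assms] tensor_lift_simps[OF bilinear] tensor_lift_of[OF bilinear])

lemmas clinear_cact = clinear_compose[OF tensor.clinear_completion_act]

lemma cbilinear_star: "cbilinear star"
  unfolding star_def[abs_def]
  by (intro cbilinearI' clinear_compose[OF clinear_tensor_lift[OF bilinear]] clinear_cact twist_closed clinear_intros)

lemmas star_intros = clinear_intros clinear_compose_left[OF cbilinear_star] clinear_compose_right[OF cbilinear_star]

lemma act_primitive_product: "h \<in> C1 \<Longrightarrow> act h (m a b) = m a (act h b) + m (act h a) b"
  using act_action_product[of h 1 a b]
  by (simp add: one_tensor_def action_product_of act_one coprod_primitive algebra_simps tensor_of_times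
      clinear_simps(1)[OF action_product_linear(1)[OF clinear_ident]])

lemma homogeneous_mult:
  assumes "homogeneous act h\<^sub>1 h\<^sub>2 n\<^sub>1 n\<^sub>2 a" "homogeneous act h\<^sub>1 h\<^sub>2 k\<^sub>1 k\<^sub>2 b"
  shows "homogeneous act h\<^sub>1 h\<^sub>2 (n\<^sub>1 + k\<^sub>1) (n\<^sub>2 + k\<^sub>2) (m a b)"
  using assms
  by (simp add: homogeneous_def act_primitive_product cbilinear_simps[OF bilinear] scaleC_add_left add.commute)

lemma homogeneous_unit: "homogeneous act h\<^sub>1 h\<^sub>2 0 0 e"
  by (simp add: homogeneous_def act_unit counit_primitive)

lemma star_assoc: "star (star a b) c = star a (star b c)"
proof (rule homogeneous_induct[of "\<lambda>a. star (star a b) c"])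
  fix n\<^sub>1 n\<^sub>2 a assume a: "homogeneous act h\<^sub>1 h\<^sub>2 n\<^sub>1 n\<^sub>2 a"
  show "star (star a b) c = star a (star b c)"
  proof (rule homogeneous_induct[of "\<lambda>b. star (star a b) c"])
    fix k\<^sub>1 k\<^sub>2 b assume b: "homogeneous act h\<^sub>1 h\<^sub>2 k\<^sub>1 k\<^sub>2 b"
    show "star (star a b) c = star a (star b c)"
    proof (rule homogeneous_induct[of "\<lambda>c. star (star a b) c"])
      fix l\<^sub>1 l\<^sub>2 c assume c: "homogeneous act h\<^sub>1 h\<^sub>2 l\<^sub>1 l\<^sub>2 c"
      have "star (star a b) c = (lam powi (n\<^sub>1 * k\<^sub>2) * lam powi ((n\<^sub>1 + k\<^sub>1) * l\<^sub>2)) *\<^sub>C m (m a b) c"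
        using star_homogeneous[OF homogeneous_mult[OF a b] c]
        by (simp add: star_homogeneous[OF a b] cbilinear_simps[OF cbilinear_star] scaleC_scaleC)
      moreover have "star a (star b c) = (lam powi (k\<^sub>1 * l\<^sub>2) * lam powi (n\<^sub>1 * (k\<^sub>2 + l\<^sub>2))) *\<^sub>C m a (m b c)"
        using star_homogeneous[OF a homogeneous_mult[OF b c]]
        by (simp add: star_homogeneous[OF b c] cbilinear_simps[OF cbilinear_star] scaleC_scaleC)
      ultimately show "star (star a b) c = star a (star b c)"
        using lam by (simp add: assoc power_int_add[symmetric] algebra_simps)
    qed (intro star_intros)+
  qed (intro star_intros)+
qed (intro star_intros)+

lemma star_unit: "star e a = a" "star a e = a"
proof -
  show "star e a = a"
    by (rule homogeneous_induct[of "star e" "\<lambda>a. a"])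
      ((intro star_intros)+, simp add: star_homogeneous[OF homogeneous_unit] left_unit scaleC_one)
  show "star a e = a"
    by (rule homogeneous_induct[of "\<lambda>a. star a e" "\<lambda>a. a"])
      ((intro star_intros)+, simp add: star_homogeneous[OF _ homogeneous_unit] right_unit scaleC_one)
qed

lemma tensor_lift_star: "tensor_lift star v = tensor_lift m (cact \<Psi>' v)"
proof (rule tensor_ext[of "tensor_lift star"])
  show "clinear (\<lambda>v. tensor_lift m (cact \<Psi>' v))"
    by (intro clinear_compose[OF clinear_tensor_lift[OF bilinear]] tensor.clinear_completion_act twist_closed)
qed (simp_all add: clinear_tensor_lift[OF cbilinear_star] tensor_lift_of[OF cbilinear_star] star_def)

lemma tensor_lift_coprod: "tensor_lift m (tact (\<Delta> t) v) = act t (tensor_lift m v)"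
proof (rule tensor_ext[of "\<lambda>v. tensor_lift m (tact (\<Delta> t) v)" "\<lambda>v. act t (tensor_lift m v)" v])
  show "clinear (\<lambda>v. tensor_lift m (tact (\<Delta> t) v))" "clinear (\<lambda>v. act t (tensor_lift m v))"
    by (intro clinear_compose[OF clinear_tensor_lift[OF bilinear]] tensor.clinear_act
        clinear_compose_right[OF act_bilinear] clinear_tensor_lift bilinear)+
  show "tensor_lift m (tact (\<Delta> t) (a \<otimes> b)) = act t (tensor_lift m (a \<otimes> b))" for a b
    using act_product[of t a b]
    by (simp add: action_product_eq[symmetric] action_product_def tensor_lift_of[OF bilinear])
qed

theorem completed_star_module_algebra: "completed_module_algebra D \<epsilon> act star e"
  unfolding completed_module_algebra_def
proof (intro conjI allI)
  show "left_action act"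
    by (fact left_action_axioms)
  show "unital_algebra star e"
    by (rule unital_algebra.intro) (fact cbilinear_star star_assoc star_unit)+
  show "act t e = \<epsilon> t *\<^sub>C e" for t
    by (fact act_unit)
  show "act t (star a b) = tensor_lift star (cact (D t) (a \<otimes> b))" for t a b
  proof -
    have "tensor_lift star (cact (D t) (a \<otimes> b)) = tensor_lift m (cact (completion_mult C2 \<Psi>' (D t)) (a \<otimes> b))"
      by (simp add: tensor_lift_star tensor.completion_act_mult closed2 completed_twisted_coprod_def)
    also have "completion_mult C2 \<Psi>' (D t) = completion_mult C2 (completion_of C2 (\<Delta> t)) \<Psi>'"
      by (simp add: completed_twisted_coprod_def C2.completion_mult_assoc closed2 twist_cancel)
    also have "tensor_lift m (cact \<dots> (a \<otimes> b)) = act t (star a b)"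
      by (simp add: tensor.completion_act_mult closed2 tensor.completion_act_of tensor_lift_coprod star_def)
    finally show ?thesis ..
  qed
qed

end

lemma quantized_isospectral_module:
  assumes q: "clinear q" "bij q" and "isospectral_module \<Delta> \<epsilon> S h\<^sub>1 h\<^sub>2 lam act m e"
  shows "isospectral_module \<Delta> \<epsilon> S h\<^sub>1 h\<^sub>2 lam (quantized_action q act) (\<lambda>x y. q (m (inv q x) (inv q y))) (q e)"
proof -
  interpret isospectral_module \<Delta> \<epsilon> S h\<^sub>1 h\<^sub>2 lam act m e by fact
  have "x \<in> cspan {x. \<exists>n\<^sub>1 n\<^sub>2. homogeneous (quantized_action q act) h\<^sub>1 h\<^sub>2 n\<^sub>1 n\<^sub>2 x}" for x
  proof -
    have "q (inv q x) \<in> cspan {x. \<exists>n\<^sub>1 n\<^sub>2. homogeneous (quantized_action q act) h\<^sub>1 h\<^sub>2 n\<^sub>1 n\<^sub>2 x}"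
    proof (rule clinear_span_image[OF q(1)])
      show "inv q x \<in> cspan {a. \<exists>n\<^sub>1 n\<^sub>2. homogeneous act h\<^sub>1 h\<^sub>2 n\<^sub>1 n\<^sub>2 a}"
        by (simp add: homogeneous_span)
      fix a assume "a \<in> {a. \<exists>n\<^sub>1 n\<^sub>2. homogeneous act h\<^sub>1 h\<^sub>2 n\<^sub>1 n\<^sub>2 a}"
      then show "q a \<in> cspan {x. \<exists>n\<^sub>1 n\<^sub>2. homogeneous (quantized_action q act) h\<^sub>1 h\<^sub>2 n\<^sub>1 n\<^sub>2 x}"
        by (intro complex_vector.span_base)
          (auto simp: homogeneous_def quantized_action_def bij_clinear_inv[OF q] clinear_simps[OF q(1)])
    qed
    then show ?thesis
      by (simp add: bij_clinear_inv[OF q])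
  qed
  then show ?thesis
    by (intro isospectral_module.intro isospectral_module_axioms.intro cartan_hopf_algebra_axioms
        quantized_module_algebra[OF q] module_algebra_axioms) blast
qed

section \<open>The action on the deformed algebra\<close>

theorem mainTheorem1:
  fixes \<Delta> :: "'h::complex_algebra_1 \<Rightarrow> 'h \<otimes> 'h"
    and \<epsilon> :: "'h \<Rightarrow> complex"
    and S :: "'h \<Rightarrow> 'h"
    and act :: "'h \<Rightarrow> 'a::complex_vector \<Rightarrow> 'a"
    and m :: "'a \<Rightarrow> 'a \<Rightarrow> 'a"
    and e :: 'a
    and q :: "'a \<Rightarrow> 'b::complex_vector"
  assumes "module_algebra \<Delta> \<epsilon> S act m e"
    and "clinear q" and "bij q"
  shows "(\<forall>t a. quantized_action q act t (q a) = q (act t a)) \<and>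
    (\<forall>\<Psi>. drinfeld_twist \<Delta> \<epsilon> \<Psi> \<longrightarrow>
      module_algebra (twisted_coprod \<Delta> \<Psi>) \<epsilon> (twisted_antipode S \<Psi>)
        (quantized_action q act) (deformed_product q act m \<Psi>) (q e)) \<and>
    (\<forall>h\<^sub>1 h\<^sub>2 lam \<Psi> \<Psi>'. cartan_pair \<Delta> h\<^sub>1 h\<^sub>2 \<longrightarrow>
      complex_vector.span {a. \<exists>n\<^sub>1 n\<^sub>2. homogeneous act h\<^sub>1 h\<^sub>2 n\<^sub>1 n\<^sub>2 a} = UNIV \<longrightarrow>
      cmod lam = 1 \<longrightarrow>
      \<Psi> = cartan_twist lam h\<^sub>1 h\<^sub>2 \<longrightarrow> \<Psi>' = cartan_twist_inverse lam h\<^sub>1 h\<^sub>2 \<longrightarrow>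
        completed_twist \<Delta> \<epsilon> {h\<^sub>1, h\<^sub>2} \<Psi> \<Psi>' \<and>
        (\<forall>n\<^sub>1 n\<^sub>2 k\<^sub>1 k\<^sub>2 a b. homogeneous act h\<^sub>1 h\<^sub>2 n\<^sub>1 n\<^sub>2 a \<longrightarrow> homogeneous act h\<^sub>1 h\<^sub>2 k\<^sub>1 k\<^sub>2 b \<longrightarrow>
          completion_act (tensor_action act) \<Psi> (a \<otimes> b) = (lam powi (- (n\<^sub>1 * k\<^sub>2))) *\<^sub>C (a \<otimes> b) \<and>
          completed_deformed_product q act m \<Psi>' (q a) (q b) = (lam powi (n\<^sub>1 * k\<^sub>2)) *\<^sub>C q (m a b)) \<and>
        completed_bialgebra {h\<^sub>1, h\<^sub>2} (completed_twisted_coprod \<Delta> {h\<^sub>1, h\<^sub>2} \<Psi> \<Psi>')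
          (completed_coprod_left \<Delta> {h\<^sub>1, h\<^sub>2} \<Psi> \<Psi>') (completed_coprod_right \<Delta> {h\<^sub>1, h\<^sub>2} \<Psi> \<Psi>') \<epsilon> \<and>
        completed_module_algebra (completed_twisted_coprod \<Delta> {h\<^sub>1, h\<^sub>2} \<Psi> \<Psi>') \<epsilon>
          (quantized_action q act) (completed_deformed_product q act m \<Psi>') (q e))"
proof (intro conjI)
  interpret module_algebra \<Delta> \<epsilon> S act m e by fact
  note q = assms(2,3)
  note q_inv = bij_clinear_inv(2,3)[OF q]
  show "\<forall>t a. quantized_action q act t (q a) = q (act t a)"
    by (simp add: quantized_action_def q_inv)
  show "\<forall>\<Psi>. drinfeld_twist \<Delta> \<epsilon> \<Psi> \<longrightarrow>
      module_algebra (twisted_coprod \<Delta> \<Psi>) \<epsilon> (twisted_antipode S \<Psi>)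
        (quantized_action q act) (deformed_product q act m \<Psi>) (q e)"
    unfolding deformed_product_eq[OF q act_bilinear bilinear]
    using module_algebra.deformed_module_algebra[OF quantized_module_algebra[OF q assms(1)]] by blast
  show "\<forall>h\<^sub>1 h\<^sub>2 lam \<Psi> \<Psi>'. cartan_pair \<Delta> h\<^sub>1 h\<^sub>2 \<longrightarrow>
      complex_vector.span {a. \<exists>n\<^sub>1 n\<^sub>2. homogeneous act h\<^sub>1 h\<^sub>2 n\<^sub>1 n\<^sub>2 a} = UNIV \<longrightarrow>
      cmod lam = 1 \<longrightarrow>
      \<Psi> = cartan_twist lam h\<^sub>1 h\<^sub>2 \<longrightarrow> \<Psi>' = cartan_twist_inverse lam h\<^sub>1 h\<^sub>2 \<longrightarrow>
        completed_twist \<Delta> \<epsilon> {h\<^sub>1, h\<^sub>2} \<Psi> \<Psi>' \<and>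
        (\<forall>n\<^sub>1 n\<^sub>2 k\<^sub>1 k\<^sub>2 a b. homogeneous act h\<^sub>1 h\<^sub>2 n\<^sub>1 n\<^sub>2 a \<longrightarrow> homogeneous act h\<^sub>1 h\<^sub>2 k\<^sub>1 k\<^sub>2 b \<longrightarrow>
          completion_act (tensor_action act) \<Psi> (a \<otimes> b) = (lam powi (- (n\<^sub>1 * k\<^sub>2))) *\<^sub>C (a \<otimes> b) \<and>
          completed_deformed_product q act m \<Psi>' (q a) (q b) = (lam powi (n\<^sub>1 * k\<^sub>2)) *\<^sub>C q (m a b)) \<and>
        completed_bialgebra {h\<^sub>1, h\<^sub>2} (completed_twisted_coprod \<Delta> {h\<^sub>1, h\<^sub>2} \<Psi> \<Psi>')
          (completed_coprod_left \<Delta> {h\<^sub>1, h\<^sub>2} \<Psi> \<Psi>') (completed_coprod_right \<Delta> {h\<^sub>1, h\<^sub>2} \<Psi> \<Psi>') \<epsilon> \<and>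
        completed_module_algebra (completed_twisted_coprod \<Delta> {h\<^sub>1, h\<^sub>2} \<Psi> \<Psi>') \<epsilon>
          (quantized_action q act) (completed_deformed_product q act m \<Psi>') (q e)"
  proof (intro allI impI)
    fix h\<^sub>1 h\<^sub>2 lam \<Psi> \<Psi>'
    assume cartan: "cartan_pair \<Delta> h\<^sub>1 h\<^sub>2"
      and span: "complex_vector.span {a. \<exists>n\<^sub>1 n\<^sub>2. homogeneous act h\<^sub>1 h\<^sub>2 n\<^sub>1 n\<^sub>2 a} = UNIV"
      and "cmod lam = 1" and \<Psi>: "\<Psi> = cartan_twist lam h\<^sub>1 h\<^sub>2" "\<Psi>' = cartan_twist_inverse lam h\<^sub>1 h\<^sub>2"
    then have "lam \<noteq> 0"
      by auto
    with cartan span interpret A: isospectral_module \<Delta> \<epsilon> S h\<^sub>1 h\<^sub>2 lam act m e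
      by unfold_locales
    define m' where "m' = (\<lambda>x y. q (m (inv q x) (inv q y)))"
    interpret B: isospectral_module \<Delta> \<epsilon> S h\<^sub>1 h\<^sub>2 lam "quantized_action q act" m' "q e"
      unfolding m'_def by (rule quantized_isospectral_module[OF q A.isospectral_module_axioms])
    have "completed_deformed_product q act m \<Psi>' = B.star"
    proof (intro ext)
      fix x y
      have "tensor_map q q (A.cact \<Psi>' (inv q x \<otimes> inv q y)) = B.cact \<Psi>' (tensor_map q q (inv q x \<otimes> inv q y))"
        by (rule completion_act_equivariant[OF A.tensor.weight_module_axioms B.tensor.weight_module_axioms])
          (simp_all add: clinear_tensor_map q quantized_tensor_action[OF q act_bilinear] \<Psi> A.twist_closed)
      then show "completed_deformed_product q act m \<Psi>' x y = B.star x y"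
        by (simp add: completed_deformed_product_def B.star_def quantized_tensor_lift[OF q bilinear]
            tensor_map_of[OF q(1) q(1)] q_inv \<Psi> flip: m'_def)
    qed
    moreover have "completed_deformed_product q act m \<Psi>' (q a) (q b) = q (A.star a b)" for a b
      by (simp add: completed_deformed_product_def A.star_def q_inv \<Psi>)
    ultimately show "completed_twist \<Delta> \<epsilon> {h\<^sub>1, h\<^sub>2} \<Psi> \<Psi>' \<and>
        (\<forall>n\<^sub>1 n\<^sub>2 k\<^sub>1 k\<^sub>2 a b. homogeneous act h\<^sub>1 h\<^sub>2 n\<^sub>1 n\<^sub>2 a \<longrightarrow> homogeneous act h\<^sub>1 h\<^sub>2 k\<^sub>1 k\<^sub>2 b \<longrightarrow>
          completion_act (tensor_action act) \<Psi> (a \<otimes> b) = (lam powi (- (n\<^sub>1 * k\<^sub>2))) *\<^sub>C (a \<otimes> b) \<and>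
          completed_deformed_product q act m \<Psi>' (q a) (q b) = (lam powi (n\<^sub>1 * k\<^sub>2)) *\<^sub>C q (m a b)) \<and>
        completed_bialgebra {h\<^sub>1, h\<^sub>2} (completed_twisted_coprod \<Delta> {h\<^sub>1, h\<^sub>2} \<Psi> \<Psi>')
          (completed_coprod_left \<Delta> {h\<^sub>1, h\<^sub>2} \<Psi> \<Psi>') (completed_coprod_right \<Delta> {h\<^sub>1, h\<^sub>2} \<Psi> \<Psi>') \<epsilon> \<and>
        completed_module_algebra (completed_twisted_coprod \<Delta> {h\<^sub>1, h\<^sub>2} \<Psi> \<Psi>') \<epsilon>
          (quantized_action q act) (completed_deformed_product q act m \<Psi>') (q e)"
      using A.completed_cartan_twist A.completed_twisted_bialgebra B.completed_star_module_algebra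
        A.twist_act_homogeneous(1) A.star_homogeneous
      by (simp add: \<Psi> clinear_simps[OF q(1)])
  qed
qed

end
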